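(* Let $\alpha\in(1,2]$ and let $\mathbf{S}(n)=\sum_{i=1}^n\mathbf{Y}_i$, $\mathbf{S}(0)=0$, be a random walk in $\mathbb{R}^d$ with i.i.d. steps with $\mathbb{E}[\mathbf{Y}_1]=0$, such that $$\frac{\mathbf{S}(n)}{b_n}\xrightarrow[n\to\infty]{\mathcal{D}}\mathbf{X}(1)$$ for a sequence $b_n>0$ and an $\alpha$-stable Lévy process $\{\mathbf{X}(t)\}_{t\ge0}$ in $\mathbb{R}^d$. Then $$\mathbb{E}\bigl[V_1\bigl(\mathrm{conv}\,\mathbf{X}[0,1]\bigr)\bigr]=\alpha\,\mathbb{E}\bigl[\|\mathbf{X}(1)\|\bigr].$$
   Context: $\mathrm{conv}$ is the convex hull and $\mathbf{X}[0,1]=\mathrm{cl}\{\mathbf{X}(t):t\in[0,1]\}$ for the càdlàg process $\mathbf{X}$; $\|\cdot\|$ is the Euclidean norm. In the normalization $b_n=n^{1/\alpha}\ell(n)$ with $\ell$ slowly varying at infinity. $V_1$ is the first intrinsic volume; intrinsic volumes $V_0(A),\dots,V_d(A)$ of a convex body $A\subset\mathbb{R}^d$ are defined by the Steiner formula $\mathrm{Vol}_d(A+\rho B^d)=\sum_{m=0}^d\rho^{d-m}\kappa_{d-m}V_m(A)$, $\rho\ge0$, where $B^d$ is the closed unit ball and $\kappa_d=\mathrm{Vol}_d(B^d)$. *)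

theory Defs
  imports "HOL-Probability.Probability"
begin

text \<open>
  The sequence of intrinsic volumes is the unique solution of the Steiner formula.  The clause
  for \<open>k > DIM('a)\<close> only fixes the values at indices the formula does not mention.  The number
  \<open>unit_ball_vol (real j)\<close> is the volume of the closed unit ball in dimension \<open>j\<close>.
  The definition is meaningful for nonempty compact convex sets.
\<close>

definition intrinsic_volume :: "nat \<Rightarrow> 'a::euclidean_space set \<Rightarrow> real" where
  "intrinsic_volume m A =
     (THE V :: nat \<Rightarrow> real.
        (\<forall>\<rho>\<ge>0. measure lborel {a + \<rho> *\<^sub>R u | a u. a \<in> A \<and> u \<in> cball 0 1} =
                (\<Sum>k\<le>DIM('a). \<rho> ^ (DIM('a) - k) * unit_ball_vol (real (DIM('a) - k)) * V k)) \<and>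
        (\<forall>k>DIM('a). V k = 0)) m"

text \<open>The library's \<open>weak_conv_m\<close> is restricted to measures on the real line.\<close>

definition weakly_converges ::
    "(nat \<Rightarrow> 'a::topological_space measure) \<Rightarrow> 'a measure \<Rightarrow> bool" where
  "weakly_converges \<mu> \<nu> \<longleftrightarrow>
     (\<forall>f :: 'a \<Rightarrow> real. continuous_on UNIV f \<and> bounded (range f) \<longrightarrow>
        (\<lambda>n. \<integral>x. f x \<partial>\<mu> n) \<longlonglongrightarrow> (\<integral>x. f x \<partial>\<nu>))"

definition slowly_varying :: "(real \<Rightarrow> real) \<Rightarrow> bool" where
  "slowly_varying l \<longleftrightarrow>
     l \<in> borel_measurable (restrict_space borel {0<..}) \<and> (\<forall>x>0. l x > 0) \<and>
     (\<forall>c>0. ((\<lambda>x. l (c * x) / l x) \<longlongrightarrow> 1) at_top)"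

text \<open>Only times \<open>t \<ge> 0\<close> are relevant, although paths are functions on all of \<open>real\<close>.\<close>

definition cadlag :: "(real \<Rightarrow> 'a::topological_space) \<Rightarrow> bool" where
  "cadlag x \<longleftrightarrow>
     (\<forall>t\<ge>0. (x \<longlongrightarrow> x t) (at_right t)) \<and> (\<forall>t>0. \<exists>y. (x \<longlongrightarrow> y) (at_left t))"

text \<open>
  Stochastic continuity is not listed: it follows from right-continuity of the paths and
  stationarity of the increments.  Every path is required to be cadlag, rather than almost every
  path, so that path functionals are measurable even when \<open>M\<close> is not complete.
\<close>

definition levy_process ::
    "'p measure \<Rightarrow> (real \<Rightarrow> 'p \<Rightarrow> 'a::euclidean_space) \<Rightarrow> bool" where
  "levy_process M X \<longleftrightarrow>
     prob_space M \<and>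
     (\<forall>t\<ge>0. X t \<in> borel_measurable M) \<and>
     (AE \<omega> in M. X 0 \<omega> = 0) \<and>
     (\<forall>(n::nat) t. 0 \<le> t 0 \<and> (\<forall>i<n. t i \<le> t (Suc i)) \<longrightarrow>
        prob_space.indep_vars M (\<lambda>_. borel) (\<lambda>i \<omega>. X (t (Suc i)) \<omega> - X (t i) \<omega>) {..<n}) \<and>
     (\<forall>s\<ge>0. \<forall>t\<ge>0. distr M borel (\<lambda>\<omega>. X (s + t) \<omega> - X s \<omega>) = distr M borel (X t)) \<and>
     (\<forall>\<omega>\<in>space M. cadlag (\<lambda>t. X t \<omega>))"

text \<open>
  For independent \<open>Z, Z'\<close> with law \<open>\<mu>\<close>, the vector \<open>p Z + q Z'\<close> is distributed as
  \<open>(p\<^sup>\<alpha> + q\<^sup>\<alpha>)\<^bsup>1/\<alpha>\<^esup> Z + v\<close> for some deterministic \<open>v\<close>.  Strict stability (\<open>v = 0\<close>) and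
  nondegeneracy are not required.
\<close>

definition stable_law :: "real \<Rightarrow> 'a::euclidean_space measure \<Rightarrow> bool" where
  "stable_law \<alpha> \<mu> \<longleftrightarrow>
     (\<forall>p>0. \<forall>q>0. \<exists>v.
        distr (\<mu> \<Otimes>\<^sub>M \<mu>) borel (\<lambda>(x, y). p *\<^sub>R x + q *\<^sub>R y) =
        distr \<mu> borel (\<lambda>x. ((p powr \<alpha> + q powr \<alpha>) powr (1 / \<alpha>)) *\<^sub>R x + v))"

definition stable_levy_process ::
    "real \<Rightarrow> 'p measure \<Rightarrow> (real \<Rightarrow> 'p \<Rightarrow> 'a::euclidean_space) \<Rightarrow> bool" where
  "stable_levy_process \<alpha> M X \<longleftrightarrow> levy_process M X \<and> stable_law \<alpha> (distr M borel (X 1))"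

definition path_range :: "(real \<Rightarrow> 'p \<Rightarrow> 'a::topological_space) \<Rightarrow> 'p \<Rightarrow> 'a set" where
  "path_range X \<omega> = closure ((\<lambda>t. X t \<omega>) ` {0..1})"

end

theory Submission
  imports Defs "HOL-Computational_Algebra.Polynomial"
begin

text \<open>
  The first intrinsic volume is a Gaussian mean width,
  \<open>V\<^sub>1(A) = 2\<pi> \<integral> h\<^sub>A(x) exp (-\<pi>\<parallel>x\<parallel>\<^sup>2) dx\<close> with \<open>h\<^sub>A\<close> the support function; in particular the right-hand
  side is \<open>\<parallel>v\<parallel>\<close> for \<open>h(x) = max 0 \<langle>x, v\<rangle>\<close>.  By Fubini the claim therefore reduces to
  \<open>E sup\<^bsub>t \<le> 1\<^esub> \<langle>x, X(t)\<rangle> = \<alpha> E (max 0 \<langle>x, X(1)\<rangle>)\<close> for every \<open>x\<close>.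
  Convergence of the random walk with regularly varying \<open>b\<close> makes the law of \<open>X(1)\<close> strictly stable,
  so that \<open>X(k/n)\<close> is distributed as \<open>(k/n)\<^bsup>1/\<alpha>\<^esup> X(1)\<close> and Spitzer's identity
  \<open>E max\<^bsub>k \<le> n\<^esub> S\<^sub>k = \<Sum>k=1..n. E (max 0 S\<^sub>k) / k\<close> on the grid of mesh \<open>1/n\<close> turns into a Riemann sum
  converging to \<open>\<alpha>\<close>.

  The Steiner polynomial of a polytope \<open>conv S\<close> comes from an argument of Gromov: the map
  \<open>\<nabla>(ln (\<Sum>a\<in>S. exp \<langle>a, x\<rangle>)) + r \<nabla>(sqrt (1 + \<parallel>x\<parallel>\<^sup>2))\<close> is a bijection from the whole space onto the
  open \<open>r\<close>-neighbourhood of \<open>conv S\<close>, and its Jacobian determinant is a polynomial in \<open>r\<close>.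
  The mean width formula is the derivative at \<open>\<epsilon> = 0\<close> of the Wills functional
  \<open>\<integral> exp (-\<pi> dist(x, \<epsilon>A)\<^sup>2) dx = \<Sum>k. \<epsilon>\<^sup>k V\<^sub>k(A)\<close>.
\<close>

section \<open>Polynomials as pointwise limits and integrals\<close>

text \<open>\<open>intrinsic_volume\<close> is a definite description, so nothing can be said about
  V_1 before the parallel volume of every convex body is known to be a polynomial of degree at most
  d. Gromov's map spares the face structure of polytopes: it is the gradient of a strictly convex
  function, hence injective with positive definite derivative, so the Jacobian determinant needs no
  absolute value and stays polynomial in r. The Gaussian weight exp(-pi |x|^2) makes all ball
  volumes of the Steiner formula cancel. The factor 2 pi appears on differentiating, because dist(x,
  eps A)^2 = |x|^2 - 2 eps h(x) + O(eps^2) for the support function h of A. The inner product of X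
  with a fixed vector is again a Levy process, so the probabilistic work takes place on the real
  line. Finiteness of E |X(1)| is not assumed; it is extracted from the decay of 1 - phi near 0 for
  the characteristic function phi, where alpha > 1 is decisive through 2^(1/alpha) < 2.\<close>

definition lagrange_basis :: "nat \<Rightarrow> nat \<Rightarrow> real poly" where
  "lagrange_basis d j =
     smult (1 / (\<Prod>i\<in>{..d} - {j}. real j - real i)) (\<Prod>i\<in>{..d} - {j}. [:- real (Suc i), 1:])"

lemma degree_lagrange_basis: "j \<le> d \<Longrightarrow> degree (lagrange_basis d j) \<le> d"
proof -
  assume "j \<le> d"
  have "degree (\<Prod>i\<in>{..d} - {j}. [:- real (Suc i), 1:]) \<le> (\<Sum>i\<in>{..d} - {j}. degree [:- real (Suc i), 1:])"
    by (rule order_trans[OF degree_prod_sum_le]) (auto simp: o_def)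
  also have "\<dots> = d"
    using \<open>j \<le> d\<close> by simp
  finally show ?thesis
    unfolding lagrange_basis_def using degree_smult_le order_trans by blast
qed

lemma poly_lagrange_basis:
  assumes "j \<le> d" "k \<le> d"
  shows "poly (lagrange_basis d j) (real (Suc k)) = (if j = k then 1 else 0)"
proof -
  have "(\<Prod>i\<in>{..d} - {j}. real k - real i) = 0" if "j \<noteq> k"
    using that assms by (intro prod_zero) auto
  moreover have "(\<Prod>i\<in>{..d} - {j}. real j - real i) \<noteq> 0"
    by auto
  ultimately show ?thesis
    by (auto simp: lagrange_basis_def poly_prod)
qed

text \<open>The nodes are 1, ..., d + 1 rather than 0, ..., d because \<open>poly_integral\<close>
  has data only for positive arguments.\<close>

lemma poly_eq_lagrange:
  fixes p :: "real poly"
  assumes "degree p \<le> d"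
  shows "poly p x = (\<Sum>j\<le>d. poly p (real (Suc j)) * poly (lagrange_basis d j) x)"
proof -
  let ?q = "\<Sum>j\<le>d. smult (poly p (real (Suc j))) (lagrange_basis d j)"
  have deg: "degree ?q \<le> d"
    by (intro degree_sum_le) (auto intro: order_trans[OF degree_smult_le] degree_lagrange_basis)
  have inj: "inj_on (\<lambda>k. real (Suc k)) {..d}"
    by (auto simp: inj_on_def)
  have "p = ?q"
  proof (rule poly_eqI_degree[where A = "(\<lambda>k. real (Suc k)) ` {..d}"])
    fix x assume "x \<in> (\<lambda>k. real (Suc k)) ` {..d}"
    then obtain k where k: "k \<le> d" "x = real (Suc k)" by auto
    have "poly ?q x = (\<Sum>j\<le>d. if j = k then poly p (real (Suc j)) else 0)"
      unfolding k(2) poly_sum poly_smult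
      by (intro sum.cong refl) (simp only: poly_lagrange_basis k(1) atMost_iff, auto)
    then show "poly p x = poly ?q x"
      using k by simp
  qed (use assms deg in \<open>auto simp: card_image[OF inj] simp del: of_nat_Suc\<close>)
  then show ?thesis
    by (metis (no_types, lifting) poly_smult poly_sum sum.cong)
qed

lemma lagrange_interpolant_exists:
  assumes "\<And>x. P x \<Longrightarrow> F x = (\<Sum>j\<le>d. c j * poly (lagrange_basis d j) x)"
  shows "\<exists>p::real poly. degree p \<le> d \<and> (\<forall>x. P x \<longrightarrow> F x = poly p x)"
  using assms
  by (intro exI[of _ "\<Sum>j\<le>d. smult (c j) (lagrange_basis d j)"] conjI degree_sum_le)
     (auto simp: poly_sum intro: order_trans[OF degree_smult_le] degree_lagrange_basis)

text \<open>A polynomial of bounded degree depends linearly on its values at fixed nodes, and this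
  linear identity survives pointwise limits; no convergence of coefficients has to be
  discussed.\<close>

lemma poly_pointwise_limit:
  fixes F :: "real \<Rightarrow> real"
  assumes q: "\<And>n. \<exists>q. degree q \<le> d \<and> (\<forall>x\<ge>0. f n x = poly q x)"
    and lim: "\<And>x. x \<ge> 0 \<Longrightarrow> (\<lambda>n. f n x) \<longlonglongrightarrow> F x"
  shows "\<exists>p. degree p \<le> d \<and> (\<forall>x\<ge>0. F x = poly p x)"
proof (rule lagrange_interpolant_exists)
  fix x :: real assume x: "x \<ge> 0"
  have "f n x = (\<Sum>j\<le>d. f n (real (Suc j)) * poly (lagrange_basis d j) x)" for n
  proof -
    obtain q where "degree q \<le> d" "\<forall>x\<ge>0. f n x = poly q x"
      using q[of n] by auto
    then show ?thesis
      using poly_eq_lagrange[of q d x] x by simp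
  qed
  moreover have "(\<lambda>n. \<Sum>j\<le>d. f n (real (Suc j)) * poly (lagrange_basis d j) x)
      \<longlonglongrightarrow> (\<Sum>j\<le>d. F (real (Suc j)) * poly (lagrange_basis d j) x)"
    by (intro tendsto_intros lim) auto
  ultimately show "F x = (\<Sum>j\<le>d. F (real (Suc j)) * poly (lagrange_basis d j) x)"
    using lim[OF x] by (intro LIMSEQ_unique) auto
qed

text \<open>The interpolation identity is integrated instead of the coefficients, so integrability
  is required only of the functions \<open>f r\<close> themselves.\<close>

lemma poly_integral:
  fixes f :: "real \<Rightarrow> 'a::euclidean_space \<Rightarrow> real"
  assumes q: "\<And>x. \<exists>q. degree q \<le> d \<and> (\<forall>r. f r x = poly q r)"
    and int: "\<And>r. r > 0 \<Longrightarrow> (f r has_integral F r) S"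
  shows "\<exists>p. degree p \<le> d \<and> (\<forall>r>0. F r = poly p r)"
proof (rule lagrange_interpolant_exists)
  fix r :: real assume r: "r > 0"
  have "f r x = (\<Sum>j\<le>d. f (real (Suc j)) x * poly (lagrange_basis d j) r)" for x
  proof -
    obtain q where "degree q \<le> d" "\<forall>r. f r x = poly q r"
      using q[of x] by auto
    then show ?thesis
      using poly_eq_lagrange[of q d r] by simp
  qed
  moreover have "((\<lambda>x. \<Sum>j\<le>d. f (real (Suc j)) x * poly (lagrange_basis d j) r)
      has_integral (\<Sum>j\<le>d. F (real (Suc j)) * poly (lagrange_basis d j) r)) S"
    by (intro has_integral_sum has_integral_mult_left int) auto
  ultimately show "F r = (\<Sum>j\<le>d. F (real (Suc j)) * poly (lagrange_basis d j) r)"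
    using int[OF r] by (intro has_integral_unique) (auto simp: fun_eq_iff cong: has_integral_cong)
qed

section \<open>Determinants of matrix pencils and of positive definite matrices\<close>

lemma det_pencil_poly:
  fixes A B :: "real^'n^'n"
  shows "\<exists>p. degree p \<le> CARD('n) \<and> (\<forall>r. det (A + r *\<^sub>R B) = poly p r)"
proof (intro exI conjI allI)
  let ?p = "\<Sum>s | s permutes (UNIV::'n set). smult (of_int (sign s)) (\<Prod>i\<in>UNIV. [:A $ i $ s i, B $ i $ s i:])"
  show "degree ?p \<le> CARD('n)"
  proof (intro degree_sum_le order_trans[OF degree_smult_le])
    fix s :: "'n \<Rightarrow> 'n"
    have "degree (\<Prod>i\<in>UNIV. [:A $ i $ s i, B $ i $ s i:]) \<le> (\<Sum>i\<in>(UNIV::'n set). degree [:A $ i $ s i, B $ i $ s i:])"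
      by (rule order_trans[OF degree_prod_sum_le]) (auto simp: o_def)
    also have "\<dots> \<le> (\<Sum>i\<in>(UNIV::'n set). 1)"
      by (intro sum_mono) (auto simp: degree_pCons_le)
    finally show "degree (\<Prod>i\<in>UNIV. [:A $ i $ s i, B $ i $ s i:]) \<le> CARD('n)"
      by simp
  qed auto
  show "det (A + r *\<^sub>R B) = poly ?p r" for r
    by (simp add: det_def poly_sum poly_prod)
qed

text \<open>Symmetry is not assumed, so eigenvalues are avoided. Every matrix on the segment from
  the identity to \<open>A\<close> is positive definite, hence has trivial kernel; a determinant
  that is not positive at \<open>A\<close> would vanish somewhere on the segment.\<close>

lemma det_pos_of_pos_def:
  fixes A :: "real^'n^'n"
  assumes pos: "\<And>v. v \<noteq> 0 \<Longrightarrow> v \<bullet> (A *v v) > 0"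
  shows "det A > 0"
proof (rule ccontr)
  assume "\<not> det A > 0"
  let ?M = "\<lambda>t::real. (1 - t) *\<^sub>R mat 1 + t *\<^sub>R A"
  have cont: "continuous_on {0..1} (\<lambda>t. det (?M t))"
    unfolding det_def by (simp, intro continuous_intros)
  have "\<exists>t\<ge>0. t \<le> 1 \<and> det (?M t) = 0"
    using \<open>\<not> det A > 0\<close> cont
    by (intro IVT2'[of "\<lambda>t. det (?M t)" 1 0 0]) auto
  then obtain t where t: "0 \<le> t" "t \<le> 1" "det (?M t) = 0"
    by blast
  then obtain v where v: "v \<noteq> 0" "?M t *v v = 0"
    by (metis invertible_det_nz matrix_left_invertible_ker invertible_left_inverse)
  have "v \<bullet> (?M t *v v) = (1 - t) * (v \<bullet> v) + t * (v \<bullet> (A *v v))"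
    by (simp add: matrix_vector_mult_add_rdistrib inner_add_right
        scaleR_matrix_vector_assoc[symmetric])
  moreover have "(1 - t) * (v \<bullet> v) + t * (v \<bullet> (A *v v)) > 0"
  proof (cases "t = 0")
    case False
    then have "t * (v \<bullet> (A *v v)) > 0" using t pos[OF v(1)] by auto
    then show ?thesis using t by (simp add: add_nonneg_pos)
  qed (use v in auto)
  ultimately show False using v by simp
qed

section \<open>Parallel bodies of polytopes\<close>

definition exp_sum :: "'a::real_inner set \<Rightarrow> 'a \<Rightarrow> real" where
  "exp_sum S x = (\<Sum>a\<in>S. exp (a \<bullet> x))"

text \<open>The expectation of \<open>\<phi>\<close> under the Gibbs distribution on
  \<open>S\<close> with weights proportional to \<open>exp (a \<bullet> x)\<close>. For the identity
  it is the gradient of \<open>ln (exp_sum S x)\<close>; other choices of \<open>\<phi>\<close> give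
  the second moments needed for the Hessian.\<close>

definition gibbs_mean :: "'a::real_inner set \<Rightarrow> ('a \<Rightarrow> 'b::real_vector) \<Rightarrow> 'a \<Rightarrow> 'b" where
  "gibbs_mean S \<phi> x = (\<Sum>a\<in>S. (exp (a \<bullet> x) / exp_sum S x) *\<^sub>R \<phi> a)"

text \<open>The gradient of \<open>sqrt (1 + x \<bullet> x)\<close>, a smooth strictly convex
  substitute for the norm.\<close>

definition soft_ball_map :: "'a::real_inner \<Rightarrow> 'a" where
  "soft_ball_map x = x /\<^sub>R sqrt (1 + x \<bullet> x)"

definition minkowski_map :: "'a::real_inner set \<Rightarrow> real \<Rightarrow> 'a \<Rightarrow> 'a" where
  "minkowski_map S r x = gibbs_mean S (\<lambda>a. a) x + r *\<^sub>R soft_ball_map x"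

text \<open>The covariance operator of the Gibbs distribution, applied to \<open>v\<close>.\<close>

definition gibbs_hessian :: "'a::real_inner set \<Rightarrow> 'a \<Rightarrow> 'a \<Rightarrow> 'a" where
  "gibbs_hessian S x v =
     gibbs_mean S (\<lambda>a. (a \<bullet> v) *\<^sub>R a) x - gibbs_mean S (\<lambda>a. a \<bullet> v) x *\<^sub>R gibbs_mean S (\<lambda>a. a) x"

definition soft_ball_hessian :: "'a::real_inner \<Rightarrow> 'a \<Rightarrow> 'a" where
  "soft_ball_hessian x v = v /\<^sub>R sqrt (1 + x \<bullet> x) - ((x \<bullet> v) / sqrt (1 + x \<bullet> x) ^ 3) *\<^sub>R x"

lemma exp_sum_pos: "finite S \<Longrightarrow> S \<noteq> {} \<Longrightarrow> exp_sum S x > 0"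
  unfolding exp_sum_def by (intro sum_pos) auto

lemma gibbs_weights:
  assumes "finite S" "S \<noteq> {}"
  shows "(\<Sum>a\<in>S. exp (a \<bullet> x) / exp_sum S x) = 1"
  using exp_sum_pos[OF assms, of x] by (simp add: sum_divide_distrib[symmetric] exp_sum_def)

lemma has_derivative_exp_sum:
  "(exp_sum S has_derivative (\<lambda>v. \<Sum>a\<in>S. exp (a \<bullet> x) * (a \<bullet> v))) (at x)"
  unfolding exp_sum_def[abs_def]
  by (auto intro!: derivative_eq_intros sum.cong simp: algebra_simps)

lemma has_derivative_ln_exp_sum:
  assumes "finite S" "S \<noteq> {}"
  shows "((\<lambda>x. ln (exp_sum S x)) has_derivative (\<lambda>v. gibbs_mean S (\<lambda>a. a) x \<bullet> v)) (at x)"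
proof -
  have "((\<lambda>x. ln (exp_sum S x)) has_derivative
      (\<lambda>v. (\<Sum>a\<in>S. exp (a \<bullet> x) * (a \<bullet> v)) * inverse (exp_sum S x))) (at x)"
    using exp_sum_pos[OF assms, of x]
    by (auto intro!: derivative_eq_intros has_derivative_exp_sum)
  also have "(\<lambda>v. (\<Sum>a\<in>S. exp (a \<bullet> x) * (a \<bullet> v)) * inverse (exp_sum S x))
      = (\<lambda>v. gibbs_mean S (\<lambda>a. a) x \<bullet> v)"
    by (auto simp: gibbs_mean_def inner_sum_left sum_distrib_right sum_divide_distrib field_simps)
  finally show ?thesis .
qed

lemma has_derivative_soft_norm:
  "((\<lambda>x::'a::real_inner. sqrt (1 + x \<bullet> x)) has_derivative (\<lambda>v. soft_ball_map x \<bullet> v)) (at x)"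
proof -
  have pos: "1 + x \<bullet> x > 0" by (simp add: add_pos_nonneg)
  show ?thesis
    using pos by (auto intro!: derivative_eq_intros
        simp: soft_ball_map_def field_simps inner_commute)
qed

lemma has_derivative_soft_ball_map:
  fixes x :: "'a::real_inner"
  shows "(soft_ball_map has_derivative soft_ball_hessian x) (at x)"
proof -
  have pos: "sqrt (1 + x \<bullet> x) > 0" by (simp add: add_pos_nonneg)
  have "((\<lambda>x::'a. inverse (sqrt (1 + x \<bullet> x))) has_derivative
      (\<lambda>v. - (inverse (sqrt (1 + x \<bullet> x)) * (soft_ball_map x \<bullet> v) * inverse (sqrt (1 + x \<bullet> x))))) (at x)"
    using pos by (intro Deriv.has_derivative_inverse has_derivative_soft_norm) auto
  from has_derivative_scaleR[OF this has_derivative_ident]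
  have "((\<lambda>x::'a. inverse (sqrt (1 + x \<bullet> x)) *\<^sub>R x) has_derivative
      (\<lambda>v. inverse (sqrt (1 + x \<bullet> x)) *\<^sub>R v
         + (- (inverse (sqrt (1 + x \<bullet> x)) * (soft_ball_map x \<bullet> v) * inverse (sqrt (1 + x \<bullet> x)))) *\<^sub>R x)) (at x)" .
  also have "(\<lambda>v. inverse (sqrt (1 + x \<bullet> x)) *\<^sub>R v
         + (- (inverse (sqrt (1 + x \<bullet> x)) * (soft_ball_map x \<bullet> v) * inverse (sqrt (1 + x \<bullet> x)))) *\<^sub>R x)
      = soft_ball_hessian x"
    using pos by (auto simp: fun_eq_iff soft_ball_hessian_def soft_ball_map_def power3_eq_cube field_simps)
  finally show ?thesis
    by (simp add: soft_ball_map_def[abs_def])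
qed

lemma has_derivative_gibbs_mean:
  assumes "finite S" "S \<noteq> {}"
  shows "(gibbs_mean S (\<lambda>a. a) has_derivative gibbs_hessian S x) (at x)"
proof -
  have pos: "exp_sum S x > 0" by (rule exp_sum_pos[OF assms])
  have eq: "gibbs_mean S (\<lambda>a. a) = (\<lambda>x. inverse (exp_sum S x) *\<^sub>R (\<Sum>a\<in>S. exp (a \<bullet> x) *\<^sub>R a))"
    by (auto simp: gibbs_mean_def scaleR_sum_right fun_eq_iff field_simps)
  have 1: "((\<lambda>x. \<Sum>a\<in>S. exp (a \<bullet> x) *\<^sub>R a) has_derivative (\<lambda>v. \<Sum>a\<in>S. (exp (a \<bullet> x) * (a \<bullet> v)) *\<^sub>R a)) (at x)"
    by (auto intro!: derivative_eq_intros sum.cong simp: algebra_simps)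
  have 2: "((\<lambda>x. inverse (exp_sum S x)) has_derivative
      (\<lambda>v. - (inverse (exp_sum S x) * (\<Sum>a\<in>S. exp (a \<bullet> x) * (a \<bullet> v)) * inverse (exp_sum S x)))) (at x)"
    using pos by (intro Deriv.has_derivative_inverse has_derivative_exp_sum) auto
  have "(gibbs_mean S (\<lambda>a. a) has_derivative (\<lambda>v. inverse (exp_sum S x) *\<^sub>R (\<Sum>a\<in>S. (exp (a \<bullet> x) * (a \<bullet> v)) *\<^sub>R a)
      + (- (inverse (exp_sum S x) * (\<Sum>a\<in>S. exp (a \<bullet> x) * (a \<bullet> v)) * inverse (exp_sum S x))) *\<^sub>R (\<Sum>a\<in>S. exp (a \<bullet> x) *\<^sub>R a))) (at x)"
    unfolding eq by (rule has_derivative_scaleR[OF 2 1])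
  also have "(\<lambda>v. inverse (exp_sum S x) *\<^sub>R (\<Sum>a\<in>S. (exp (a \<bullet> x) * (a \<bullet> v)) *\<^sub>R a)
      + (- (inverse (exp_sum S x) * (\<Sum>a\<in>S. exp (a \<bullet> x) * (a \<bullet> v)) * inverse (exp_sum S x))) *\<^sub>R (\<Sum>a\<in>S. exp (a \<bullet> x) *\<^sub>R a))
      = gibbs_hessian S x"
  proof
    fix v
    have a: "gibbs_mean S (\<lambda>a. (a \<bullet> v) *\<^sub>R a) x = inverse (exp_sum S x) *\<^sub>R (\<Sum>a\<in>S. (exp (a \<bullet> x) * (a \<bullet> v)) *\<^sub>R a)"
      by (auto simp: gibbs_mean_def scaleR_sum_right divide_inverse mult_ac)
    have b: "gibbs_mean S (\<lambda>a. a \<bullet> v) x = inverse (exp_sum S x) * (\<Sum>a\<in>S. exp (a \<bullet> x) * (a \<bullet> v))"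
      by (auto simp: gibbs_mean_def sum_distrib_left divide_inverse mult_ac)
    show "inverse (exp_sum S x) *\<^sub>R (\<Sum>a\<in>S. (exp (a \<bullet> x) * (a \<bullet> v)) *\<^sub>R a)
      + (- (inverse (exp_sum S x) * (\<Sum>a\<in>S. exp (a \<bullet> x) * (a \<bullet> v)) * inverse (exp_sum S x))) *\<^sub>R (\<Sum>a\<in>S. exp (a \<bullet> x) *\<^sub>R a)
      = gibbs_hessian S x v"
      unfolding gibbs_hessian_def a b unfolding eq by (simp add: mult_ac)
  qed
  finally show ?thesis .
qed

lemma has_derivative_minkowski_map:
  assumes "finite S" "S \<noteq> {}"
  shows "(minkowski_map S r has_derivative (\<lambda>v. gibbs_hessian S x v + r *\<^sub>R soft_ball_hessian x v)) (at x)"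
  unfolding minkowski_map_def[abs_def]
  by (intro has_derivative_add has_derivative_scaleR_right has_derivative_gibbs_mean assms
      has_derivative_soft_ball_map)

text \<open>The quadratic form of the Hessian of \<open>ln \<circ> exp_sum S\<close> is a variance.\<close>

lemma gibbs_hessian_nonneg:
  assumes "finite S" "S \<noteq> {}"
  shows "v \<bullet> gibbs_hessian S x v \<ge> 0"
proof -
  let ?w = "\<lambda>a. exp (a \<bullet> x) / exp_sum S x"
  define m where "m = (\<Sum>a\<in>S. ?w a * (a \<bullet> v))"
  have "0 \<le> (\<Sum>a\<in>S. ?w a * (a \<bullet> v - m)\<^sup>2)"
    using exp_sum_pos[OF assms, of x] by (intro sum_nonneg) auto
  also have "\<dots> = (\<Sum>a\<in>S. ?w a * (a \<bullet> v)\<^sup>2 - 2 * m * (?w a * (a \<bullet> v)) + m\<^sup>2 * ?w a)"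
    by (intro sum.cong refl) (simp add: power2_diff algebra_simps add_divide_distrib diff_divide_distrib)
  also have "\<dots> = (\<Sum>a\<in>S. ?w a * (a \<bullet> v)\<^sup>2) - 2 * m * (\<Sum>a\<in>S. ?w a * (a \<bullet> v)) + m\<^sup>2 * (\<Sum>a\<in>S. ?w a)"
    by (simp only: sum.distrib sum_subtractf sum_distrib_left)
  also have "\<dots> = (\<Sum>a\<in>S. ?w a * (a \<bullet> v)\<^sup>2) - m * m"
    unfolding m_def[symmetric] gibbs_weights[OF assms] by (simp add: power2_eq_square)
  also have "\<dots> = v \<bullet> gibbs_hessian S x v"
    by (simp add: gibbs_hessian_def gibbs_mean_def inner_diff_right inner_sum_right m_def
        inner_commute power2_eq_square mult_ac)
  finally show ?thesis .
qed

text \<open>Strictness comes from the 1 under the root: Cauchy-Schwarz bounds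
  \<open>(x \<bullet> v)\<^sup>2\<close> by \<open>(x \<bullet> x) * (v \<bullet> v)\<close>, and
  \<open>x \<bullet> x\<close> is smaller than \<open>1 + x \<bullet> x\<close>. This makes the full
  Jacobian definite even if \<open>convex hull S\<close> is lower-dimensional, where the Gibbs
  covariance is singular.\<close>

lemma soft_ball_hessian_pos:
  assumes "v \<noteq> 0"
  shows "v \<bullet> soft_ball_hessian x v > 0"
proof -
  define s where "s = sqrt (1 + x \<bullet> x)"
  have s: "s > 0" "s\<^sup>2 = 1 + x \<bullet> x"
    unfolding s_def by (auto simp: add_pos_nonneg)
  have "(x \<bullet> v)\<^sup>2 \<le> (x \<bullet> x) * (v \<bullet> v)"
    by (rule Cauchy_Schwarz_ineq)
  also have "\<dots> < s\<^sup>2 * (v \<bullet> v)"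
    using assms unfolding s(2) by (simp add: algebra_simps)
  finally have "(s\<^sup>2 * (v \<bullet> v) - (x \<bullet> v)\<^sup>2) / s ^ 3 > 0"
    using s by auto
  also have "(s\<^sup>2 * (v \<bullet> v) - (x \<bullet> v)\<^sup>2) / s ^ 3 = v \<bullet> soft_ball_hessian x v"
    using s(1) unfolding soft_ball_hessian_def s_def[symmetric]
    by (simp add: inner_diff_right inner_commute field_simps power2_eq_square power3_eq_cube)
  finally show ?thesis .
qed

lemma minkowski_map_derivative_pos:
  assumes "finite S" "S \<noteq> {}" "r > 0" "v \<noteq> 0"
  shows "v \<bullet> (gibbs_hessian S x v + r *\<^sub>R soft_ball_hessian x v) > 0"
  using gibbs_hessian_nonneg[OF assms(1,2), of v x] soft_ball_hessian_pos[OF assms(4), of x] assms(3)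
  by (simp add: inner_add_right add_nonneg_pos)

text \<open>Gradients of strictly convex functions are injective: on the segment from
  \<open>y\<close> to \<open>x\<close>, the component of the map along \<open>x - y\<close> has
  positive derivative.\<close>

lemma inj_minkowski_map:
  fixes S :: "'a::real_inner set"
  assumes "finite S" "S \<noteq> {}" "r > 0"
  shows "inj (minkowski_map S r)"
proof (rule injI, rule ccontr)
  fix x y :: 'a assume eq: "minkowski_map S r x = minkowski_map S r y" and "x \<noteq> y"
  define v where "v = x - y"
  let ?f = "\<lambda>t::real. v \<bullet> minkowski_map S r (y + t *\<^sub>R v)"
  let ?D = "\<lambda>z v. gibbs_hessian S z v + r *\<^sub>R soft_ball_hessian z v"
  have der: "(?f has_derivative (\<lambda>h. v \<bullet> ?D (y + t *\<^sub>R v) (h *\<^sub>R v))) (at t)" for t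
    by (intro has_derivative_inner_right
        has_derivative_compose[OF _ has_derivative_minkowski_map[OF assms(1,2)], of "\<lambda>t. y + t *\<^sub>R v"])
       (auto intro!: derivative_eq_intros)
  have "\<exists>t\<in>{0<..<1}. ?f 1 - ?f 0 = v \<bullet> ?D (y + t *\<^sub>R v) ((1 - 0) *\<^sub>R v)"
    using der by (intro mvt_simple) (auto intro: has_derivative_at_withinI)
  then obtain t where "?f 1 - ?f 0 = v \<bullet> ?D (y + t *\<^sub>R v) v"
    by auto
  moreover have "?f 1 = ?f 0"
    using eq by (simp add: v_def)
  moreover have "v \<noteq> 0" using \<open>x \<noteq> y\<close> by (simp add: v_def)
  ultimately show False
    using minkowski_map_derivative_pos[OF assms, of v "y + t *\<^sub>R v"] by simp
qed

lemma norm_less_soft_norm: "norm x < sqrt (1 + x \<bullet> x)"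
  unfolding norm_eq_sqrt_inner by (rule real_sqrt_less_mono) simp

text \<open>Gibbs weights are convex coefficients and \<open>soft_ball_map\<close> has norm below 1,
  which gives one inclusion. Conversely a point of the open parallel body is hit at the minimum of a
  tilted convex potential.\<close>

lemma range_minkowski_map:
  fixes S :: "'a::euclidean_space set"
  assumes S: "finite S" "S \<noteq> {}" and r: "r > 0"
  shows "range (minkowski_map S r) = {a + r *\<^sub>R u |a u. a \<in> convex hull S \<and> u \<in> ball 0 1}"
proof (intro equalityI subsetI)
  fix y assume "y \<in> range (minkowski_map S r)"
  then obtain x where y: "y = minkowski_map S r x" by auto
  have "gibbs_mean S (\<lambda>a. a) x \<in> convex hull S"
    unfolding convex_hull_finite[OF S(1)] gibbs_mean_def
    using gibbs_weights[OF S, of x] exp_sum_pos[OF S, of x]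
    by (intro CollectI exI[of _ "\<lambda>a. exp (a \<bullet> x) / exp_sum S x"]) auto
  moreover have "soft_ball_map x \<in> ball 0 1"
    using norm_less_soft_norm[of x] le_less_trans[OF norm_ge_zero norm_less_soft_norm[of x]]
    by (auto simp: soft_ball_map_def inverse_eq_divide)
  ultimately show "y \<in> {a + r *\<^sub>R u |a u. a \<in> convex hull S \<and> u \<in> ball 0 1}"
    unfolding y minkowski_map_def by blast
next
  fix y assume "y \<in> {a + r *\<^sub>R u |a u. a \<in> convex hull S \<and> u \<in> ball 0 1}"
  then obtain a b where y: "y = a + r *\<^sub>R b" and a: "a \<in> convex hull S" and b: "norm b < 1"
    by auto
  \<comment> \<open>The gradient of \<open>\<psi>\<close> is \<open>minkowski_map S r x - y\<close>,
    so every critical point is a preimage of \<open>y\<close>.\<close>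
  define \<psi> where "\<psi> x = ln (exp_sum S x) - a \<bullet> x + r * (sqrt (1 + x \<bullet> x) - b \<bullet> x)" for x
  have der: "(\<psi> has_derivative (\<lambda>v. (minkowski_map S r x - y) \<bullet> v)) (at x)" for x
    unfolding \<psi>_def[abs_def]
    by (rule derivative_eq_intros has_derivative_ln_exp_sum[OF S] has_derivative_soft_norm refl)+
       (auto simp: y minkowski_map_def inner_simps algebra_simps)
  \<comment> \<open>Coercivity: \<open>a\<close> in the hull gives
    \<open>a \<bullet> x \<le> ln (exp_sum S x)\<close>, and \<open>norm b < 1\<close> leaves linear
    growth in the second summand.\<close>
  have lower: "\<psi> x \<ge> r * (1 - norm b) * norm x" for x
  proof -
    from a obtain w where w: "\<forall>s\<in>S. 0 \<le> w s" "sum w S = 1" "(\<Sum>s\<in>S. w s *\<^sub>R s) = a"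
      unfolding convex_hull_finite[OF S(1)] by auto
    have *: "s \<bullet> x \<le> ln (exp_sum S x)" if "s \<in> S" for s
    proof -
      have "exp (s \<bullet> x) \<le> exp_sum S x"
        unfolding exp_sum_def using that S(1) by (intro member_le_sum) auto
      then show ?thesis
        using exp_sum_pos[OF S, of x] by (simp add: ln_ge_iff)
    qed
    have "a \<bullet> x = (\<Sum>s\<in>S. w s * (s \<bullet> x))"
      by (simp add: w(3)[symmetric] inner_sum_left)
    also have "\<dots> \<le> (\<Sum>s\<in>S. w s * ln (exp_sum S x))"
      using w * by (intro sum_mono mult_left_mono) auto
    also have "\<dots> = ln (exp_sum S x)"
      by (simp add: sum_distrib_right[symmetric] w)
    finally have 1: "a \<bullet> x \<le> ln (exp_sum S x)" .
    have "b \<bullet> x \<le> norm b * norm x" by (rule norm_cauchy_schwarz)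
    then have "(1 - norm b) * norm x \<le> sqrt (1 + x \<bullet> x) - b \<bullet> x"
      using norm_less_soft_norm[of x] by (simp add: algebra_simps)
    then have "r * ((1 - norm b) * norm x) \<le> r * (sqrt (1 + x \<bullet> x) - b \<bullet> x)"
      using r by (intro mult_left_mono) auto
    then show ?thesis using 1 unfolding \<psi>_def by simp
  qed
  \<comment> \<open>Outside the ball of radius \<open>R\<close> the bound \<open>lower\<close>
    already exceeds \<open>\<psi> 0\<close>, so the minimum over the ball is global.\<close>
  define R where "R = \<psi> 0 / (r * (1 - norm b))"
  have c: "r * (1 - norm b) > 0" using r b by simp
  have "\<psi> 0 \<ge> 0" using lower[of 0] by simp
  then have R: "R \<ge> 0" unfolding R_def using c by simp
  have "continuous_on (cball 0 R) \<psi>"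
    using der by (meson continuous_at_imp_continuous_on has_derivative_continuous)
  then obtain x where x: "x \<in> cball 0 R" "\<forall>z\<in>cball 0 R. \<psi> x \<le> \<psi> z"
    using continuous_attains_inf[of "cball 0 R" \<psi>] R by auto
  have "\<psi> x \<le> \<psi> z" for z
  proof (cases "norm z \<le> R")
    case False
    have "\<psi> x \<le> \<psi> 0" using x R by auto
    also have "\<psi> 0 = r * (1 - norm b) * R" using r b by (auto simp: R_def)
    also have "\<dots> \<le> r * (1 - norm b) * norm z"
      using False c by (intro mult_left_mono) auto
    also have "\<dots> \<le> \<psi> z" by (rule lower)
    finally show ?thesis .
  qed (use x in auto)
  then have "(\<lambda>v. (minkowski_map S r x - y) \<bullet> v) = (\<lambda>v. 0)"
    using der by (intro differential_zero_maxmin[of x UNIV \<psi>]) auto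
  then have "(minkowski_map S r x - y) \<bullet> (minkowski_map S r x - y) = 0"
    by metis
  then show "y \<in> range (minkowski_map S r)"
    by auto
qed

text \<open>Change of variables turns the volume into an integral over the whole space, a domain
  independent of r. The determinant is a polynomial in every real r; for r > 0 it is positive and
  therefore equals its absolute value.\<close>

lemma parallel_open_volume_poly:
  fixes S :: "(real^'n::{finite,wellorder}) set"
  assumes S: "finite S" "S \<noteq> {}"
  shows "\<exists>p. degree p \<le> CARD('n) \<and>
    (\<forall>r>0. measure lebesgue {a + r *\<^sub>R u |a u. a \<in> convex hull S \<and> u \<in> ball 0 1} = poly p r)"
proof (rule poly_integral)
  let ?D = "\<lambda>r x v. gibbs_hessian S x v + r *\<^sub>R soft_ball_hessian x v"
  fix x :: "real^'n::{finite,wellorder}"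
  have "matrix (?D r x) = matrix (gibbs_hessian S x) + r *\<^sub>R matrix (soft_ball_hessian x)" for r
    by (simp add: matrix_def vec_eq_iff)
  then show "\<exists>q. degree q \<le> CARD('n) \<and> (\<forall>r. det (matrix (?D r x)) = poly q r)"
    using det_pencil_poly[of "matrix (gibbs_hessian S x)" "matrix (soft_ball_hessian x)"] by simp
next
  let ?D = "\<lambda>r x v. gibbs_hessian S x v + r *\<^sub>R soft_ball_hessian x v"
  fix r :: real assume r: "r > 0"
  let ?A = "{a + r *\<^sub>R u |a u. a \<in> convex hull S \<and> u \<in> ball 0 1}"
  have lin: "linear (?D r x)" for x
    using has_derivative_minkowski_map[OF S] by (rule has_derivative_linear)
  have det: "det (matrix (?D r x)) > 0" for x
    using minkowski_map_derivative_pos[OF S r] lin[of x]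
    by (intro det_pos_of_pos_def) (simp add: matrix_works)
  have "?A = (\<Union>a\<in>convex hull S. ball a r)"
  proof (intro equalityI subsetI)
    fix y assume "y \<in> (\<Union>a\<in>convex hull S. ball a r)"
    then obtain a where "a \<in> convex hull S" "dist a y < r" by auto
    moreover have "y = a + r *\<^sub>R ((y - a) /\<^sub>R r)"
      using r by simp
    moreover have "(y - a) /\<^sub>R r \<in> ball 0 1"
      using r \<open>dist a y < r\<close> by (simp add: dist_norm norm_minus_commute divide_inverse[symmetric] inverse_eq_divide
          del: scaleR_right_diff_distrib)
    ultimately show "y \<in> ?A" by blast
  next
    fix y assume "y \<in> ?A"
    then obtain a u where "a \<in> convex hull S" "norm u < 1" "y = a + r *\<^sub>R u" by auto
    moreover from this have "y \<in> ball a r" using r by (simp add: dist_norm)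
    ultimately show "y \<in> (\<Union>a\<in>convex hull S. ball a r)" by blast
  qed
  then have "open ?A" by auto
  moreover have "bounded ?A"
  proof -
    have "bounded (convex hull S)" "bounded ((*\<^sub>R) r ` ball (0::real^'n::{finite,wellorder}) 1)"
      using S by (auto intro!: bounded_scaling simp: finite_imp_bounded bounded_convex_hull)
    from bounded_plus[OF this] show ?thesis
      by (rule bounded_subset) (force simp: image_iff)
  qed
  ultimately have lm: "?A \<in> lmeasurable"
    by (intro lmeasurable_open)
  have "((\<lambda>x. \<bar>det (matrix (?D r x))\<bar>) has_integral measure lebesgue ?A) UNIV"
    using has_measure_differentiable_image[of UNIV "minkowski_map S r" "?D r" "measure lebesgue ?A"]
      has_derivative_minkowski_map[OF S] inj_minkowski_map[OF S r] lm
    unfolding range_minkowski_map[OF S r] by auto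
  then show "((\<lambda>x. det (matrix (?D r x))) has_integral measure lebesgue ?A) UNIV"
    using det by (simp add: less_imp_le abs_of_nonneg)
qed

section \<open>The Steiner formula\<close>

text \<open>The library's change of variables theorem wants a well-ordered index type.\<close>

typedef 'a wellordered = "UNIV :: 'a set"
  morphisms unwrap wrap ..

instance wellordered :: (finite) finite
proof
  have "UNIV = range (wrap :: 'a \<Rightarrow> 'a wellordered)"
    by (metis surjI unwrap_inverse)
  then show "finite (UNIV :: 'a wellordered set)"
    by (metis finite_imageI finite)
qed

instantiation wellordered :: (finite) wellorder
begin

text \<open>The order is pulled back from an enumeration of the finite type; any total order would
  serve.\<close>

definition less_eq_wellordered :: "'a wellordered \<Rightarrow> 'a wellordered \<Rightarrow> bool" where
  "less_eq_wellordered x y \<longleftrightarrow> to_nat_on UNIV (unwrap x) \<le> to_nat_on UNIV (unwrap y)"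

definition less_wellordered :: "'a wellordered \<Rightarrow> 'a wellordered \<Rightarrow> bool" where
  "less_wellordered x y \<longleftrightarrow> to_nat_on UNIV (unwrap x) < to_nat_on UNIV (unwrap y)"

instance
proof
  fix x y :: "'a wellordered"
  assume "x \<le> y" "y \<le> x"
  then have "to_nat_on UNIV (unwrap x) = to_nat_on UNIV (unwrap y)"
    by (simp add: less_eq_wellordered_def)
  then show "x = y"
    using inj_on_to_nat_on[of "UNIV :: 'a set"] by (simp add: inj_on_def unwrap_inject countable_finite)
next
  fix P :: "'a wellordered \<Rightarrow> bool" and a :: "'a wellordered"
  assume step: "\<And>x. (\<And>y. y < x \<Longrightarrow> P y) \<Longrightarrow> P x"
  show "P a"
  proof (induction a rule: measure_induct_rule[where f = "\<lambda>x. to_nat_on UNIV (unwrap x)"])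
    case (less a)
    show ?case
      by (rule step, rule less) (simp add: less_wellordered_def)
  qed
qed (auto simp: less_eq_wellordered_def less_wellordered_def)

end

lemma bij_wrap: "bij wrap"
  by (metis UNIV_I bijI' wrap_inject unwrap_inverse)

text \<open>A linear isometry that only relabels coordinates; it moves convex bodies and Lebesgue
  measure to the well-ordered index type.\<close>

definition wrap_vec :: "real^'n \<Rightarrow> real^('n::finite) wellordered" where
  "wrap_vec x = (\<chi> i. x $ unwrap i)"

lemma linear_wrap_vec: "linear wrap_vec"
  by (auto intro!: linearI simp: wrap_vec_def vec_eq_iff)

lemma norm_wrap_vec [simp]: "norm (wrap_vec x) = norm x"
proof -
  have "(\<Sum>i\<in>UNIV. (norm (wrap_vec x $ i))\<^sup>2) = (\<Sum>i\<in>UNIV. (norm (wrap_vec x $ wrap i))\<^sup>2)"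
    using bij_wrap by (intro sum.reindex_bij_betw[symmetric]) auto
  then show ?thesis
    by (simp add: norm_vec_def L2_set_def wrap_vec_def wrap_inverse)
qed

lemma infdist_wrap_vec: "infdist (wrap_vec x) (wrap_vec ` A) = infdist x A"
  by (simp add: infdist_def image_image dist_norm linear_diff[OF linear_wrap_vec, symmetric])

lemma prod_Basis_vec: "(\<Prod>b\<in>Basis. x \<bullet> b) = (\<Prod>i\<in>UNIV. x $ i)"
  for x :: "real^'n"
proof -
  have B: "(Basis :: (real^'n) set) = range (\<lambda>i. axis i 1)"
    by (auto simp: Basis_vec_def)
  have "inj (\<lambda>i::'n. axis i (1::real))"
    by (auto simp: inj_on_def axis_eq_axis)
  then show ?thesis
    unfolding B by (simp add: prod.reindex inner_axis)
qed

text \<open>Lebesgue measure is determined by its values on boxes, and relabelling maps boxes to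
  boxes with the same side lengths.\<close>

lemma lborel_wrap_vec: "distr lborel borel wrap_vec = (lborel :: (real^('n::finite) wellordered) measure)"
proof (rule sym, rule lborel_eqI)
  have meas: "wrap_vec \<in> borel_measurable borel"
    using linear_wrap_vec by (intro borel_measurable_continuous_onI linear_continuous_on)
      (simp add: linear_linear)
  fix l u :: "real^('n::finite) wellordered"
  assume le: "\<And>b. b \<in> Basis \<Longrightarrow> l \<bullet> b \<le> u \<bullet> b"
  define l' u' where "l' = (\<chi> i. l $ wrap i)" and "u' = (\<chi> i. u $ wrap i)"
  have le': "l $ i \<le> u $ i" for i
    using le[of "axis i 1"] by (auto simp: inner_axis axis_in_Basis_iff)
  have eq: "wrap_vec -` box l u = box l' u'"
  proof (rule set_eqI)
    fix x :: "real^'n"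
    have all: "(\<forall>i. P i) \<longleftrightarrow> (\<forall>j. P (wrap j))" for P :: "'n wellordered \<Rightarrow> bool"
      by (metis unwrap_inverse)
    show "x \<in> wrap_vec -` box l u \<longleftrightarrow> x \<in> box l' u'"
      by (simp add: mem_box_cart wrap_vec_def l'_def u'_def wrap_inverse
          all[of "\<lambda>i. l $ i < x $ unwrap i \<and> x $ unwrap i < u $ i"])
  qed
  have "emeasure (distr lborel borel wrap_vec) (box l u) = emeasure lborel (box l' u')"
    using meas by (subst emeasure_distr) (auto simp: eq)
  also have "\<dots> = (\<Prod>b\<in>Basis. (u' - l') \<bullet> b)"
    using le' by (intro emeasure_lborel_box) (auto simp: Basis_vec_def inner_axis l'_def u'_def)
  also have "(\<Prod>b\<in>Basis. (u' - l') \<bullet> b) = (\<Prod>b\<in>Basis. (u - l) \<bullet> b)"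
    unfolding prod_Basis_vec l'_def u'_def
    using prod.reindex_bij_betw[OF bij_wrap, of "\<lambda>i. u $ i - l $ i"] by simp
  finally show "emeasure (distr lborel borel wrap_vec) (box l u) = (\<Prod>b\<in>Basis. (u - l) \<bullet> b)" .
qed simp

section \<open>Parallel bodies as sublevel sets of the distance, and their volume\<close>

lemma parallel_body_eq_infdist:
  fixes A :: "'a::euclidean_space set"
  assumes A: "closed A" "A \<noteq> {}" and r: "r \<ge> 0"
  shows "{a + r *\<^sub>R u |a u. a \<in> A \<and> u \<in> cball 0 1} = {x. infdist x A \<le> r}"
proof (intro equalityI subsetI)
  fix x assume "x \<in> {a + r *\<^sub>R u |a u. a \<in> A \<and> u \<in> cball 0 1}"
  then obtain a u where x: "x = a + r *\<^sub>R u" "a \<in> A" "norm u \<le> 1" by auto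
  have "infdist x A \<le> dist x a" using x by (intro infdist_le)
  also have "\<dots> \<le> r" using x r by (simp add: dist_norm mult_left_le)
  finally show "x \<in> {x. infdist x A \<le> r}" by simp
next
  fix x assume "x \<in> {x. infdist x A \<le> r}"
  moreover obtain a where a: "a \<in> A" "infdist x A = dist x a"
    using infdist_attains_inf[OF A] by auto
  ultimately have d: "norm (x - a) \<le> r" by (simp add: dist_norm)
  \<comment> \<open>For \<open>r = 0\<close> the distance vanishes, so \<open>x = a\<close>, and the
    convention \<open>inverse 0 = 0\<close> makes the witness the zero vector.\<close>
  have "x = a + r *\<^sub>R ((x - a) /\<^sub>R r)" 
    using d r by (cases "r = 0") auto
  moreover have "(x - a) /\<^sub>R r \<in> cball 0 1"
    using d r by (cases "r = 0") (auto simp: divide_inverse[symmetric] inverse_eq_divide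
        simp del: scaleR_right_diff_distrib)
  ultimately show "x \<in> {a + r *\<^sub>R u |a u. a \<in> A \<and> u \<in> cball 0 1}"
    using a by blast
qed

lemma closed_infdist_le: "closed {x. infdist x A \<le> r}"
  by (intro closed_Collect_le continuous_intros)

lemma compact_infdist_le:
  fixes A :: "'a::euclidean_space set"
  assumes "compact A" "A \<noteq> {}"
  shows "compact {x. infdist x A \<le> r}"
proof -
  have "bounded {x. infdist x A \<le> r}"
  proof -
    obtain B where B: "\<forall>a\<in>A. norm a \<le> B"
      using compact_imp_bounded[OF assms(1)] bounded_iff by blast
    have "norm x \<le> r + B" if x: "infdist x A \<le> r" for x
    proof -
      obtain a where a: "a \<in> A" "infdist x A = dist x a"
        using infdist_attains_inf[OF compact_imp_closed[OF assms(1)] assms(2)] by auto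
      have "norm x \<le> norm (x - a) + norm a" using norm_triangle_sub[of x a] by simp
      then show ?thesis using a B x by (fastforce simp: dist_norm)
    qed
    then show ?thesis unfolding bounded_iff by blast
  qed
  then show ?thesis
    using closed_infdist_le compact_eq_bounded_closed by blast
qed

text \<open>With a finite \<open>e n\<close>-net \<open>S n\<close> of \<open>A\<close> inside
  \<open>A\<close>, the open parallel body \<open>Q n (r + e n)\<close> of the polytope lies between
  the closed parallel bodies of \<open>A\<close> with radii \<open>r\<close> and
  \<open>r + e n\<close>. Its volume is polynomial in r and converges to that of
  \<open>A\<close>.\<close>

lemma parallel_volume_poly_wellorder:
  fixes A :: "(real^'n::{finite,wellorder}) set"
  assumes A: "compact A" "convex A" "A \<noteq> {}"
  shows "\<exists>p. degree p \<le> CARD('n) \<and> (\<forall>r\<ge>0. measure lebesgue {x. infdist x A \<le> r} = poly p r)"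
proof -
  define e where "e n = 1 / real (Suc n)" for n
  have e: "e n > 0" for n by (simp add: e_def)
  have "\<exists>S. finite S \<and> S \<subseteq> A \<and> A \<subseteq> (\<Union>s\<in>S. ball s (e n))" for n
  proof -
    have "A \<subseteq> (\<Union>s\<in>A. ball s (e n))" using e[of n] by auto
    then obtain S where "S \<subseteq> A" "finite S" "A \<subseteq> (\<Union>s\<in>S. ball s (e n))"
      using compactE_image[OF A(1), of A "\<lambda>s. ball s (e n)"] by blast
    then show ?thesis by blast
  qed
  then obtain S where S: "\<And>n. finite (S n)" "\<And>n. S n \<subseteq> A" "\<And>n. A \<subseteq> (\<Union>s\<in>S n. ball s (e n))"
    by metis
  have S_ne: "S n \<noteq> {}" for n using S(3)[of n] A(3) by auto
  have hull: "convex hull S n \<subseteq> A" for n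
    using S(2) A(2) by (rule hull_minimal)
  define Q where "Q n r = {a + r *\<^sub>R u |a u. a \<in> convex hull S n \<and> u \<in> ball 0 1}" for n r
  have "\<exists>p. degree p \<le> CARD('n) \<and> (\<forall>r>0. measure lebesgue (Q n r) = poly p r)" for n
    unfolding Q_def by (rule parallel_open_volume_poly[OF S(1) S_ne])
  then obtain p where p: "\<And>n. degree (p n) \<le> CARD('n)" "\<And>n r. r > 0 \<Longrightarrow> measure lebesgue (Q n r) = poly (p n) r"
    by metis
  have eq: "{a + r *\<^sub>R u |a u. a \<in> A \<and> u \<in> cball 0 1} = {x. infdist x A \<le> r}" if "r \<ge> 0" for r
    using parallel_body_eq_infdist[OF compact_imp_closed[OF A(1)] A(3) that] .
  have lm: "{x. infdist x A \<le> r} \<in> lmeasurable" for r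
    using compact_infdist_le[OF A(1,3)] by (rule lmeasurable_compact)
  have lower: "{x. infdist x A \<le> r} \<subseteq> Q n (r + e n)" if r: "r \<ge> 0" for r n
  proof
    fix x assume "x \<in> {x. infdist x A \<le> r}"
    then obtain a u where x: "x = a + r *\<^sub>R u" "a \<in> A" "norm u \<le> 1"
      unfolding eq[OF r, symmetric] by auto
    obtain s where s: "s \<in> S n" "dist s a < e n" using S(3)[of n] x(2) by auto
    have "norm ((a - s) + r *\<^sub>R u) \<le> norm (a - s) + r * norm u"
      using norm_triangle_ineq[of "a - s" "r *\<^sub>R u"] r by simp
    also have "\<dots> < e n + r" 
      using s x(3) r by (intro add_less_le_mono) (auto simp: dist_norm norm_minus_commute mult_left_le)
    finally have "((a - s) + r *\<^sub>R u) /\<^sub>R (r + e n) \<in> ball 0 1"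
      using r e[of n] by (simp add: divide_inverse[symmetric] inverse_eq_divide add.commute del: scaleR_right_distrib)
    moreover have "x = s + (r + e n) *\<^sub>R (((a - s) + r *\<^sub>R u) /\<^sub>R (r + e n))"
      using r e[of n] x(1) by simp
    ultimately show "x \<in> Q n (r + e n)"
      unfolding Q_def using hull_inc[OF s(1), of convex] by blast
  qed
  have upper: "Q n r \<subseteq> {x. infdist x A \<le> r}" if "r \<ge> 0" for n r
    unfolding Q_def eq[OF that, symmetric] using hull[of n] ball_subset_cball[of "0::real^'n::{finite,wellorder}" 1] by blast
  show ?thesis
  proof (rule poly_pointwise_limit)
    fix n
    \<comment> \<open>The shift by \<open>e n\<close> keeps the degree and makes the radius
      positive, so the polytope formula covers \<open>r = 0\<close> as well.\<close>
    have "degree (pcompose (p n) [:e n, 1:]) \<le> CARD('n)"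
      using p(1)[of n] by (simp add: degree_pcompose)
    moreover have "\<forall>r\<ge>0. measure lebesgue (Q n (r + e n)) = poly (pcompose (p n) [:e n, 1:]) r"
      using e[of n] p(2)[of _ n] by (simp add: poly_pcompose add.commute add_pos_nonneg)
    ultimately show "\<exists>q. degree q \<le> CARD('n) \<and> (\<forall>r\<ge>0. measure lebesgue (Q n (r + e n)) = poly q r)"
      by blast
  next
    fix r :: real assume r: "r \<ge> 0"
    have "decseq (\<lambda>n. {x. infdist x A \<le> r + e n})"
      by (auto simp: decseq_def e_def frac_le intro: order_trans)
    then have "(\<lambda>n. measure lebesgue {x. infdist x A \<le> r + e n}) \<longlonglongrightarrow> measure lebesgue (\<Inter>n. {x. infdist x A \<le> r + e n})"
      using fmeasurableD[OF lm] fmeasurableD2[OF lm]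
      by (intro Lim_measure_decseq) (auto simp del: emeasure_completion)
    also have "(\<Inter>n. {x. infdist x A \<le> r + e n}) = {x. infdist x A \<le> r}"
    proof (intro equalityI subsetI)
      fix x assume x: "x \<in> (\<Inter>n. {x. infdist x A \<le> r + e n})"
      have "(\<lambda>n. r + e n) \<longlonglongrightarrow> r + 0"
        unfolding e_def by (intro tendsto_intros LIMSEQ_Suc[OF lim_1_over_n])
      then show "x \<in> {x. infdist x A \<le> r}"
        using x by (auto intro: LIMSEQ_le_const)
    qed (auto intro: order_trans simp: e_def)
    finally have lim: "(\<lambda>n. measure lebesgue {x. infdist x A \<le> r + e n}) \<longlonglongrightarrow> measure lebesgue {x. infdist x A \<le> r}" .
    \<comment> \<open>As the image of the whole space under a differentiable map,
      \<open>Q n (r + e n)\<close> is Lebesgue measurable.\<close>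
    have Qm: "Q n (r + e n) \<in> sets lebesgue" for n
    proof -
      have "Q n (r + e n) = range (minkowski_map (S n) (r + e n))"
        unfolding Q_def using range_minkowski_map[OF S(1) S_ne, of "r + e n" n] r e[of n] by simp
      moreover have "(minkowski_map (S n) (r + e n)) differentiable_on UNIV"
        using has_derivative_minkowski_map[OF S(1) S_ne]
        by (auto simp: differentiable_on_def differentiable_def)
      ultimately show ?thesis
        using differentiable_image_in_sets_lebesgue[of UNIV "minkowski_map (S n) (r + e n)"] by auto
    qed
    show "(\<lambda>n. measure lebesgue (Q n (r + e n))) \<longlonglongrightarrow> measure lebesgue {x. infdist x A \<le> r}"
    proof (rule tendsto_sandwich[OF _ _ tendsto_const lim])
      have Qlm: "Q n (r + e n) \<in> lmeasurable" for n
        using upper[of "r + e n" n] r e[of n] by (intro fmeasurableI2[OF lm _ Qm]) auto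
      show "\<forall>\<^sub>F n in sequentially. measure lebesgue {x. infdist x A \<le> r} \<le> measure lebesgue (Q n (r + e n))"
        using lower[OF r] lm Qlm by (intro always_eventually allI measure_mono_fmeasurable) (auto simp: fmeasurableD)
      show "\<forall>\<^sub>F n in sequentially. measure lebesgue (Q n (r + e n)) \<le> measure lebesgue {x. infdist x A \<le> r + e n}"
        using upper[of "r + e _"] r e lm Qm
        by (intro always_eventually allI measure_mono_fmeasurable) (auto simp: add_nonneg_pos less_imp_le)
    qed
  qed
qed

lemma parallel_volume_poly:
  fixes A :: "(real^'n) set"
  assumes A: "compact A" "convex A" "A \<noteq> {}"
  shows "\<exists>p. degree p \<le> CARD('n) \<and> (\<forall>r\<ge>0. measure lborel {x. infdist x A \<le> r} = poly p r)"
proof -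
  let ?A = "wrap_vec ` A"
  have "(wrap_vec :: real^'n \<Rightarrow> _) \<in> borel_measurable borel"
    using linear_wrap_vec by (intro borel_measurable_continuous_onI linear_continuous_on)
      (simp add: linear_linear)
  then have meas: "wrap_vec \<in> borel_measurable (lborel :: (real^'n) measure)"
    by simp
  have "measure lebesgue {y. infdist y ?A \<le> r} = measure lborel {x. infdist x A \<le> r}" for r
  proof -
    have "measure lebesgue {y. infdist y ?A \<le> r} = measure lborel {y. infdist y ?A \<le> r}"
      using closed_infdist_le by (intro measure_completion) (auto intro: borel_closed)
    also have "\<dots> = measure (distr lborel borel wrap_vec) {y. infdist y ?A \<le> r}"
      by (simp add: lborel_wrap_vec)
    also have "\<dots> = measure lborel {x. infdist x A \<le> r}"
      using meas closed_infdist_le by (subst measure_distr) (auto intro!: borel_closed simp: infdist_wrap_vec vimage_def)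
    finally show ?thesis .
  qed
  moreover have "compact ?A" "convex ?A" "?A \<noteq> {}"
    using A linear_wrap_vec
    by (auto intro!: compact_continuous_image convex_linear_image linear_continuous_on simp: linear_linear)
  moreover have "CARD('n wellordered) = CARD('n)"
    using bij_wrap bij_betw_same_card by metis
  ultimately show ?thesis
    using parallel_volume_poly_wellorder[of ?A] by simp
qed

text \<open>This is what gives the definite description in \<open>intrinsic_volume\<close> a
  meaning, with \<open>c j\<close> the volume of the j-dimensional unit ball. Existence divides by
  \<open>c\<close>; uniqueness compares coefficients.\<close>

lemma steiner_coefficients:
  fixes d :: nat and c :: "nat \<Rightarrow> real" and p :: "real poly"
  assumes c: "\<And>j. j \<le> d \<Longrightarrow> c j \<noteq> 0" and p: "degree p \<le> d"
  shows "\<exists>!V :: nat \<Rightarrow> real. (\<forall>r\<ge>0. poly p r = (\<Sum>k\<le>d. r ^ (d - k) * c (d - k) * V k)) \<and> (\<forall>k>d. V k = 0)"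
proof (rule ex_ex1I)
  let ?V = "\<lambda>k. if k \<le> d then coeff p (d - k) / c (d - k) else 0"
  have "poly p r = (\<Sum>k\<le>d. r ^ (d - k) * c (d - k) * ?V k)" for r
  proof -
    have "poly p r = (\<Sum>j\<le>d. coeff p j * r ^ j)"
      unfolding poly_altdef using p by (intro sum.mono_neutral_left) (auto simp: coeff_eq_0)
    also have "\<dots> = (\<Sum>k\<le>d. coeff p (d - k) * r ^ (d - k))"
      using sum.nat_diff_reindex[of "\<lambda>j. coeff p j * r ^ j" "Suc d"] by (simp add: lessThan_Suc_atMost)
    also have "\<dots> = (\<Sum>k\<le>d. r ^ (d - k) * c (d - k) * ?V k)"
      using c by (intro sum.cong) auto
    finally show ?thesis .
  qed
  then show "\<exists>V. (\<forall>r\<ge>0. poly p r = (\<Sum>k\<le>d. r ^ (d - k) * c (d - k) * V k)) \<and> (\<forall>k>d. V k = 0)"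
    by (intro exI[of _ ?V]) auto
next
  fix V W :: "nat \<Rightarrow> real"
  assume V: "(\<forall>r\<ge>0. poly p r = (\<Sum>k\<le>d. r ^ (d - k) * c (d - k) * V k)) \<and> (\<forall>k>d. V k = 0)"
     and W: "(\<forall>r\<ge>0. poly p r = (\<Sum>k\<le>d. r ^ (d - k) * c (d - k) * W k)) \<and> (\<forall>k>d. W k = 0)"
  \<comment> \<open>The two expansions agree only for \<open>r \<ge> 0\<close>, but their difference
    then has infinitely many roots and is the zero polynomial.\<close>
  let ?q = "\<Sum>k\<le>d. monom (c (d - k) * (V k - W k)) (d - k)"
  have "poly ?q r = 0" if "r \<ge> 0" for r
  proof -
    have "poly ?q r = (\<Sum>k\<le>d. r ^ (d - k) * c (d - k) * V k) - (\<Sum>k\<le>d. r ^ (d - k) * c (d - k) * W k)"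
      by (simp add: poly_sum poly_monom sum_subtractf[symmetric] algebra_simps)
    then show ?thesis using V W that by simp
  qed
  then have "{0..} \<subseteq> {r. poly ?q r = 0}" by auto
  then have "infinite {r. poly ?q r = 0}"
    using infinite_Ici infinite_super by blast
  then have q: "?q = 0" using poly_roots_finite by blast
  have "V k = W k" if "k \<le> d" for k
  proof -
    have "0 = coeff ?q (d - k)" by (simp add: q)
    also have "\<dots> = (\<Sum>i\<le>d. if i = k then c (d - k) * (V k - W k) else 0)"
      unfolding coeff_sum using that by (intro sum.cong refl) auto
    also have "\<dots> = c (d - k) * (V k - W k)" using that by simp
    finally show ?thesis using c[of "d - k"] by simp
  qed
  then show "V = W" using V W by (metis ext not_le_imp_less)
qed

theorem steiner_formula:
  fixes A :: "(real^'n) set"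
  assumes A: "compact A" "convex A" "A \<noteq> {}" and r: "r \<ge> 0"
  shows "measure lborel {x. infdist x A \<le> r} =
    (\<Sum>k\<le>CARD('n). r ^ (CARD('n) - k) * unit_ball_vol (real (CARD('n) - k)) * intrinsic_volume k A)"
proof -
  obtain p where p: "degree p \<le> CARD('n)" "\<forall>r\<ge>0. measure lborel {x. infdist x A \<le> r} = poly p r"
    using parallel_volume_poly[OF A] by blast
  let ?P = "\<lambda>V. (\<forall>\<rho>\<ge>0. measure lborel {a + \<rho> *\<^sub>R u | a u. a \<in> A \<and> u \<in> cball 0 1} =
                (\<Sum>k\<le>CARD('n). \<rho> ^ (CARD('n) - k) * unit_ball_vol (real (CARD('n) - k)) * V k)) \<and>
        (\<forall>k>CARD('n). V k = 0)"
  \<comment> \<open>Once the parallel volume is replaced by \<open>poly p\<close>, the defining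
    predicate is the one treated in \<open>steiner_coefficients\<close>.\<close>
  have "?P = (\<lambda>V. (\<forall>r\<ge>0. poly p r = (\<Sum>k\<le>CARD('n). r ^ (CARD('n) - k) * unit_ball_vol (real (CARD('n) - k)) * V k)) \<and> (\<forall>k>CARD('n). V k = 0))"
    using p(2) parallel_body_eq_infdist[OF compact_imp_closed[OF A(1)] A(3)] by (intro ext) (auto cong: conj_cong)
  then have "\<exists>!V. ?P V"
    using steiner_coefficients[of "CARD('n)" "\<lambda>j. unit_ball_vol (real j)" p] p(1)
    by (simp add: less_imp_neq[OF unit_ball_vol_pos, symmetric])
  then have W: "?P (THE V. ?P V)" by (rule theI')
  define W where "W = (THE V. ?P V)"
  have iv: "intrinsic_volume k A = W k" for k
    unfolding W_def intrinsic_volume_def by simp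
  have "?P W" using W unfolding W_def .
  from this[THEN conjunct1, rule_format, OF r] show ?thesis
    unfolding parallel_body_eq_infdist[OF compact_imp_closed[OF A(1)] A(3) r] iv .
qed

section \<open>The Wills functional and the mean width\<close>

text \<open>The factor after \<open>r ^ j\<close> is minus the derivative of
  \<open>exp (- (pi * e\<^sup>2 * r\<^sup>2))\<close>. Its j-th moment is the Gamma quotient that is
  reciprocal to the ball volume, which is why the Steiner coefficients lose their factors under
  Gaussian integration.\<close>

lemma radial_gaussian_moment:
  assumes e: "(e::real) > 0"
  shows "has_bochner_integral lborel
    (\<lambda>r. indicator {0..} r * (r ^ j * (2 * pi * e\<^sup>2 * r * exp (- (pi * e\<^sup>2 * r\<^sup>2)))))
    (1 / (unit_ball_vol (real j) * e ^ j))"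
proof -
  have base: "has_bochner_integral lborel (\<lambda>r::real. indicator {0..} r *\<^sub>R (exp (- r\<^sup>2) * r ^ (j + 1)))
      (sqrt pi ^ j / (2 * unit_ball_vol (real j)))"
  \<comment> \<open>Both the closed form of the ball volume and the Gaussian moment of order
    \<open>j + 1\<close> depend on parity.\<close>
  proof (cases "even j")
    case True
    then obtain k where k: "j = 2 * k" by auto
    have E: "sqrt pi ^ j / (2 * unit_ball_vol (real j)) = fact k / 2"
      unfolding k unit_ball_vol_even by (simp add: power_mult)
    show ?thesis
      unfolding E using gaussian_moment_odd_pos[of k] by (simp only: k)
  next
    case False
    then obtain k where k: "j = 2 * k + 1" by (auto elim: oddE)
    have "sqrt pi ^ j / (2 * unit_ball_vol (real j)) = (sqrt pi / 2) * (fact (2 * Suc k) / (2 ^ (2 * Suc k) * fact (Suc k)))"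
      unfolding k unit_ball_vol_odd by (simp add: power_mult power_add)
    then show ?thesis
      using gaussian_moment_even_pos[of "Suc k"] k by simp
  qed
  \<comment> \<open>The substitution by \<open>c\<close> turns the variance of
    \<open>exp (- r\<^sup>2)\<close> into that of
    \<open>exp (- (pi * e\<^sup>2 * r\<^sup>2))\<close>.\<close>
  define c where "c = sqrt pi * e"
  have c: "c > 0" "c\<^sup>2 = pi * e\<^sup>2" using e by (auto simp: c_def power_mult_distrib)
  have "has_bochner_integral lborel (\<lambda>r. indicator {0..} (0 + c * r) *\<^sub>R (exp (- (0 + c * r)\<^sup>2) * (0 + c * r) ^ (j + 1)))
      ((sqrt pi ^ j / (2 * unit_ball_vol (real j))) /\<^sub>R \<bar>c\<bar>)"
    using base c(1) by (subst (asm) lborel_has_bochner_integral_real_affine_iff[where t = 0 and c = c]) auto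
  then have "has_bochner_integral lborel (\<lambda>r. (2 * c / c ^ j) * (indicator {0..} (0 + c * r) *\<^sub>R (exp (- (0 + c * r)\<^sup>2) * (0 + c * r) ^ (j + 1))))
      ((2 * c / c ^ j) * ((sqrt pi ^ j / (2 * unit_ball_vol (real j))) /\<^sub>R \<bar>c\<bar>))"
    by (intro has_bochner_integral_mult_right) auto
  also have "(\<lambda>r. (2 * c / c ^ j) * (indicator {0..} (0 + c * r) *\<^sub>R (exp (- (0 + c * r)\<^sup>2) * (0 + c * r) ^ (j + 1))))
     = (\<lambda>r. indicator {0..} r * (r ^ j * (2 * pi * e\<^sup>2 * r * exp (- (pi * e\<^sup>2 * r\<^sup>2)))))"
  proof
    fix r :: real
    have "(indicator {0..} (c * r) :: real) = indicator {0..} r"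
      using c(1) by (auto simp: indicator_def zero_le_mult_iff)
    moreover have "(2 * c / c ^ j) * (exp (- (c * r)\<^sup>2) * (c * r) ^ (j + 1))
        = r ^ j * (2 * c\<^sup>2 * r * exp (- (c\<^sup>2 * r\<^sup>2)))"
      using c(1) by (simp add: power_mult_distrib power2_eq_square)
    ultimately show "(2 * c / c ^ j) * (indicator {0..} (0 + c * r) *\<^sub>R (exp (- (0 + c * r)\<^sup>2) * (0 + c * r) ^ (j + 1)))
      = indicator {0..} r * (r ^ j * (2 * pi * e\<^sup>2 * r * exp (- (pi * e\<^sup>2 * r\<^sup>2))))"
      unfolding c(2) by (cases "r \<ge> 0") (simp_all add: mult.assoc mult.left_commute)
  qed
  also have "(2 * c / c ^ j) * ((sqrt pi ^ j / (2 * unit_ball_vol (real j))) /\<^sub>R \<bar>c\<bar>) = 1 / (unit_ball_vol (real j) * e ^ j)"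
    using c(1) e by (simp add: c_def power_mult_distrib field_simps)
  finally show ?thesis .
qed

lemma exp_neg_square_layer_cake:
  assumes e: "(e::real) > 0" and D: "D \<ge> 0"
  shows "(\<integral>\<^sup>+r. ennreal (2 * pi * e\<^sup>2 * r * exp (- (pi * e\<^sup>2 * r\<^sup>2))) * indicator {D..} r \<partial>lborel)
    = ennreal (exp (- (pi * e\<^sup>2 * D\<^sup>2)))"
proof -
  have c: "pi * e\<^sup>2 > 0" using e by simp
  have "(\<integral>\<^sup>+r. ennreal (2 * pi * e\<^sup>2 * r * exp (- (pi * e\<^sup>2 * r\<^sup>2))) * indicator {D..} r \<partial>lborel)
      = ennreal (0 - - exp (- (pi * e\<^sup>2 * D\<^sup>2)))"
  proof (rule nn_integral_FTC_atLeast)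
    show "((\<lambda>r. - exp (- (pi * e\<^sup>2 * r\<^sup>2))) has_real_derivative 2 * pi * e\<^sup>2 * r * exp (- (pi * e\<^sup>2 * r\<^sup>2))) (at r)" for r
      by (auto intro!: derivative_eq_intros)
    have "filterlim (\<lambda>r::real. pi * e\<^sup>2 * r\<^sup>2) at_top at_top"
      using c by (intro filterlim_tendsto_pos_mult_at_top[OF tendsto_const] filterlim_pow_at_top filterlim_ident) auto
    then have "((\<lambda>r. exp (- (pi * e\<^sup>2 * r\<^sup>2))) \<longlongrightarrow> 0) at_top"
      by (intro filterlim_compose[OF exp_at_bot] filterlim_compose[OF filterlim_uminus_at_bot_at_top])
    from tendsto_minus[OF this] show "((\<lambda>r. - exp (- (pi * e\<^sup>2 * r\<^sup>2))) \<longlongrightarrow> 0) at_top"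
      by simp
  qed (use D e in auto)
  then show ?thesis by simp
qed

text \<open>A rescaled version of Hadwiger's formula for the Wills functional.\<close>

lemma wills_functional:
  fixes A :: "(real^'n) set"
  assumes A: "compact A" "convex A" "A \<noteq> {}" and e: "e > 0"
  shows "has_bochner_integral lborel (\<lambda>x. exp (- (pi * e\<^sup>2 * (infdist x A)\<^sup>2)))
    (\<Sum>k\<le>CARD('n). intrinsic_volume k A / e ^ (CARD('n) - k))"
proof -
  let ?d = "CARD('n)"
  define g where "g r = 2 * pi * e\<^sup>2 * r * exp (- (pi * e\<^sup>2 * r\<^sup>2))" for r :: real
  have [measurable]: "g \<in> borel_measurable borel" unfolding g_def by measurable
  have g_nn: "g r \<ge> 0" if "r \<ge> 0" for r using that by (simp add: g_def)
  have [measurable]: "(\<lambda>x. infdist x A) \<in> borel_measurable borel"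
    by (intro borel_measurable_continuous_onI continuous_intros)
  let ?F = "\<lambda>r. indicator {0..} r * (g r * measure lborel {x. infdist x A \<le> r})"
  \<comment> \<open>The Steiner formula is integrated term by term against \<open>g\<close>; each
    ball volume cancels against its radial moment.\<close>
  have F: "has_bochner_integral lborel ?F (\<Sum>k\<le>?d. intrinsic_volume k A / e ^ (?d - k))"
  proof -
    have "has_bochner_integral lborel
        (\<lambda>r. \<Sum>k\<le>?d. (unit_ball_vol (real (?d - k)) * intrinsic_volume k A) * (indicator {0..} r * (r ^ (?d - k) * g r)))
        (\<Sum>k\<le>?d. (unit_ball_vol (real (?d - k)) * intrinsic_volume k A) * (1 / (unit_ball_vol (real (?d - k)) * e ^ (?d - k))))"
      unfolding g_def
      by (intro has_bochner_integral_sum has_bochner_integral_mult_right radial_gaussian_moment e)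
    also have "(\<lambda>r. \<Sum>k\<le>?d. (unit_ball_vol (real (?d - k)) * intrinsic_volume k A) * (indicator {0..} r * (r ^ (?d - k) * g r))) = ?F"
      by (auto simp: fun_eq_iff steiner_formula[OF A] sum_distrib_left sum_distrib_right mult_ac
          split: split_indicator intro!: sum.cong)
    also have "(\<Sum>k\<le>?d. (unit_ball_vol (real (?d - k)) * intrinsic_volume k A) * (1 / (unit_ball_vol (real (?d - k)) * e ^ (?d - k))))
        = (\<Sum>k\<le>?d. intrinsic_volume k A / e ^ (?d - k))"
      using less_imp_neq[OF unit_ball_vol_pos, symmetric] by (intro sum.cong refl) (simp del: of_nat_diff)
    finally show ?thesis .
  qed
  have F_nn: "?F r \<ge> 0" for r using g_nn by (auto split: split_indicator)
  have "(\<integral>\<^sup>+x. ennreal (exp (- (pi * e\<^sup>2 * (infdist x A)\<^sup>2))) \<partial>lborel)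
      = (\<integral>\<^sup>+x. \<integral>\<^sup>+r. ennreal (g r) * indicator {infdist x A..} r \<partial>lborel \<partial>lborel)"
    unfolding g_def by (intro nn_integral_cong exp_neg_square_layer_cake[symmetric] e infdist_nonneg)
  also have "\<dots> = (\<integral>\<^sup>+r. \<integral>\<^sup>+x. ennreal (g r) * indicator {infdist x A..} r \<partial>lborel \<partial>lborel)"
    by (intro lborel_pair.Fubini'[symmetric]) (measurable, simp)
  also have "\<dots> = (\<integral>\<^sup>+r. ennreal (?F r) \<partial>lborel)"
  proof (intro nn_integral_cong)
    fix r :: real
    have "(\<integral>\<^sup>+x. ennreal (g r) * indicator {infdist x A..} r \<partial>lborel)
        = (\<integral>\<^sup>+x. ennreal (g r) * indicator {x. infdist x A \<le> r} x \<partial>lborel)"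
      by (intro nn_integral_cong) (auto split: split_indicator)
    also have "\<dots> = ennreal (g r) * emeasure lborel {x. infdist x A \<le> r}"
      using closed_infdist_le by (subst nn_integral_cmult_indicator) auto
    also have "emeasure lborel {x. infdist x A \<le> r} = ennreal (measure lborel {x. infdist x A \<le> r})"
      using emeasure_compact_finite[OF compact_infdist_le[OF A(1,3)], of r] by (intro emeasure_eq_ennreal_measure) auto
    also have "ennreal (g r) * \<dots> = ennreal (?F r)"
    proof (cases "r \<ge> 0")
      case False
      then have "\<not> infdist x A \<le> r" for x using infdist_nonneg[of x A] by linarith
      then show ?thesis using False by simp
    qed (simp add: g_nn ennreal_mult')
    finally show "(\<integral>\<^sup>+x. ennreal (g r) * indicator {infdist x A..} r \<partial>lborel) = ennreal (?F r)" .
  qed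
  also have "\<dots> = ennreal (\<Sum>k\<le>?d. intrinsic_volume k A / e ^ (?d - k))"
    using F F_nn by (subst nn_integral_eq_integral) (auto simp: has_bochner_integral_iff)
  finally have nn: "(\<integral>\<^sup>+x. ennreal (exp (- (pi * e\<^sup>2 * (infdist x A)\<^sup>2))) \<partial>lborel)
      = ennreal (\<Sum>k\<le>?d. intrinsic_volume k A / e ^ (?d - k))" .
  have "0 \<le> (\<integral>r. ?F r \<partial>lborel)"
    using F_nn by (rule Bochner_Integration.integral_nonneg)
  then have "(\<Sum>k\<le>?d. intrinsic_volume k A / e ^ (?d - k)) \<ge> 0"
    unfolding has_bochner_integral_integral_eq[OF F] .
  then show ?thesis
    using nn by (intro has_bochner_integral_nn_integral) auto
qed

text \<open>\<open>e * infdist (x /\<^sub>R e) A\<close> is the distance from \<open>x\<close> to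
  the dilate of \<open>A\<close> by \<open>e\<close>. The change of variables contributes
  \<open>e\<close> to the power d and so turns the exponents k - d into k.\<close>

lemma wills_functional_scaled:
  fixes A :: "(real^'n) set"
  assumes A: "compact A" "convex A" "A \<noteq> {}" and e: "e > 0"
  shows "has_bochner_integral lborel (\<lambda>x. exp (- (pi * (e * infdist (x /\<^sub>R e) A)\<^sup>2)))
    (\<Sum>k\<le>CARD('n). intrinsic_volume k A * e ^ k)"
proof -
  let ?d = "CARD('n)"
  let ?f = "\<lambda>x. exp (- (pi * (e * infdist (x /\<^sub>R e) A)\<^sup>2))"
  have meas: "(\<lambda>x. infdist (x /\<^sub>R e) A) \<in> borel_measurable borel"
    by (intro borel_measurable_continuous_onI continuous_intros)
  have "lborel = density (distr lborel borel (\<lambda>x::real^'n. 0 + e *\<^sub>R x)) (\<lambda>_. \<bar>e\<bar> ^ DIM(real^'n))"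
    using e by (intro lborel_affine) auto
  then have L: "lborel = density (distr lborel borel (\<lambda>x::real^'n. e *\<^sub>R x)) (\<lambda>_. e ^ ?d)"
    using e by simp
  have "has_bochner_integral lborel (\<lambda>x. e ^ ?d * exp (- (pi * e\<^sup>2 * (infdist x A)\<^sup>2)))
      (e ^ ?d * (\<Sum>k\<le>?d. intrinsic_volume k A / e ^ (?d - k)))"
    by (intro has_bochner_integral_mult_right wills_functional A e)
  also have "(\<lambda>x. e ^ ?d * exp (- (pi * e\<^sup>2 * (infdist x A)\<^sup>2))) = (\<lambda>x. e ^ ?d *\<^sub>R ?f (e *\<^sub>R x))"
    using e by (simp add: power_mult_distrib mult_ac)
  also have "e ^ ?d * (\<Sum>k\<le>?d. intrinsic_volume k A / e ^ (?d - k)) = (\<Sum>k\<le>?d. intrinsic_volume k A * e ^ k)"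
    using e by (auto simp: sum_distrib_left power_diff intro!: sum.cong)
  finally have "has_bochner_integral lborel (\<lambda>x. e ^ ?d *\<^sub>R ?f (e *\<^sub>R x)) (\<Sum>k\<le>?d. intrinsic_volume k A * e ^ k)" .
  then have "has_bochner_integral (distr lborel borel (\<lambda>x::real^'n. e *\<^sub>R x)) (\<lambda>x. e ^ ?d *\<^sub>R ?f x) (\<Sum>k\<le>?d. intrinsic_volume k A * e ^ k)"
    using meas by (subst has_bochner_integral_distr) auto
  then show ?thesis
    using meas e by (subst L) (subst has_bochner_integral_density, auto)
qed

section \<open>Support functions and the derivative of the Wills functional at zero\<close>

definition support_fun :: "'a::real_inner set \<Rightarrow> 'a \<Rightarrow> real" where
  "support_fun A x = (SUP a\<in>A. a \<bullet> x)"

lemma bounded_inner_image: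
  assumes "bounded A"
  shows "bdd_above ((\<lambda>a. a \<bullet> x) ` A)"
proof -
  obtain B where "\<forall>a\<in>A. norm a \<le> B" using assms bounded_iff by blast
  then have "\<forall>a\<in>A. \<bar>a \<bullet> x\<bar> \<le> B * norm x"
    by (meson Cauchy_Schwarz_ineq2 mult_right_mono norm_ge_zero order_trans)
  then show ?thesis
    by (auto simp: abs_le_iff intro!: bdd_aboveI2[of _ _ "B * norm x"])
qed

lemma support_fun_upper: "bounded A \<Longrightarrow> a \<in> A \<Longrightarrow> a \<bullet> x \<le> support_fun A x"
  unfolding support_fun_def by (intro cSUP_upper bounded_inner_image)

lemma support_fun_bound:
  assumes "\<forall>a\<in>A. norm a \<le> R" "A \<noteq> {}"
  shows "\<bar>support_fun A x\<bar> \<le> R * norm x"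
proof -
  have b: "bounded A" using assms(1) bounded_iff by blast
  have *: "\<bar>a \<bullet> x\<bar> \<le> R * norm x" if "a \<in> A" for a
    using assms(1) that by (meson Cauchy_Schwarz_ineq2 mult_right_mono norm_ge_zero order_trans)
  obtain a where a: "a \<in> A" using assms by auto
  have "support_fun A x \<le> R * norm x"
    unfolding support_fun_def using assms(2) * by (intro cSUP_least) (auto simp: abs_le_iff)
  moreover have "- (R * norm x) \<le> support_fun A x"
    using *[OF a] support_fun_upper[OF b a, of x] by linarith
  ultimately show ?thesis by linarith
qed

text \<open>Expanding \<open>(norm (x - e *\<^sub>R a))\<^sup>2\<close> and minimising over
  \<open>a\<close> leaves the support function up to the quadratic term, which is at most
  \<open>e * R\<^sup>2 / 2\<close> after division by \<open>2 * e\<close>.\<close>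

lemma scaled_infdist_expansion:
  fixes A :: "'a::euclidean_space set" and x :: 'a
  assumes A: "closed A" "A \<noteq> {}" "\<forall>a\<in>A. norm a \<le> R" and e: "e > 0"
  defines "q \<equiv> ((norm x)\<^sup>2 - (e * infdist (x /\<^sub>R e) A)\<^sup>2) / (2 * e)"
  shows "support_fun A x - e * R\<^sup>2 / 2 \<le> q" "q \<le> support_fun A x"
proof -
  have b: "bounded A" using A(3) bounded_iff by blast
  have expand: "(e * dist (x /\<^sub>R e) a)\<^sup>2 = (norm x)\<^sup>2 - 2 * e * (a \<bullet> x) + e\<^sup>2 * (norm a)\<^sup>2" for a
  proof -
    have "e * dist (x /\<^sub>R e) a = norm (e *\<^sub>R (x /\<^sub>R e - a))"
      using e by (simp add: dist_norm del: scaleR_right_diff_distrib)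
    also have "e *\<^sub>R (x /\<^sub>R e - a) = x - e *\<^sub>R a"
      using e by (simp add: algebra_simps)
    finally have "(e * dist (x /\<^sub>R e) a)\<^sup>2 = (norm (x - e *\<^sub>R a))\<^sup>2" by simp
    then show ?thesis
      by (simp only: power2_norm_eq_inner) (simp add: inner_diff_left inner_diff_right inner_commute algebra_simps power2_eq_square)
  qed
  obtain a where a: "a \<in> A" "infdist (x /\<^sub>R e) A = dist (x /\<^sub>R e) a"
    using infdist_attains_inf[OF A(1,2)] by auto
  have "q = a \<bullet> x - e * (norm a)\<^sup>2 / 2"
    unfolding q_def a(2) expand using e by (simp add: field_simps power2_eq_square)
  also have "\<dots> \<le> a \<bullet> x" using e by simp
  also have "\<dots> \<le> support_fun A x" using a b by (intro support_fun_upper)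
  finally show "q \<le> support_fun A x" .
  have "a \<bullet> x \<le> q + e * R\<^sup>2 / 2" if "a \<in> A" for a
  proof -
    have "(e * infdist (x /\<^sub>R e) A)\<^sup>2 \<le> (e * dist (x /\<^sub>R e) a)\<^sup>2"
      using that e by (intro power_mono mult_left_mono infdist_le) (auto simp: infdist_nonneg)
    then have "a \<bullet> x - e * (norm a)\<^sup>2 / 2 \<le> q"
      unfolding q_def expand using e by (simp add: field_simps power2_eq_square)
    moreover have "e * (norm a)\<^sup>2 / 2 \<le> e * R\<^sup>2 / 2"
      using A(3) that e by (intro divide_right_mono mult_left_mono power_mono) auto
    ultimately show ?thesis by linarith
  qed
  then have "support_fun A x \<le> q + e * R\<^sup>2 / 2"
    unfolding support_fun_def using A(2) by (intro cSUP_least)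
  then show "support_fun A x - e * R\<^sup>2 / 2 \<le> q" by simp
qed

lemma abs_exp_minus_one_le: "\<bar>exp y - 1\<bar> \<le> \<bar>y\<bar> * exp \<bar>y\<bar>" for y :: real
proof (cases "y \<ge> 0")
  case True
  have "1 - y \<le> exp (- y)" using exp_ge_add_one_self[of "-y"] by simp
  then have "(1 - y) * exp y \<le> exp (- y) * exp y" by (intro mult_right_mono) auto
  then show ?thesis using True by (simp add: exp_minus algebra_simps)
next
  case False
  have "1 + y \<le> exp y" by (rule exp_ge_add_one_self)
  moreover have "y * exp (- y) \<le> y * 1" using False by (intro mult_left_mono_neg) auto
  ultimately have "1 - exp y \<le> - (y * exp (- y))" by linarith
  then show ?thesis using False by simp
qed

text \<open>The inequality \<open>1 + y \<le> exp y\<close>, used at both signs of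
  \<open>y = e n * c n\<close>, encloses the quotient between \<open>c n\<close> and
  \<open>c n * exp (e n * c n)\<close>.\<close>

lemma exp_difference_quotient_tendsto:
  fixes c e :: "nat \<Rightarrow> real"
  assumes c: "c \<longlonglongrightarrow> c0" and e: "e \<longlonglongrightarrow> 0" "\<And>n. e n > 0"
  shows "(\<lambda>n. (exp (e n * c n) - 1) / e n) \<longlonglongrightarrow> c0"
proof (rule tendsto_sandwich)
  show "\<forall>\<^sub>F n in sequentially. c n \<le> (exp (e n * c n) - 1) / e n"
  proof (intro always_eventually allI)
    fix n
    have "e n * c n \<le> exp (e n * c n) - 1"
      using exp_ge_add_one_self[of "e n * c n"] by linarith
    then show "c n \<le> (exp (e n * c n) - 1) / e n"
      using e(2)[of n] by (simp add: field_simps)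
  qed
  show "\<forall>\<^sub>F n in sequentially. (exp (e n * c n) - 1) / e n \<le> c n * exp (e n * c n)"
  proof (intro always_eventually allI)
    fix n
    have "1 - e n * c n \<le> exp (- (e n * c n))" using exp_ge_add_one_self[of "- (e n * c n)"] by simp
    then have "(1 - e n * c n) * exp (e n * c n) \<le> exp (- (e n * c n)) * exp (e n * c n)"
      by (intro mult_right_mono) auto
    then have "exp (e n * c n) - 1 \<le> e n * c n * exp (e n * c n)"
      by (simp add: exp_minus algebra_simps)
    then show "(exp (e n * c n) - 1) / e n \<le> c n * exp (e n * c n)"
      using e(2)[of n] by (simp add: field_simps)
  qed
  show "c \<longlonglongrightarrow> c0" by fact
  have "(\<lambda>n. c n * exp (e n * c n)) \<longlonglongrightarrow> c0 * exp (0 * c0)"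
    by (intro tendsto_intros c e)
  then show "(\<lambda>n. c n * exp (e n * c n)) \<longlonglongrightarrow> c0" by simp
qed

text \<open>A support function is Lipschitz with constant the radius of a ball around 0 that
  contains \<open>A\<close>.\<close>

lemma borel_measurable_support_fun:
  fixes A :: "'a::euclidean_space set"
  assumes A: "bounded A" "A \<noteq> {}"
  shows "support_fun A \<in> borel_measurable borel"
proof -
  obtain R where R: "\<forall>a\<in>A. norm a \<le> R" using A bounded_iff by blast
  have "support_fun A x \<le> support_fun A y + R * dist x y" for x y
  proof -
    have "a \<bullet> x \<le> support_fun A y + R * dist x y" if a: "a \<in> A" for a
    proof -
      have "a \<bullet> x = a \<bullet> y + a \<bullet> (x - y)" by (simp add: inner_diff_right)
      also have "a \<bullet> (x - y) \<le> norm a * norm (x - y)" by (rule norm_cauchy_schwarz)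
      also have "\<dots> \<le> R * dist x y" using R a by (simp add: dist_norm mult_right_mono)
      finally show ?thesis using support_fun_upper[OF A(1) a, of y] by linarith
    qed
    then show ?thesis unfolding support_fun_def[of A x] using A(2) by (intro cSUP_least)
  qed
  note 1 = this
  have "dist (support_fun A x) (support_fun A y) \<le> R * dist x y" for x y
    using 1[of x y] 1[of y x] by (auto simp: dist_real_def abs_le_iff dist_commute)
  moreover have "R \<ge> 0" using R A(2) norm_ge_zero order_trans by blast
  ultimately have "R-lipschitz_on UNIV (support_fun A)"
    by (intro lipschitz_onI) auto
  then show ?thesis
    by (intro borel_measurable_continuous_onI lipschitz_on_continuous_on)
qed

theorem intrinsic_volume_1_gaussian:
  fixes A :: "(real^'n) set"
  assumes A: "compact A" "convex A" "A \<noteq> {}"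
  shows "has_bochner_integral lborel (\<lambda>x. 2 * pi * support_fun A x * exp (- (pi * (norm x)\<^sup>2))) (intrinsic_volume 1 A)"
proof -
  let ?d = "CARD('n)"
  obtain R0 where R0: "\<forall>a\<in>A. norm a \<le> R0" using compact_imp_bounded[OF A(1)] bounded_iff by blast
  define R where "R = max 0 R0"
  have R: "\<forall>a\<in>A. norm a \<le> R" "R \<ge> 0" using R0 by (auto simp: R_def le_max_iff_disj)
  have closed: "closed A" using A(1) by (rule compact_imp_closed)
  define e where "e n = 1 / real (Suc n)" for n
  have e: "e n > 0" "e n \<le> 1" for n by (auto simp: e_def)
  have e_lim: "e \<longlonglongrightarrow> 0" unfolding e_def by (intro LIMSEQ_Suc[OF lim_1_over_n])
  define q where "q n x = ((norm x)\<^sup>2 - (e n * infdist (x /\<^sub>R e n) A)\<^sup>2) / (2 * e n)" for n x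
  have q: "support_fun A x - e n * R\<^sup>2 / 2 \<le> q n x" "q n x \<le> support_fun A x" for n x
    unfolding q_def using scaled_infdist_expansion[OF closed A(3) R(1) e(1)] by auto
  have q_lim: "(\<lambda>n. q n x) \<longlonglongrightarrow> support_fun A x" for x
  proof (rule tendsto_sandwich[OF _ _ _ tendsto_const])
    have "(\<lambda>n. support_fun A x - e n * R\<^sup>2 / 2) \<longlonglongrightarrow> support_fun A x - 0 * R\<^sup>2 / 2"
      by (intro tendsto_intros e_lim) auto
    then show "(\<lambda>n. support_fun A x - e n * R\<^sup>2 / 2) \<longlonglongrightarrow> support_fun A x" by simp
  qed (use q in auto)
  define G where "G n x = exp (- (pi * (e n * infdist (x /\<^sub>R e n) A)\<^sup>2))" for n x
  define G0 where "G0 x = exp (- (pi * (norm x)\<^sup>2))" for x :: "real^'n"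
  \<comment> \<open>Dividing out the Gaussian leaves an exponential whose exponent is
    \<open>e n\<close> times a quantity tending to \<open>2 * pi * support_fun A x\<close>.\<close>
  have G_eq: "G n x = G0 x * exp (e n * (2 * pi * q n x))" for n x
  proof -
    have "- (pi * (e n * infdist (x /\<^sub>R e n) A)\<^sup>2) = - (pi * (norm x)\<^sup>2) + e n * (2 * pi * q n x)"
      unfolding q_def using e(1)[of n] by (simp add: field_simps)
    then show ?thesis unfolding G_def G0_def by (simp only: exp_add)
  qed
  have G_int: "has_bochner_integral lborel (G n) (\<Sum>k\<le>?d. intrinsic_volume k A * e n ^ k)" for n
    unfolding G_def[abs_def] by (rule wills_functional_scaled[OF A e(1)])
  \<comment> \<open>Integrability of a Gaussian is the Wills functional of the one-point body at the
    origin.\<close>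
  have gauss_int: "integrable lborel (\<lambda>x::real^'n. exp (- (pi * c\<^sup>2 * (norm x)\<^sup>2)))" if "c > 0" for c
    using wills_functional[of "{0::real^'n}" c] that by (auto simp: has_bochner_integral_iff)
  have G0_int: "integrable lborel G0"
    unfolding G0_def[abs_def] using gauss_int[of 1] by simp
  let ?f = "\<lambda>n x. (G n x - G0 x) / e n"
  let ?g = "\<lambda>x. 2 * pi * support_fun A x * G0 x"
  \<comment> \<open>The difference quotient is at most \<open>G0 x * exp (4 * pi * B)\<close> with
    \<open>B = R * norm x + R\<^sup>2\<close>. Completing a square sacrifices half of the Gaussian
    exponent to absorb the linear term, hence \<open>sqrt (1/2)\<close>; the 12 is a generous
    version of the 8 from the square.\<close>
  let ?w = "\<lambda>x::real^'n. exp (12 * pi * R\<^sup>2 + 4 * pi * R\<^sup>2) * exp (- (pi * (sqrt (1/2))\<^sup>2 * (norm x)\<^sup>2))"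
  have w_int: "integrable lborel ?w"
    by (intro integrable_mult_right gauss_int) auto
  have [measurable]: "support_fun A \<in> borel_measurable borel"
    using compact_imp_bounded[OF A(1)] A(3) by (rule borel_measurable_support_fun)
  have [measurable]: "G0 \<in> borel_measurable borel" "G n \<in> borel_measurable borel" for n
    using borel_measurable_integrable[OF G0_int] has_bochner_integral_iff[THEN iffD1, OF G_int, THEN conjunct1, THEN borel_measurable_integrable]
    by auto
  have lim: "(\<lambda>n. ?f n x) \<longlonglongrightarrow> ?g x" for x
  proof -
    have "(\<lambda>n. (exp (e n * (2 * pi * q n x)) - 1) / e n) \<longlonglongrightarrow> 2 * pi * support_fun A x"
      by (intro exp_difference_quotient_tendsto tendsto_intros q_lim e_lim e)
    then have "(\<lambda>n. G0 x * ((exp (e n * (2 * pi * q n x)) - 1) / e n)) \<longlonglongrightarrow> G0 x * (2 * pi * support_fun A x)"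
      by (intro tendsto_intros)
    then show ?thesis by (simp add: G_eq field_simps)
  qed
  have bound: "norm (?f n x) \<le> ?w x" for n x
  proof -
    define B where "B = R * norm x + R\<^sup>2"
    have B: "B \<ge> 0" using R(2) by (simp add: B_def)
    have "\<bar>support_fun A x\<bar> \<le> R * norm x" using R(1) A(3) by (rule support_fun_bound)
    moreover have "e n * R\<^sup>2 / 2 \<le> R\<^sup>2" 
      using e[of n] mult_right_mono[of "e n" 1 "R\<^sup>2"] zero_le_power2[of R] by linarith
    ultimately have "\<bar>q n x\<bar> \<le> B" using q(1)[of x n] q(2)[of n x] unfolding B_def abs_le_iff
      by (auto simp: algebra_simps)
    then have y: "\<bar>2 * pi * q n x\<bar> \<le> 2 * pi * B" by (simp add: abs_mult)
    have "\<bar>exp (e n * (2 * pi * q n x)) - 1\<bar> \<le> \<bar>e n * (2 * pi * q n x)\<bar> * exp \<bar>e n * (2 * pi * q n x)\<bar>"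
      by (rule abs_exp_minus_one_le)
    also have "\<dots> \<le> (e n * (2 * pi * B)) * exp (2 * pi * B)"
    proof (intro mult_mono)
      show "\<bar>e n * (2 * pi * q n x)\<bar> \<le> e n * (2 * pi * B)"
        unfolding abs_mult[of "e n"] using e(1)[of n] y by simp
      have "e n * (2 * pi * B) \<le> 1 * (2 * pi * B)" using e[of n] B by (intro mult_right_mono) auto
      then show "exp \<bar>e n * (2 * pi * q n x)\<bar> \<le> exp (2 * pi * B)"
        using order_trans[OF \<open>\<bar>e n * (2 * pi * q n x)\<bar> \<le> e n * (2 * pi * B)\<close>] by simp
    qed (use e(1)[of n] B in auto)
    finally have "\<bar>exp (e n * (2 * pi * q n x)) - 1\<bar> / e n \<le> (2 * pi * B) * exp (2 * pi * B)"
      using e(1)[of n] by (simp add: field_simps)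
    also have "\<dots> \<le> exp (2 * pi * B) * exp (2 * pi * B)"
      using exp_ge_add_one_self[of "2 * pi * B"] by (intro mult_right_mono; (linarith | simp))
    also have "\<dots> = exp (4 * pi * B)" by (simp add: exp_add[symmetric])
    finally have 1: "\<bar>exp (e n * (2 * pi * q n x)) - 1\<bar> / e n \<le> exp (4 * pi * B)" .
    have "norm (?f n x) = G0 x * (\<bar>exp (e n * (2 * pi * q n x)) - 1\<bar> / e n)"
    proof -
      have "?f n x = G0 x * ((exp (e n * (2 * pi * q n x)) - 1) / e n)"
        by (simp add: G_eq field_simps)
      then show ?thesis using e(1)[of n] by (simp add: abs_mult G0_def)
    qed
    also have "\<dots> \<le> G0 x * exp (4 * pi * B)"
      using 1 by (intro mult_left_mono) (auto simp: G0_def)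
    also have "\<dots> = exp (- (pi * (norm x)\<^sup>2) + 4 * pi * B)"
      by (simp only: G0_def exp_add)
    also have "\<dots> \<le> exp ((12 * pi * R\<^sup>2 + 4 * pi * R\<^sup>2) + - (pi * (sqrt (1/2))\<^sup>2 * (norm x)\<^sup>2))"
    proof -
      have "0 \<le> (norm x - 4 * R)\<^sup>2" by simp
      then have "4 * (R * norm x) \<le> (norm x)\<^sup>2 / 2 + 8 * R\<^sup>2"
        by (simp add: power2_eq_square algebra_simps)
      then have "4 * (R * norm x) \<le> (norm x)\<^sup>2 / 2 + 12 * R\<^sup>2"
        using zero_le_power2[of R] by linarith
      then have "pi * (4 * (R * norm x)) \<le> pi * ((norm x)\<^sup>2 / 2 + 12 * R\<^sup>2)"
        by (intro mult_left_mono) auto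
      then show ?thesis
        unfolding B_def by (simp add: algebra_simps)
    qed
    finally show ?thesis by (simp only: exp_add)
  qed
  have g_int: "integrable lborel ?g"
    by (rule integrable_dominated_convergence[where s = ?f, OF _ _ w_int]) (use lim bound in auto)
  have int_lim: "(\<lambda>n. \<integral>x. ?f n x \<partial>lborel) \<longlonglongrightarrow> (\<integral>x. ?g x \<partial>lborel)"
    by (rule integral_dominated_convergence[OF _ _ w_int]) (use lim bound in auto)
  \<comment> \<open>The Gaussian integral need not be evaluated: convergence of
    \<open>(P (e n) - I) / e n\<close> with \<open>e n\<close> tending to 0 already forces
    \<open>I\<close> to be the constant term of \<open>P\<close>.\<close>
  define I where "I = (\<integral>x. G0 x \<partial>lborel)"
  define P where "P y = (\<Sum>k\<le>?d. intrinsic_volume k A * y ^ k)" for y :: real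
  define Q where "Q y = (\<Sum>k<?d. intrinsic_volume (Suc k) A * y ^ k)" for y :: real
  have PQ: "P y = intrinsic_volume 0 A + y * Q y" for y
    unfolding P_def Q_def lessThan_Suc_atMost[symmetric] sum.lessThan_Suc_shift
    by (simp add: sum_distrib_left mult_ac)
  have int_f: "(\<integral>x. ?f n x \<partial>lborel) = (P (e n) - I) / e n" for n
    using G_int[of n] G0_int by (simp add: has_bochner_integral_iff I_def P_def)
  have quot: "(\<lambda>n. (P (e n) - I) / e n) \<longlonglongrightarrow> (\<integral>x. ?g x \<partial>lborel)"
    using int_lim unfolding int_f .
  then have "(\<lambda>n. e n * ((P (e n) - I) / e n)) \<longlonglongrightarrow> 0 * (\<integral>x. ?g x \<partial>lborel)"
    by (intro tendsto_mult e_lim)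
  moreover have "e n * ((P (e n) - I) / e n) = P (e n) - I" for n
    using e(1)[of n] by simp
  ultimately have "(\<lambda>n. P (e n) - I) \<longlonglongrightarrow> 0" by simp
  moreover have Q_lim: "(\<lambda>n. Q (e n)) \<longlonglongrightarrow> Q 0"
    unfolding Q_def by (intro tendsto_intros e_lim)
  then have "(\<lambda>n. P (e n) - I) \<longlonglongrightarrow> intrinsic_volume 0 A + 0 * Q 0 - I"
    unfolding PQ by (intro tendsto_intros e_lim)
  ultimately have "I = intrinsic_volume 0 A"
    using LIMSEQ_unique by fastforce
  then have "(P (e n) - I) / e n = Q (e n)" for n
    using e(1)[of n] by (simp add: PQ)
  then have "(\<integral>x. ?g x \<partial>lborel) = Q 0"
    using quot Q_lim LIMSEQ_unique by simp
  also have "Q 0 = intrinsic_volume 1 A"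
  proof -
    \<comment> \<open>Only k = 0 survives because \<open>0 ^ 0 = 1\<close>, and this index occurs
      because the dimension is positive.\<close>
    have "Q 0 = (\<Sum>k<?d. if k = 0 then intrinsic_volume (Suc k) A else 0)"
      unfolding Q_def by (intro sum.cong) auto
    then show ?thesis by simp
  qed
  finally show ?thesis
    using g_int by (simp add: has_bochner_integral_iff G0_def)
qed

section \<open>Gaussian half moments\<close>

text \<open>With \<open>pi\<close> in the exponent this is a probability measure without a
  normalising constant; each coordinate is normal with variance 1 / (2 pi).\<close>

definition gauss_measure :: "'a::euclidean_space measure" where
  "gauss_measure = density lborel (\<lambda>x. ennreal (exp (- (pi * (norm x)\<^sup>2))))"

lemma normal_density_pi: "normal_density 0 (1 / sqrt (2 * pi)) x = exp (- (pi * x\<^sup>2))"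
  by (simp add: normal_density_def power_divide)

lemma exp_norm_square_prod:
  "ennreal (exp (- (pi * (norm (x::'a::euclidean_space))\<^sup>2))) =
     (\<Prod>b\<in>Basis. ennreal (normal_density 0 (1 / sqrt (2 * pi)) (x \<bullet> b)))"
proof -
  have "(norm x)\<^sup>2 = (\<Sum>b\<in>Basis. (x \<bullet> b)\<^sup>2)"
    unfolding power2_norm_eq_inner by (subst euclidean_inner) (simp add: power2_eq_square)
  then show ?thesis
    by (simp add: normal_density_pi prod_ennreal exp_sum[symmetric] sum_distrib_left sum_negf)
qed

lemma sets_gauss_measure [simp, measurable_cong]: "sets gauss_measure = sets borel"
  and space_gauss_measure [simp]: "space gauss_measure = UNIV"
  by (simp_all add: gauss_measure_def)

lemma emeasure_gauss_measure_coords: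
  assumes [measurable]: "\<And>b. b \<in> Basis \<Longrightarrow> A b \<in> sets borel"
  shows "emeasure gauss_measure {x::'a::euclidean_space. \<forall>b\<in>Basis. x \<bullet> b \<in> A b} =
    (\<Prod>b\<in>Basis. emeasure (density lborel (normal_density 0 (1 / sqrt (2 * pi)))) (A b))"
proof -
  let ?n = "normal_density 0 (1 / sqrt (2 * pi))"
  have "emeasure gauss_measure {x::'a. \<forall>b\<in>Basis. x \<bullet> b \<in> A b} =
      (\<integral>\<^sup>+x. (\<Prod>b\<in>Basis. ennreal (?n (x \<bullet> b)) * indicator (A b) (x \<bullet> b)) \<partial>(lborel :: 'a measure))"
    unfolding gauss_measure_def
    by (subst emeasure_density)
       (auto simp: exp_norm_square_prod prod.distrib intro!: nn_integral_cong split: split_indicator)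
  also have "\<dots> = (\<Prod>b\<in>Basis. (\<integral>\<^sup>+t. ennreal (?n t) * indicator (A b) t \<partial>lborel))"
    by (intro nn_integral_lborel_prod) auto
  also have "\<dots> = (\<Prod>b\<in>Basis. emeasure (density lborel ?n) (A b))"
    by (intro prod.cong refl) (simp add: emeasure_density)
  finally show ?thesis .
qed

lemma emeasure_normal_UNIV: "emeasure (density lborel (normal_density 0 (1 / sqrt (2 * pi)))) UNIV = 1"
proof -
  interpret prob_space "density lborel (normal_density 0 (1 / sqrt (2 * pi)))"
    by (rule prob_space_normal_density) simp
  show ?thesis using emeasure_space_1 by simp
qed

lemma prob_space_gauss_measure: "prob_space (gauss_measure :: 'a::euclidean_space measure)"
  using emeasure_gauss_measure_coords[of "\<lambda>_::'a. UNIV"]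
  by (intro prob_spaceI) (simp add: emeasure_normal_UNIV)

lemma emeasure_gauss_measure_coord:
  assumes c: "c \<in> (Basis :: 'a::euclidean_space set)" and A: "A \<in> sets borel"
  shows "emeasure gauss_measure {x::'a. x \<bullet> c \<in> A} =
    emeasure (density lborel (normal_density 0 (1 / sqrt (2 * pi)))) A"
proof -
  have "{x::'a. x \<bullet> c \<in> A} = {x. \<forall>b\<in>Basis. x \<bullet> b \<in> (if b = c then A else UNIV)}"
    using c by auto
  also have "emeasure gauss_measure \<dots> = (\<Prod>b\<in>(Basis::'a set).
      emeasure (density lborel (normal_density 0 (1 / sqrt (2 * pi)))) (if b = c then A else UNIV))"
    using A by (intro emeasure_gauss_measure_coords) auto
  also have "\<dots> = (\<Prod>b\<in>(Basis::'a set).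
      if b = c then emeasure (density lborel (normal_density 0 (1 / sqrt (2 * pi)))) A else 1)"
    by (intro prod.cong refl) (simp add: emeasure_normal_UNIV)
  finally show ?thesis using c by simp
qed

lemma distributed_gauss_measure_coord:
  assumes c: "c \<in> (Basis :: 'a::euclidean_space set)"
  shows "distributed gauss_measure lborel (\<lambda>x::'a. x \<bullet> c) (normal_density 0 (1 / sqrt (2 * pi)))"
  unfolding distributed_def
proof (intro conjI measure_eqI)
  fix A assume "A \<in> sets (distr gauss_measure lborel (\<lambda>x::'a. x \<bullet> c))"
  then have A: "A \<in> sets borel" by simp
  then have "emeasure (distr gauss_measure lborel (\<lambda>x::'a. x \<bullet> c)) A = emeasure gauss_measure {x::'a. x \<bullet> c \<in> A}"
    by (subst emeasure_distr) (auto simp: vimage_def)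
  also have "\<dots> = emeasure (density lborel (normal_density 0 (1 / sqrt (2 * pi)))) A"
    by (rule emeasure_gauss_measure_coord[OF c A])
  finally show "emeasure (distr gauss_measure lborel (\<lambda>x::'a. x \<bullet> c)) A
      = emeasure (density lborel (\<lambda>x. ennreal (normal_density 0 (1 / sqrt (2 * pi)) x))) A" .
qed auto

text \<open>The density is a product over the coordinates, so probabilities of coordinate boxes
  factor.\<close>

lemma indep_gauss_measure_coords:
  "prob_space.indep_vars gauss_measure (\<lambda>_. borel) (\<lambda>b x. x \<bullet> b) (Basis :: 'a::euclidean_space set)"
proof -
  interpret prob_space "gauss_measure :: 'a measure" by (rule prob_space_gauss_measure)
  show ?thesis
  proof (subst indep_vars_finite[where E = "\<lambda>_. sets borel"])
    show "sets (borel :: real measure) = sigma_sets (space borel) (sets borel)"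
      by (metis sets.sigma_sets_eq)
    show "\<forall>A\<in>(Basis :: 'a set) \<rightarrow> sets borel.
        prob (\<Inter>j\<in>Basis. (\<lambda>x. x \<bullet> j) -` A j \<inter> space gauss_measure) =
        (\<Prod>j\<in>Basis. prob ((\<lambda>x. x \<bullet> j) -` A j \<inter> space gauss_measure))"
    proof
      fix A :: "'a \<Rightarrow> real set" assume A: "A \<in> Basis \<rightarrow> sets borel"
      have "emeasure gauss_measure {x::'a. \<forall>b\<in>Basis. x \<bullet> b \<in> A b}
          = (\<Prod>b\<in>Basis. emeasure gauss_measure {x::'a. x \<bullet> b \<in> A b})"
        using A by (subst emeasure_gauss_measure_coords)
          (auto intro!: prod.cong simp: emeasure_gauss_measure_coord Pi_iff)
      then have "ennreal (prob {x::'a. \<forall>b\<in>Basis. x \<bullet> b \<in> A b})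
          = ennreal (\<Prod>b\<in>Basis. prob {x::'a. x \<bullet> b \<in> A b})"
        by (simp add: emeasure_eq_measure prod_ennreal)
      then have "prob {x::'a. \<forall>b\<in>Basis. x \<bullet> b \<in> A b} = (\<Prod>b\<in>Basis. prob {x::'a. x \<bullet> b \<in> A b})"
        by (simp add: prod_nonneg)
      moreover have "(\<Inter>j\<in>Basis. (\<lambda>x. x \<bullet> j) -` A j) = {x::'a. \<forall>b\<in>Basis. x \<bullet> b \<in> A b}"
        by auto
      ultimately show "prob (\<Inter>j\<in>Basis. (\<lambda>x. x \<bullet> j) -` A j \<inter> space gauss_measure) =
        (\<Prod>j\<in>Basis. prob ((\<lambda>x. x \<bullet> j) -` A j \<inter> space gauss_measure))"
        by (simp add: vimage_def)
    qed
  qed (auto simp: Int_stable_def)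
qed

lemma distributed_gauss_measure_inner:
  fixes v :: "'a::euclidean_space"
  assumes v: "v \<noteq> 0"
  shows "distributed gauss_measure lborel (\<lambda>x. x \<bullet> v) (normal_density 0 (norm v / sqrt (2 * pi)))"
proof -
  interpret prob_space "gauss_measure :: 'a measure" by (rule prob_space_gauss_measure)
  \<comment> \<open>Basis vectors with coefficient 0 are dropped because the summands in
    \<open>sum_indep_normal\<close> must have positive standard deviation.\<close>
  let ?B = "{b \<in> Basis. v \<bullet> b \<noteq> 0}"
  let ?s = "1 / sqrt (2 * pi)"
  have ne: "?B \<noteq> {}" using v euclidean_all_zero_iff[of v] by auto
  have "indep_vars (\<lambda>_. borel) (\<lambda>b x. (v \<bullet> b) * (x \<bullet> b)) (Basis :: 'a set)"
    by (rule indep_vars_compose2[OF indep_gauss_measure_coords]) auto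
  then have ind: "indep_vars (\<lambda>_. borel) (\<lambda>b x. (v \<bullet> b) * (x \<bullet> b)) ?B"
    by (rule indep_vars_subset) auto
  have dist: "distributed gauss_measure lborel (\<lambda>x. (v \<bullet> b) * (x \<bullet> b)) (normal_density 0 (\<bar>v \<bullet> b\<bar> * ?s))"
    if "b \<in> ?B" for b
    using normal_density_affine[OF distributed_gauss_measure_coord, of b "v \<bullet> b" 0] that by simp
  have "distributed gauss_measure lborel (\<lambda>x. \<Sum>b\<in>?B. (v \<bullet> b) * (x \<bullet> b))
      (normal_density (\<Sum>b\<in>?B. 0) (sqrt (\<Sum>b\<in>?B. (\<bar>v \<bullet> b\<bar> * ?s)\<^sup>2)))"
    using ne ind dist by (intro sum_indep_normal) auto
  moreover have "(\<Sum>b\<in>?B. (v \<bullet> b) * (x \<bullet> b)) = x \<bullet> v" for x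
  proof -
    have "x \<bullet> v = (\<Sum>b\<in>Basis. (v \<bullet> b) * (x \<bullet> b))"
      by (subst euclidean_inner) (simp add: mult.commute)
    also have "\<dots> = (\<Sum>b\<in>?B. (v \<bullet> b) * (x \<bullet> b))"
      by (intro sum.mono_neutral_right) auto
    finally show ?thesis by simp
  qed
  moreover have "sqrt (\<Sum>b\<in>?B. (\<bar>v \<bullet> b\<bar> * ?s)\<^sup>2) = norm v / sqrt (2 * pi)"
  proof -
    have "(\<Sum>b\<in>?B. (\<bar>v \<bullet> b\<bar> * ?s)\<^sup>2) = (\<Sum>b\<in>Basis. (\<bar>v \<bullet> b\<bar> * ?s)\<^sup>2)"
      by (intro sum.mono_neutral_left) auto
    also have "\<dots> = (v \<bullet> v) * ?s\<^sup>2"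
      by (subst euclidean_inner[of v v]) (simp add: sum_distrib_right sum_divide_distrib power2_eq_square power_mult_distrib mult_ac)
    finally show ?thesis by (simp add: real_sqrt_mult norm_eq_sqrt_inner real_sqrt_divide)
  qed
  ultimately show ?thesis by simp
qed

text \<open>The function \<open>- (\<sigma>\<^sup>2 * normal_density 0 \<sigma> x)\<close> is an
  antiderivative of \<open>x * normal_density 0 \<sigma> x\<close>.\<close>

lemma nn_integral_normal_pos_part:
  assumes s: "\<sigma> > 0"
  shows "(\<integral>\<^sup>+x. ennreal (normal_density 0 \<sigma> x) * ennreal (max 0 x) \<partial>lborel) = ennreal (\<sigma> / sqrt (2 * pi))"
proof -
  have "(\<integral>\<^sup>+x. ennreal (normal_density 0 \<sigma> x) * ennreal (max 0 x) \<partial>lborel)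
      = (\<integral>\<^sup>+x. ennreal (x * normal_density 0 \<sigma> x) * indicator {0..} x \<partial>lborel)"
    by (intro nn_integral_cong) (auto simp: ennreal_mult'[symmetric] ennreal_neg mult.commute split: split_indicator)
  also have "\<dots> = ennreal (0 - - (\<sigma>\<^sup>2 * normal_density 0 \<sigma> 0))"
  proof (rule nn_integral_FTC_atLeast[where F = "\<lambda>x. - (\<sigma>\<^sup>2 * normal_density 0 \<sigma> x)"])
    show "((\<lambda>x. - (\<sigma>\<^sup>2 * normal_density 0 \<sigma> x)) has_real_derivative x * normal_density 0 \<sigma> x) (at x)" for x
      unfolding normal_density_def using s
      by (auto intro!: derivative_eq_intros simp: field_simps)
    have "filterlim (\<lambda>x::real. 1 / (2 * \<sigma>\<^sup>2) * x\<^sup>2) at_top at_top"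
      using s by (intro filterlim_tendsto_pos_mult_at_top[OF tendsto_const] filterlim_pow_at_top filterlim_ident) auto
    then have "((\<lambda>x. exp (- (1 / (2 * \<sigma>\<^sup>2) * x\<^sup>2))) \<longlongrightarrow> 0) at_top"
      by (intro filterlim_compose[OF exp_at_bot] filterlim_compose[OF filterlim_uminus_at_bot_at_top])
    from tendsto_mult_right_zero[OF this, of "- (\<sigma>\<^sup>2 * (1 / sqrt (2 * pi * \<sigma>\<^sup>2)))"]
    show "((\<lambda>x. - (\<sigma>\<^sup>2 * normal_density 0 \<sigma> x)) \<longlongrightarrow> 0) at_top"
      unfolding normal_density_def by (simp add: mult.assoc)
  qed (use s in auto)
  also have "0 - - (\<sigma>\<^sup>2 * normal_density 0 \<sigma> 0) = \<sigma> / sqrt (2 * pi)"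
    using s by (simp add: normal_density_def real_sqrt_mult power2_eq_square field_simps)
  finally show ?thesis .
qed

text \<open>Under \<open>gauss_measure\<close> the variable \<open>x \<bullet> v\<close> is centred
  normal with deviation \<open>norm v / sqrt (2 * pi)\<close>, so its positive part has mean
  \<open>norm v / (2 * pi)\<close>. In geometric terms, this is the mean width formula for the
  segment from 0 to \<open>v\<close>.\<close>

lemma gaussian_half_moment:
  fixes v :: "'a::euclidean_space"
  shows "(\<integral>\<^sup>+x. ennreal (2 * pi * max 0 (x \<bullet> v) * exp (- (pi * (norm x)\<^sup>2))) \<partial>lborel) = ennreal (norm v)"
proof (cases "v = 0")
  case False
  let ?\<sigma> = "norm v / sqrt (2 * pi)"
  have s: "?\<sigma> > 0" using False by simp
  have "(\<integral>\<^sup>+x. ennreal (2 * pi * max 0 (x \<bullet> v) * exp (- (pi * (norm x)\<^sup>2))) \<partial>lborel)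
      = (\<integral>\<^sup>+x. ennreal (2 * pi) * (ennreal (exp (- (pi * (norm x)\<^sup>2))) * ennreal (max 0 (x \<bullet> v))) \<partial>lborel)"
  proof (intro nn_integral_cong)
    fix x
    show "ennreal (2 * pi * max 0 (x \<bullet> v) * exp (- (pi * (norm x)\<^sup>2)))
      = ennreal (2 * pi) * (ennreal (exp (- (pi * (norm x)\<^sup>2))) * ennreal (max 0 (x \<bullet> v)))"
      by (cases "x \<bullet> v \<ge> 0") (simp_all add: max_def ennreal_mult'[symmetric] ennreal_neg mult_ac)
  qed
  also have "\<dots> = ennreal (2 * pi) * (\<integral>\<^sup>+x. ennreal (max 0 (x \<bullet> v)) \<partial>gauss_measure)"
    by (simp add: gauss_measure_def nn_integral_cmult nn_integral_density)
  also have "(\<integral>\<^sup>+x. ennreal (max 0 (x \<bullet> v)) \<partial>gauss_measure) = (\<integral>\<^sup>+t. ennreal (normal_density 0 ?\<sigma> t) * ennreal (max 0 t) \<partial>lborel)"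
    using distributed_nn_integral[OF distributed_gauss_measure_inner[OF False], of "\<lambda>t. ennreal (max 0 t)"] by simp
  also have "\<dots> = ennreal (?\<sigma> / sqrt (2 * pi))"
    by (rule nn_integral_normal_pos_part[OF s])
  also have "ennreal (2 * pi) * \<dots> = ennreal (norm v)"
    by (simp add: ennreal_mult'[symmetric])
  finally show ?thesis .
qed simp

section \<open>Spitzer's identity\<close>

text \<open>The argument lists the steps, not the partial sums, so that permutations of the steps
  act on it. Time 0 takes part in the maximum.\<close>

fun walk_max :: "nat \<Rightarrow> (nat \<Rightarrow> real) \<Rightarrow> real" where
  "walk_max 0 x = 0"
| "walk_max (Suc n) x = max (walk_max n x) (\<Sum>i<Suc n. x i)"

lemma walk_max_le_iff: "walk_max n x \<le> c \<longleftrightarrow> (\<forall>k\<le>n. (\<Sum>i<k. x i) \<le> c)"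
  by (induction n) (auto simp: le_Suc_eq)

lemma sum_le_walk_max: "k \<le> n \<Longrightarrow> (\<Sum>i<k. x i) \<le> walk_max n x"
  using walk_max_le_iff[of n x "walk_max n x"] by auto

lemma walk_max_nonneg: "walk_max n x \<ge> 0"
  using sum_le_walk_max[of 0 n x] by simp

lemma walk_max_cong: "(\<And>i. i < n \<Longrightarrow> x i = y i) \<Longrightarrow> walk_max n x = walk_max n y"
  by (induction n) (auto intro!: arg_cong2[of _ _ _ _ max] sum.cong)

lemma walk_max_le_sum_abs: "walk_max n x \<le> (\<Sum>i<n. \<bar>x i\<bar>)"
  unfolding walk_max_le_iff
proof (intro allI impI)
  fix k assume "k \<le> n"
  have "(\<Sum>i<k. x i) \<le> (\<Sum>i<k. \<bar>x i\<bar>)" by (intro sum_mono) auto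
  also have "\<dots> \<le> (\<Sum>i<n. \<bar>x i\<bar>)" using \<open>k \<le> n\<close> by (intro sum_mono2) auto
  finally show "(\<Sum>i<k. x i) \<le> (\<Sum>i<n. \<bar>x i\<bar>)" .
qed

text \<open>Either the maximum is attained at time 0, or it is the first step plus the maximum of
  the walk restarted after it.\<close>

lemma walk_max_shift: "walk_max (Suc n) x = max 0 (x 0 + walk_max n (\<lambda>i. x (Suc i)))"
proof (induction n)
  case (Suc n)
  have "walk_max (Suc (Suc n)) x = max (walk_max (Suc n) x) (\<Sum>i<Suc (Suc n). x i)"
    by (rule walk_max.simps)
  also have "(\<Sum>i<Suc (Suc n). x i) = x 0 + (\<Sum>i<Suc n. x (Suc i))"
    by (rule sum.lessThan_Suc_shift)
  also have "max (walk_max (Suc n) x) \<dots> = max 0 (x 0 + walk_max (Suc n) (\<lambda>i. x (Suc i)))"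
    unfolding Suc.IH by (simp add: max_def)
  finally show ?case .
qed simp

text \<open>If \<open>S\<^bsub>n+1\<^esub> > 0\<close>, the maximum is attained after the first step; otherwise the last step is irrelevant.\<close>

lemma walk_max_split:
  "walk_max (Suc n) x = (if (\<Sum>i<Suc n. x i) > 0 then x 0 + walk_max n (\<lambda>i. x (Suc i)) else walk_max n x)"
proof (cases "(\<Sum>i<Suc n. x i) > 0")
  case True
  have "(\<Sum>i<n. x (Suc i)) \<le> walk_max n (\<lambda>i. x (Suc i))" by (rule sum_le_walk_max) simp
  moreover have "(\<Sum>i<Suc n. x i) = x 0 + (\<Sum>i<n. x (Suc i))" by (rule sum.lessThan_Suc_shift)
  ultimately show ?thesis using True by (simp only: walk_max_shift) (simp add: max_def)
next
  case False
  then show ?thesis using walk_max_nonneg[of n x] by (simp add: max_def)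
qed

lemma measurable_walk_max [measurable (raw)]:
  assumes [measurable]: "\<And>i. (\<lambda>\<omega>. X i \<omega>) \<in> borel_measurable M"
  shows "(\<lambda>\<omega>. walk_max n (\<lambda>i. X i \<omega>)) \<in> borel_measurable M"
  by (induction n) auto

text \<open>Independence and equal laws make the joint law a power of \<open>\<mu>\<close>, and a
  product of identical factors is invariant under permuting coordinates.\<close>

lemma (in prob_space) iid_exchangeable:
  fixes X :: "'i \<Rightarrow> 'a \<Rightarrow> real" and F :: "('i \<Rightarrow> real) \<Rightarrow> real"
  assumes I: "finite I" and ind: "indep_vars (\<lambda>_. borel) X I"
    and id: "\<And>i. i \<in> I \<Longrightarrow> distr M borel (X i) = \<mu>"
    and t: "bij_betw t I I"
    and F: "F \<in> borel_measurable (PiM I (\<lambda>_. borel))"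
  shows "(\<integral>\<omega>. F (\<lambda>i\<in>I. X (t i) \<omega>) \<partial>M) = (\<integral>\<omega>. F (\<lambda>i\<in>I. X i \<omega>) \<partial>M)"
proof (cases "I = {}")
  case False
  then obtain i0 where i0: "i0 \<in> I" by auto
  have X: "X i \<in> borel_measurable M" if "i \<in> I" for i
    using ind that by (simp add: indep_vars_def)
  let ?P = "PiM I (\<lambda>_. \<mu>)" and ?B = "PiM I (\<lambda>_. borel :: real measure)"
  let ?V = "\<lambda>\<omega>. \<lambda>i\<in>I. X i \<omega>" and ?t = "\<lambda>x. \<lambda>i\<in>I. x (t i)"
  have mu: "prob_space \<mu>" "sets \<mu> = sets borel"
    using prob_space_distr[OF X[OF i0]] id[OF i0] by auto
  have V: "?V \<in> M \<rightarrow>\<^sub>M ?B" using X by (intro measurable_restrict)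
  have tI: "t i \<in> I" if "i \<in> I" for i using t that by (auto simp: bij_betw_def)
  have tm: "?t \<in> ?B \<rightarrow>\<^sub>M ?B"
    using tI by (intro measurable_restrict measurable_component_singleton)
  have sets: "sets ?P = sets ?B" using mu by (intro sets_PiM_cong) auto
  have VP: "distr M ?B ?V = ?P"
  proof -
    have "distr M ?B ?V = PiM I (\<lambda>i. distr M borel (X i))"
      using False X ind by (subst (asm) indep_vars_iff_distr_eq_PiM') auto
    also have "\<dots> = ?P" by (intro PiM_cong) (auto simp: id)
    finally show ?thesis .
  qed
  have tP: "distr ?P ?P ?t = ?P"
    using mu(1) t by (intro distr_PiM_reindex) (auto simp: bij_betw_def)
  have "(\<integral>\<omega>. F (\<lambda>i\<in>I. X (t i) \<omega>) \<partial>M) = (\<integral>\<omega>. F (?t (?V \<omega>)) \<partial>M)"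
    using tI by (intro Bochner_Integration.integral_cong refl arg_cong[of _ _ F]) (auto simp: restrict_def)
  also have "\<dots> = (\<integral>x. F (?t x) \<partial>?P)"
    unfolding VP[symmetric] using V measurable_compose[OF tm F] by (subst integral_distr) auto
  also have "\<dots> = (\<integral>x. F x \<partial>(distr ?P ?P ?t))"
    using tm F sets by (subst integral_distr) (auto simp: measurable_cong_sets[OF sets sets] cong: measurable_cong_sets)
  also have "\<dots> = (\<integral>x. F x \<partial>?P)"
    by (simp only: tP)
  also have "\<dots> = (\<integral>\<omega>. F (?V \<omega>) \<partial>M)"
    unfolding VP[symmetric] by (rule integral_distr[OF V F])
  finally show ?thesis .
qed (simp add: restrict_def)

text \<open>Induction through \<open>walk_max_split\<close>. On the event that the full sum is
  positive, a cyclic shift of the steps replaces the restarted maximum by the original one, so the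
  expected maximum grows by the mean of the first step on that event. By exchangeability this is the
  mean positive part of the sum divided by the number of steps.\<close>

lemma (in prob_space) expectation_walk_max:
  fixes X :: "nat \<Rightarrow> 'a \<Rightarrow> real"
  assumes ind: "indep_vars (\<lambda>_. borel) X {..<N}"
    and id: "\<And>i. i < N \<Longrightarrow> distr M borel (X i) = \<mu>"
    and int: "\<And>i. i < N \<Longrightarrow> integrable M (X i)"
  shows "n \<le> N \<Longrightarrow> (\<integral>\<omega>. walk_max n (\<lambda>i. X i \<omega>) \<partial>M) =
     (\<Sum>k=1..n. (\<integral>\<omega>. max 0 (\<Sum>i<k. X i \<omega>) \<partial>M) / real k)"
proof (induction n)
  case (Suc n)
  let ?I = "{..<Suc n}"
  let ?S = "\<lambda>\<omega>. \<Sum>i<Suc n. X i \<omega>"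
  let ?pos = "\<lambda>x::nat \<Rightarrow> real. if (\<Sum>i<Suc n. x i) > 0 then (1::real) else 0"
  have I: "?I \<subseteq> {..<N}" using Suc.prems by auto
  have ind': "indep_vars (\<lambda>_. borel) X ?I" by (rule indep_vars_subset[OF ind I])
  have id': "distr M borel (X i) = \<mu>" if "i \<in> ?I" for i using id I that by auto
  have [measurable]: "X i \<in> borel_measurable M" if "i < Suc n" for i
    using int[of i] that I by (auto simp: borel_measurable_integrable)
  have intX: "integrable M (X i)" if "i < Suc n" for i using int that I by auto
  have Sm: "?S \<in> borel_measurable M" by (intro borel_measurable_sum) auto
  \<comment> \<open>Padding with 0 makes every coordinate measurable, as
    \<open>measurable_walk_max\<close> requires; for \<open>X\<close> this is known only below
    \<open>Suc n\<close>.\<close>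
  define Y where "Y i \<omega> = (if i < Suc n then X i \<omega> else 0)" for i \<omega>
  have [measurable]: "Y i \<in> borel_measurable M" for i unfolding Y_def by (cases "i < Suc n") auto
  have wm: "walk_max n (\<lambda>i. X i \<omega>) = walk_max n (\<lambda>i. Y i \<omega>)"
    "walk_max n (\<lambda>i. X (Suc i) \<omega>) = walk_max n (\<lambda>i. Y (Suc i) \<omega>)" for \<omega>
    by (auto intro!: walk_max_cong simp: Y_def)
  have wm_meas: "(\<lambda>\<omega>. walk_max n (\<lambda>i. X i \<omega>)) \<in> borel_measurable M"
    "(\<lambda>\<omega>. walk_max n (\<lambda>i. X (Suc i) \<omega>)) \<in> borel_measurable M"
    unfolding wm by measurable
  have pos_meas: "(\<lambda>\<omega>. ?pos (\<lambda>i. X i \<omega>)) \<in> borel_measurable M"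
    using Sm by measurable
  have bound: "integrable M (\<lambda>\<omega>. \<Sum>i<Suc n. \<bar>X i \<omega>\<bar>)" using intX by (intro Bochner_Integration.integrable_sum integrable_abs) auto
  have le1: "walk_max n (\<lambda>i. X i \<omega>) \<le> (\<Sum>i<Suc n. \<bar>X i \<omega>\<bar>)" for \<omega>
    using walk_max_le_sum_abs[of n "\<lambda>i. X i \<omega>"] by (simp add: add_increasing2)
  have le2: "walk_max n (\<lambda>i. X (Suc i) \<omega>) \<le> (\<Sum>i<Suc n. \<bar>X i \<omega>\<bar>)" for \<omega>
    unfolding sum.lessThan_Suc_shift using walk_max_le_sum_abs[of n "\<lambda>i. X (Suc i) \<omega>"]
    by (simp add: add_increasing)
  have int1: "integrable M (\<lambda>\<omega>. walk_max n (\<lambda>i. X i \<omega>))"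
    by (rule Bochner_Integration.integrable_bound[OF bound wm_meas(1)])
       (use le1 walk_max_nonneg in \<open>auto simp: abs_of_nonneg sum_nonneg intro!: AE_I2\<close>)
  have int2: "integrable M (\<lambda>\<omega>. ?pos (\<lambda>i. X i \<omega>) * walk_max n (\<lambda>i. X i \<omega>))"
    by (rule Bochner_Integration.integrable_bound[OF int1])
       (use pos_meas wm_meas in \<open>auto intro!: AE_I2\<close>)
  have int3: "integrable M (\<lambda>\<omega>. ?pos (\<lambda>i. X i \<omega>) * walk_max n (\<lambda>i. X (Suc i) \<omega>))"
    by (rule Bochner_Integration.integrable_bound[OF bound])
       (use pos_meas wm_meas le2 walk_max_nonneg in \<open>auto simp: abs_of_nonneg sum_nonneg intro!: AE_I2 borel_measurable_times\<close>)
  have int4: "integrable M (\<lambda>\<omega>. ?pos (\<lambda>i. X i \<omega>) * X i \<omega>)" if "i < Suc n" for i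
    by (rule Bochner_Integration.integrable_bound[OF intX[OF that]])
       (use pos_meas that in \<open>auto intro!: AE_I2 borel_measurable_times\<close>)
  have comp: "(\<lambda>x. x i) \<in> borel_measurable (PiM ?I (\<lambda>_. borel :: real measure))" if "i < Suc n" for i
    using that by (intro measurable_component_singleton) auto
  have pos_P: "?pos \<in> borel_measurable (PiM ?I (\<lambda>_. borel))"
  proof -
    have "(\<lambda>x. \<Sum>i<Suc n. x i) \<in> borel_measurable (PiM ?I (\<lambda>_. borel :: real measure))"
      using comp by (intro borel_measurable_sum) auto
    then show ?thesis by measurable
  qed
  have ex1: "(\<integral>\<omega>. ?pos (\<lambda>i. X i \<omega>) * walk_max n (\<lambda>i. X (Suc i) \<omega>) \<partial>M) = (\<integral>\<omega>. ?pos (\<lambda>i. X i \<omega>) * walk_max n (\<lambda>i. X i \<omega>) \<partial>M)"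
  proof -
    \<comment> \<open>The cyclic shift: it preserves the total sum and turns the first
      \<open>n\<close> steps into steps 1 to \<open>n\<close>.\<close>
    define t where "t i = (if i < n then Suc i else if i = n then 0 else i)" for i
    have t: "bij_betw t ?I ?I"
      by (rule bij_betwI[where g = "\<lambda>i. if i = 0 then n else i - 1"]) (auto simp: t_def)
    let ?F = "\<lambda>x. ?pos x * walk_max n x"
    have "(\<lambda>x. walk_max n x) \<in> borel_measurable (PiM ?I (\<lambda>_. borel))"
    proof -
      have "(\<lambda>x. walk_max n (\<lambda>i. if i < Suc n then x i else 0)) \<in> borel_measurable (PiM ?I (\<lambda>_. borel))"
      proof (intro measurable_walk_max)
        fix i
        show "(\<lambda>x. if i < Suc n then x i else 0) \<in> borel_measurable (PiM ?I (\<lambda>_. borel))"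
          using comp[of i] by (cases "i < Suc n") auto
      qed
      moreover have "walk_max n (\<lambda>i. if i < Suc n then x i else 0) = walk_max n x" for x
        by (intro walk_max_cong) auto
      ultimately show ?thesis by simp
    qed
    then have F: "?F \<in> borel_measurable (PiM ?I (\<lambda>_. borel))"
      using pos_P by (intro borel_measurable_times)
    have eqA: "?F (\<lambda>i\<in>?I. X (t i) \<omega>) = ?pos (\<lambda>i. X i \<omega>) * walk_max n (\<lambda>i. X (Suc i) \<omega>)" for \<omega>
    proof -
      have "(\<Sum>i<Suc n. (\<lambda>i\<in>?I. X (t i) \<omega>) i) = (\<Sum>i<Suc n. X (t i) \<omega>)"
        by (intro sum.cong) auto
      also have "\<dots> = (\<Sum>i<Suc n. X i \<omega>)"
        by (rule sum.reindex_bij_betw[OF t])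
      finally have "(\<Sum>i<Suc n. (\<lambda>i\<in>?I. X (t i) \<omega>) i) = (\<Sum>i<Suc n. X i \<omega>)" .
      moreover have "walk_max n (\<lambda>i\<in>?I. X (t i) \<omega>) = walk_max n (\<lambda>i. X (Suc i) \<omega>)"
        by (intro walk_max_cong) (auto simp: t_def)
      ultimately show ?thesis by simp
    qed
    have eqB: "?F (\<lambda>i\<in>?I. X i \<omega>) = ?pos (\<lambda>i. X i \<omega>) * walk_max n (\<lambda>i. X i \<omega>)" for \<omega>
    proof -
      have "(\<Sum>i<Suc n. (\<lambda>i\<in>?I. X i \<omega>) i) = (\<Sum>i<Suc n. X i \<omega>)"
        by (intro sum.cong) auto
      moreover have "walk_max n (\<lambda>i\<in>?I. X i \<omega>) = walk_max n (\<lambda>i. X i \<omega>)"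
        by (intro walk_max_cong) auto
      ultimately show ?thesis by simp
    qed
    show ?thesis
      using iid_exchangeable[OF finite_lessThan ind' id' t F] unfolding eqA eqB .
  qed
  have ex2: "(\<integral>\<omega>. ?pos (\<lambda>i. X i \<omega>) * X j \<omega> \<partial>M) = (\<integral>\<omega>. ?pos (\<lambda>i. X i \<omega>) * X 0 \<omega> \<partial>M)" if j: "j < Suc n" for j
  proof -
    \<comment> \<open>Swapping steps 0 and \<open>j\<close> preserves the sum, so all steps
      contribute equally on the event that it is positive.\<close>
    let ?t = "Transposition.transpose 0 j"
    have "?t permutes ?I" using j by (intro permutes_swap_id) auto
    then have t: "bij_betw ?t ?I ?I" by (rule permutes_imp_bij)
    let ?F = "\<lambda>x. ?pos x * x 0"
    have F: "?F \<in> borel_measurable (PiM ?I (\<lambda>_. borel))"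
      using pos_P comp[of 0] by (intro borel_measurable_times) auto
    have eqA: "?F (\<lambda>i\<in>?I. X (?t i) \<omega>) = ?pos (\<lambda>i. X i \<omega>) * X j \<omega>" for \<omega>
    proof -
      have "(\<Sum>i<Suc n. (\<lambda>i\<in>?I. X (?t i) \<omega>) i) = (\<Sum>i<Suc n. X (?t i) \<omega>)"
        by (intro sum.cong) auto
      also have "\<dots> = (\<Sum>i<Suc n. X i \<omega>)"
        by (rule sum.reindex_bij_betw[OF t])
      finally show ?thesis by simp
    qed
    have eqB: "?F (\<lambda>i\<in>?I. X i \<omega>) = ?pos (\<lambda>i. X i \<omega>) * X 0 \<omega>" for \<omega>
    proof -
      have "(\<Sum>i<Suc n. (\<lambda>i\<in>?I. X i \<omega>) i) = (\<Sum>i<Suc n. X i \<omega>)"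
        by (intro sum.cong) auto
      then show ?thesis by simp
    qed
    show ?thesis
      using iid_exchangeable[OF finite_lessThan ind' id' t F] unfolding eqA eqB .
  qed
  have "(\<integral>\<omega>. max 0 (?S \<omega>) \<partial>M) = (\<integral>\<omega>. (\<Sum>j<Suc n. ?pos (\<lambda>i. X i \<omega>) * X j \<omega>) \<partial>M)"
    by (intro Bochner_Integration.integral_cong refl) (auto simp: max_def sum_distrib_left[symmetric])
  also have "\<dots> = (\<Sum>j<Suc n. \<integral>\<omega>. ?pos (\<lambda>i. X i \<omega>) * X j \<omega> \<partial>M)"
    using int4 by (intro Bochner_Integration.integral_sum) auto
  also have "\<dots> = (\<Sum>j<Suc n. \<integral>\<omega>. ?pos (\<lambda>i. X i \<omega>) * X 0 \<omega> \<partial>M)"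
    by (intro sum.cong refl ex2) auto
  also have "\<dots> = real (Suc n) * (\<integral>\<omega>. ?pos (\<lambda>i. X i \<omega>) * X 0 \<omega> \<partial>M)"
    by simp
  finally have S: "(\<integral>\<omega>. ?pos (\<lambda>i. X i \<omega>) * X 0 \<omega> \<partial>M) = (\<integral>\<omega>. max 0 (?S \<omega>) \<partial>M) / real (Suc n)"
    by (simp del: of_nat_Suc)
  \<comment> \<open>\<open>walk_max_split\<close> without case distinction; by \<open>ex1\<close>
    the second and the last summand cancel in expectation.\<close>
  have "(\<integral>\<omega>. walk_max (Suc n) (\<lambda>i. X i \<omega>) \<partial>M) = (\<integral>\<omega>. ?pos (\<lambda>i. X i \<omega>) * X 0 \<omega>
      + ?pos (\<lambda>i. X i \<omega>) * walk_max n (\<lambda>i. X (Suc i) \<omega>)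
      + (walk_max n (\<lambda>i. X i \<omega>) - ?pos (\<lambda>i. X i \<omega>) * walk_max n (\<lambda>i. X i \<omega>)) \<partial>M)"
    by (intro Bochner_Integration.integral_cong refl) (simp only: walk_max_split, auto)
  also have "\<dots> = (\<integral>\<omega>. ?pos (\<lambda>i. X i \<omega>) * X 0 \<omega> \<partial>M)
      + (\<integral>\<omega>. ?pos (\<lambda>i. X i \<omega>) * walk_max n (\<lambda>i. X (Suc i) \<omega>) \<partial>M)
      + ((\<integral>\<omega>. walk_max n (\<lambda>i. X i \<omega>) \<partial>M) - (\<integral>\<omega>. ?pos (\<lambda>i. X i \<omega>) * walk_max n (\<lambda>i. X i \<omega>) \<partial>M))"
    using int1 int2 int3 int4[of 0]
    by (simp only: Bochner_Integration.integral_add Bochner_Integration.integral_diff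
        Bochner_Integration.integrable_add Bochner_Integration.integrable_diff zero_less_Suc)
  also have "\<dots> = (\<integral>\<omega>. max 0 (?S \<omega>) \<partial>M) / real (Suc n) + (\<integral>\<omega>. walk_max n (\<lambda>i. X i \<omega>) \<partial>M)"
    unfolding ex1 S by simp
  finally show ?case
    using Suc by simp
qed simp

text \<open>One-sided limits bound the path on a punctured neighbourhood of each time, and finitely
  many neighbourhoods cover the compact interval.\<close>

lemma cadlag_bounded:
  fixes x :: "real \<Rightarrow> 'a::real_normed_vector"
  assumes "cadlag x"
  shows "bounded (x ` {0..b})"
proof -
  have bounded_near: "\<exists>e>0. bounded (x ` ({t<..<t + e}))" if "t \<ge> 0" for t
  proof -
    have "(x \<longlongrightarrow> x t) (at_right t)" using assms that by (auto simp: cadlag_def)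
    then have "eventually (\<lambda>s. dist (x s) (x t) < 1) (at_right t)" by (rule tendstoD) simp
    then obtain c where c: "c > t" "\<forall>s>t. s < c \<longrightarrow> dist (x s) (x t) < 1"
      unfolding eventually_at_right_field by blast
    then have "x ` {t<..<t + (c - t)} \<subseteq> ball (x t) 1" by (auto simp: dist_commute)
    then have "bounded (x ` {t<..<t + (c - t)})" by (rule bounded_subset[OF bounded_ball])
    then show ?thesis using c(1) by (intro exI[of _ "c - t"]) auto
  qed
  have bounded_left: "\<exists>e>0. bounded (x ` ({t - e<..<t}))" if "t > 0" for t
  proof -
    have "\<exists>y. (x \<longlongrightarrow> y) (at_left t)" using assms that by (simp add: cadlag_def)
    then obtain y where "(x \<longlongrightarrow> y) (at_left t)" ..
    then have "eventually (\<lambda>s. dist (x s) y < 1) (at_left t)" by (rule tendstoD) simp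
    then obtain c where c: "c < t" "\<forall>s>c. s < t \<longrightarrow> dist (x s) y < 1"
      unfolding eventually_at_left_field by blast
    then have "x ` {t - (t - c)<..<t} \<subseteq> ball y 1" by (auto simp: dist_commute)
    then have "bounded (x ` {t - (t - c)<..<t})" by (rule bounded_subset[OF bounded_ball])
    then show ?thesis using c(1) by (intro exI[of _ "t - c"]) auto
  qed
  have "\<exists>e>0. bounded (x ` ({0..b} \<inter> ball t e))" if t: "t \<in> {0..b}" for t
  proof -
    obtain e1 where e1: "e1 > 0" "bounded (x ` {t<..<t + e1})" using bounded_near t by auto
    obtain e2 where e2: "e2 > 0" "bounded (x ` ({t - e2<..<t} \<inter> {0..}))"
    \<comment> \<open>At time 0 no left limit is available, but there is also nothing of the
      interval to the left.\<close>
    proof (cases "t > 0")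
      case True
      then obtain e2 where "e2 > 0" "bounded (x ` {t - e2<..<t})" using bounded_left by blast
      then show ?thesis using that by (meson bounded_subset image_mono inf_le1)
    next
      case False
      then have "{t - 1<..<t} \<inter> {0..} = {}" using t by auto
      then show ?thesis using that[of 1] by simp
    qed
    have "{0..b} \<inter> ball t (min e1 e2) \<subseteq> {t<..<t + e1} \<union> ({t - e2<..<t} \<inter> {0..}) \<union> {t}"
      by (auto simp: dist_real_def)
    then have "x ` ({0..b} \<inter> ball t (min e1 e2)) \<subseteq> x ` {t<..<t + e1} \<union> x ` ({t - e2<..<t} \<inter> {0..}) \<union> {x t}"
      by blast
    moreover have "bounded (x ` {t<..<t + e1} \<union> x ` ({t - e2<..<t} \<inter> {0..}) \<union> {x t})"
      using e1 e2 by simp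
    ultimately have "bounded (x ` ({0..b} \<inter> ball t (min e1 e2)))" by (rule bounded_subset[rotated])
    then show ?thesis using e1 e2 by (intro exI[of _ "min e1 e2"]) auto
  qed
  then obtain e where e: "\<And>t. t \<in> {0..b} \<Longrightarrow> e t > 0" "\<And>t. t \<in> {0..b} \<Longrightarrow> bounded (x ` ({0..b} \<inter> ball t (e t)))"
    by metis
  have "{0..b} \<subseteq> (\<Union>t\<in>{0..b}. ball t (e t))" using e(1) by fastforce
  then obtain T where T: "T \<subseteq> {0..b}" "finite T" "{0..b} \<subseteq> (\<Union>t\<in>T. ball t (e t))"
    using compactE_image[of "{0..b}" "{0..b}" "\<lambda>t. ball t (e t)"] by auto
  have "x ` {0..b} \<subseteq> (\<Union>t\<in>T. x ` ({0..b} \<inter> ball t (e t)))" using T(3) by blast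
  moreover have "bounded (\<Union>t\<in>T. x ` ({0..b} \<inter> ball t (e t)))"
    using T e(2) by (intro bounded_UN) auto
  ultimately show ?thesis by (rule bounded_subset[rotated])
qed

section \<open>Strictly stable laws\<close>

lemma char_distr_scale:
  assumes "f \<in> borel_measurable M"
  shows "char (distr M borel (\<lambda>\<omega>. c * f \<omega>)) t = char (distr M borel f) (c * t)"
  using assms by (simp add: char_def integral_distr mult_ac)

text \<open>Pointwise convergence does not directly allow the argument to move with n. A Skorohod
  coupling makes the variables converge pointwise, after which dominated convergence applies to
  \<open>a n * t * W n x\<close>.\<close>

lemma char_tendsto_rescaled:
  fixes \<mu> :: "nat \<Rightarrow> real measure"
  assumes \<mu>: "\<And>n. real_distribution (\<mu> n)" and \<nu>: "real_distribution \<nu>"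
    and conv: "\<And>t. (\<lambda>n. char (\<mu> n) t) \<longlonglongrightarrow> char \<nu> t"
    and a: "a \<longlonglongrightarrow> a0"
  shows "(\<lambda>n. char (\<mu> n) (a n * t)) \<longlonglongrightarrow> char \<nu> (a0 * t)"
proof -
  have "weak_conv_m \<mu> \<nu>" by (rule levy_continuity[OF \<mu> \<nu> conv])
  from Skorohod[OF \<mu> \<nu> this] obtain \<Omega> :: "real measure" and W V where sk:
    "prob_space \<Omega>" "\<forall>n. W n \<in> borel_measurable \<Omega>" "\<forall>n. distr \<Omega> borel (W n) = \<mu> n"
    "V \<in> measurable \<Omega> lborel" "distr \<Omega> borel V = \<nu>"
    "\<forall>x\<in>space \<Omega>. (\<lambda>n. W n x) \<longlonglongrightarrow> V x"
    by metis
  then have W: "\<And>n. W n \<in> borel_measurable \<Omega>" "\<And>n. distr \<Omega> borel (W n) = \<mu> n"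
    and V: "V \<in> borel_measurable \<Omega>" "distr \<Omega> borel V = \<nu>"
    and lim: "\<And>x. x \<in> space \<Omega> \<Longrightarrow> (\<lambda>n. W n x) \<longlonglongrightarrow> V x"
    by simp_all
  interpret prob_space \<Omega> by (rule sk(1))
  have "(\<lambda>n. CLINT x|\<Omega>. iexp (a n * t * W n x)) \<longlonglongrightarrow> (CLINT x|\<Omega>. iexp (a0 * t * V x))"
    by (rule integral_dominated_convergence[where w = "\<lambda>_. 1"])
       (use W V in \<open>auto intro!: AE_I2 tendsto_intros lim a\<close>)
  moreover have "char (\<mu> n) s = (CLINT x|\<Omega>. iexp (s * W n x))" for n s
    using W by (simp add: W(2)[symmetric] char_def integral_distr)
  moreover have "char \<nu> s = (CLINT x|\<Omega>. iexp (s * V x))" for s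
    using V by (simp add: V(2)[symmetric] char_def integral_distr)
  ultimately show ?thesis by simp
qed

text \<open>\<open>weakly_converges\<close> tests real-valued functions only, hence the detour
  through cosine and sine.\<close>

lemma char_inner_tendsto:
  fixes \<mu> :: "nat \<Rightarrow> 'a::euclidean_space measure"
  assumes conv: "weakly_converges \<mu> \<nu>"
    and \<mu>: "\<And>n. prob_space (\<mu> n)" "\<And>n. sets (\<mu> n) = sets borel"
    and \<nu>: "prob_space \<nu>" "sets \<nu> = sets borel"
  shows "(\<lambda>n. char (distr (\<mu> n) borel (\<lambda>x. x \<bullet> u)) t) \<longlonglongrightarrow> char (distr \<nu> borel (\<lambda>x. x \<bullet> u)) t"
proof -
  have eq: "char (distr \<kappa> borel (\<lambda>x. x \<bullet> u)) t =
      complex_of_real (\<integral>x. cos (t * (x \<bullet> u)) \<partial>\<kappa>) + \<i> * complex_of_real (\<integral>x. sin (t * (x \<bullet> u)) \<partial>\<kappa>)"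
    if "prob_space \<kappa>" "sets \<kappa> = sets borel" for \<kappa> :: "'a measure"
  proof -
    interpret prob_space \<kappa> by fact
    have m: "(\<lambda>x. x \<bullet> u) \<in> borel_measurable \<kappa>"
      using that(2) by (simp cong: measurable_cong_sets)
    have i: "integrable \<kappa> (\<lambda>x. cos (t * (x \<bullet> u)))" "integrable \<kappa> (\<lambda>x. sin (t * (x \<bullet> u)))"
      using m by (auto intro!: integrable_const_bound[of _ 1])
    have "char (distr \<kappa> borel (\<lambda>x. x \<bullet> u)) t = (CLINT x|\<kappa>. iexp (t * (x \<bullet> u)))"
      using m by (simp add: char_def integral_distr)
    also have "\<dots> = (CLINT x|\<kappa>. complex_of_real (cos (t * (x \<bullet> u))) + \<i> * complex_of_real (sin (t * (x \<bullet> u))))"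
      by (intro Bochner_Integration.integral_cong refl) (simp only: exp_Euler cos_of_real sin_of_real)
    also have "\<dots> = complex_of_real (\<integral>x. cos (t * (x \<bullet> u)) \<partial>\<kappa>) + \<i> * complex_of_real (\<integral>x. sin (t * (x \<bullet> u)) \<partial>\<kappa>)"
      using i by (subst Bochner_Integration.integral_add) auto
    finally show ?thesis .
  qed
  have "(\<lambda>n. \<integral>x. cos (t * (x \<bullet> u)) \<partial>\<mu> n) \<longlonglongrightarrow> (\<integral>x. cos (t * (x \<bullet> u)) \<partial>\<nu>)"
    by (rule conv[unfolded weakly_converges_def, rule_format]) (auto intro!: continuous_intros boundedI[of _ 1])
  moreover have "(\<lambda>n. \<integral>x. sin (t * (x \<bullet> u)) \<partial>\<mu> n) \<longlonglongrightarrow> (\<integral>x. sin (t * (x \<bullet> u)) \<partial>\<nu>)"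
    by (rule conv[unfolded weakly_converges_def, rule_format]) (auto intro!: continuous_intros boundedI[of _ 1])
  ultimately show ?thesis
    unfolding eq[OF \<mu>] eq[OF \<nu>] by (intro tendsto_intros)
qed

text \<open>Splitting \<open>S(m n)\<close> into \<open>m\<close> independent copies of \<open>S(n)\<close> and using \<open>b(m n) / b(n) \<longlonglongrightarrow> m powr (1 / \<alpha>)\<close>
  shows that the limit law is strictly stable.\<close>

lemma strictly_stable_of_weak_limit:
  fixes Y :: "nat \<Rightarrow> 'm \<Rightarrow> 'a::euclidean_space"
  assumes prob: "prob_space M"
    and indep: "prob_space.indep_vars M (\<lambda>_. borel) Y {1..}"
    and ident: "\<And>i. i \<ge> 1 \<Longrightarrow> distr M borel (Y i) = distr M borel (Y 1)"
    and b_pos: "\<And>n. n \<ge> 1 \<Longrightarrow> b n > 0"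
    and l_slow: "slowly_varying l"
    and b_eq: "\<And>n. n \<ge> 1 \<Longrightarrow> b n = real n powr (1 / \<alpha>) * l (real n)"
    and conv: "weakly_converges (\<lambda>n. distr M borel (\<lambda>\<omega>. (\<Sum>i=1..n. Y i \<omega>) /\<^sub>R b n)) \<nu>"
    and \<nu>: "prob_space \<nu>" "sets \<nu> = sets borel"
    and m: "m \<ge> 1"
  shows "char (distr \<nu> borel (\<lambda>x. x \<bullet> u)) t ^ m
    = char (distr \<nu> borel (\<lambda>x. x \<bullet> u)) (real m powr (1 / \<alpha>) * t)"
proof -
  interpret prob_space M by fact
  have Y [measurable]: "Y i \<in> borel_measurable M" if "i \<ge> 1" for i
    using indep that by (simp add: indep_vars_def)
  let ?\<mu> = "\<lambda>n. distr M borel (\<lambda>\<omega>. (\<Sum>i=1..n. Y i \<omega>) /\<^sub>R b n)"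
  let ?\<phi> = "char (distr \<nu> borel (\<lambda>x. x \<bullet> u))"
  define \<psi> where "\<psi> = char (distr M borel (\<lambda>\<omega>. Y 1 \<omega> \<bullet> u))"
  have Sm: "(\<lambda>\<omega>. (\<Sum>i=1..n. Y i \<omega>) /\<^sub>R b n) \<in> borel_measurable M" for n
    by (intro borel_measurable_scaleR borel_measurable_const borel_measurable_sum) auto
  define \<mu> where "\<mu> n = distr (?\<mu> n) borel (\<lambda>x. x \<bullet> u)" for n
  have \<mu>_eq: "\<mu> n = distr M borel (\<lambda>\<omega>. inverse (b n) * (\<Sum>i=1..n. Y i \<omega> \<bullet> u))" for n
    unfolding \<mu>_def using Sm[of n] by (subst distr_distr) (auto simp: comp_def inner_sum_left)
  have real_\<mu>: "real_distribution (\<mu> n)" for n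
    unfolding \<mu>_eq by (intro real_distribution_distr) (auto intro!: borel_measurable_times borel_measurable_sum)
  have real_\<nu>: "real_distribution (distr \<nu> borel (\<lambda>x. x \<bullet> u))"
    using \<nu> by (intro prob_space.real_distribution_distr) (auto cong: measurable_cong_sets)
  have char_\<mu>: "char (\<mu> n) s = \<psi> (s / b n) ^ n" for n s
  proof -
    have "indep_vars (\<lambda>_. borel) (\<lambda>i \<omega>. Y i \<omega> \<bullet> u) {1..}"
      by (rule indep_vars_compose2[OF indep]) auto
    then have ind: "indep_vars (\<lambda>_. borel) (\<lambda>i \<omega>. Y i \<omega> \<bullet> u) {1..n}"
      by (rule indep_vars_subset) auto
    have D: "distr M borel (\<lambda>\<omega>. Y i \<omega> \<bullet> u) = distr M borel (\<lambda>\<omega>. Y 1 \<omega> \<bullet> u)" if "i \<ge> 1" for i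
    proof -
      have "distr (distr M borel (Y i)) borel (\<lambda>x. x \<bullet> u) = distr (distr M borel (Y 1)) borel (\<lambda>x. x \<bullet> u)"
        using ident[OF that] by simp
      then show ?thesis using that by (simp add: distr_distr comp_def)
    qed
    have "char (distr M borel (\<lambda>\<omega>. \<Sum>i=1..n. Y i \<omega> \<bullet> u)) s' = \<psi> s' ^ n" for s'
    proof -
      have "char (distr M borel (\<lambda>\<omega>. \<Sum>i=1..n. Y i \<omega> \<bullet> u)) s' = (\<Prod>i=1..n. \<psi> s')"
        unfolding char_distr_sum[OF ind] \<psi>_def by (intro prod.cong refl arg_cong2[of _ _ _ _ char] D) auto
      then show ?thesis by simp
    qed
    then show ?thesis
      unfolding \<mu>_eq by (subst char_distr_scale) (auto intro!: borel_measurable_sum simp: divide_inverse mult.commute)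
  qed
  have lim: "(\<lambda>n. char (\<mu> n) s) \<longlonglongrightarrow> ?\<phi> s" for s
    unfolding \<mu>_def using conv \<nu> Sm by (intro char_inner_tendsto) (auto intro!: prob_space_distr)
  \<comment> \<open>\<open>Suc n\<close> keeps the index positive, where \<open>b_pos\<close> and
    \<open>b_eq\<close> apply.\<close>
  define k where "k n = m * Suc n" for n
  have k: "filterlim k at_top sequentially"
  proof (rule filterlim_at_top_mono[OF filterlim_Suc], intro always_eventually allI)
    show "Suc n \<le> k n" for n
      using mult_le_mono1[OF m, of "Suc n"] by (simp add: k_def)
  qed
  define a where "a n = b (k n) / b (Suc n)" for n
  have a: "a \<longlonglongrightarrow> real m powr (1 / \<alpha>)"
  proof -
    have "((\<lambda>x. l (real m * x) / l x) \<longlongrightarrow> 1) at_top"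
      using l_slow m by (simp add: slowly_varying_def)
    moreover have "filterlim (\<lambda>n. real (Suc n)) at_top sequentially"
      by (rule filterlim_compose[OF filterlim_real_sequentially filterlim_Suc])
    ultimately have "(\<lambda>n. l (real m * real (Suc n)) / l (real (Suc n))) \<longlonglongrightarrow> 1"
      by (rule filterlim_compose)
    then have "(\<lambda>n. real m powr (1 / \<alpha>) * (l (real m * real (Suc n)) / l (real (Suc n)))) \<longlonglongrightarrow> real m powr (1 / \<alpha>) * 1"
      by (intro tendsto_intros)
    moreover have "a = (\<lambda>n. real m powr (1 / \<alpha>) * (l (real m * real (Suc n)) / l (real (Suc n))))"
    proof
      fix n
      have "k n \<ge> 1" using m by (simp add: k_def)
      moreover have "real (k n) powr (1 / \<alpha>) = real m powr (1 / \<alpha>) * real (Suc n) powr (1 / \<alpha>)"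
        unfolding k_def of_nat_mult by (rule powr_mult)
      ultimately have "b (k n) = real m powr (1 / \<alpha>) * real (Suc n) powr (1 / \<alpha>) * l (real m * real (Suc n))"
        using b_eq[of "k n"] unfolding k_def of_nat_mult by simp
      then show "a n = real m powr (1 / \<alpha>) * (l (real m * real (Suc n)) / l (real (Suc n)))"
        unfolding a_def using b_eq[of "Suc n"] by simp
    qed
    ultimately show ?thesis by simp
  qed
  have "(\<lambda>n. char (\<mu> (k n)) (a n * t)) \<longlonglongrightarrow> ?\<phi> (real m powr (1 / \<alpha>) * t)"
    using real_\<mu> real_\<nu> filterlim_compose[OF lim k] a by (intro char_tendsto_rescaled)
  \<comment> \<open>The factor \<open>a n\<close> exchanges the normalisation \<open>b (k n)\<close>
    for \<open>b (Suc n)\<close>; what remains is a power with exponent \<open>m * Suc n\<close>,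
    that is, m blocks of \<open>Suc n\<close> steps.\<close>
  moreover have "char (\<mu> (k n)) (a n * t) = char (\<mu> (Suc n)) t ^ m" for n
  proof -
    have "b (k n) > 0" using m by (intro b_pos) (simp add: k_def)
    then have e: "a n * t / b (k n) = t / b (Suc n)" by (simp add: a_def)
    show ?thesis unfolding char_\<mu> e unfolding k_def mult.commute[of m] by (rule power_mult)
  qed
  moreover have "(\<lambda>n. char (\<mu> (Suc n)) t ^ m) \<longlonglongrightarrow> ?\<phi> t ^ m"
    by (intro tendsto_power LIMSEQ_Suc lim)
  ultimately show ?thesis
    using LIMSEQ_unique by fastforce
qed

text \<open>The quotient \<open>f t / g t\<close> is continuous and takes values in the finite set
  of n-th roots of unity, hence is constant on the line.\<close>

lemma continuous_nth_root_unique: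
  fixes f g :: "real \<Rightarrow> complex"
  assumes f: "continuous_on UNIV f" and g: "continuous_on UNIV g" "\<And>t. g t \<noteq> 0"
    and eq: "\<And>t. f t ^ n = g t ^ n" and n: "n > 0" and t0: "f t0 = g t0"
  shows "f t = g t"
proof -
  let ?h = "\<lambda>t. f t / g t"
  have "?h t ^ n = 1" for t using eq g(2) by (simp add: power_divide)
  then have "range ?h \<subseteq> {z. z ^ n = 1}" by auto
  then have "finite (range ?h)" using finite_roots_unity[of n] n finite_subset by auto
  moreover have "continuous_on UNIV ?h" using f g by (intro continuous_intros) auto
  ultimately have "?h constant_on UNIV" by (intro continuous_finite_range_constant) auto
  then have "?h t = ?h t0" by (auto simp: constant_on_def)
  then show ?thesis using t0 g(2) by simp
qed

text \<open>The sum equals the sum of \<open>real k powr (\<beta> - 1)\<close> divided by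
  \<open>real n powr \<beta>\<close>. Since \<open>\<beta> \<le> 1\<close>, the derivative of
  \<open>x powr \<beta>\<close> is nonincreasing, so telescoping mean value estimates bound
  \<open>\<beta>\<close> times the former sum on both sides.\<close>

lemma sum_powr_tendsto:
  assumes b: "0 < \<beta>" "\<beta> \<le> (1::real)"
  shows "(\<lambda>n. \<Sum>k=1..n. (real k / real n) powr \<beta> / real k) \<longlonglongrightarrow> 1 / \<beta>"
proof -
  let ?S = "\<lambda>n. \<Sum>k=1..n. real k powr (\<beta> - 1)"
  have mvt: "\<exists>\<xi>. real n < \<xi> \<and> \<xi> < real (Suc n) \<and> real (Suc n) powr \<beta> - real n powr \<beta> = \<beta> * \<xi> powr (\<beta> - 1)"
    if "n \<ge> 1" for n
  proof -
    have "\<exists>\<xi>. real n < \<xi> \<and> \<xi> < real (Suc n) \<and> real (Suc n) powr \<beta> - real n powr \<beta> = (real (Suc n) - real n) * (\<beta> * \<xi> powr (\<beta> - 1))"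
      using that by (intro MVT2) (auto intro!: derivative_eq_intros)
    then show ?thesis by simp
  qed
  have upper: "\<beta> * ?S n \<le> real n powr \<beta>" for n
  proof (induction n)
    case (Suc n)
    show ?case
    \<comment> \<open>The interval from 0 to 1, where the derivative may be singular at the left
      end, is treated by hand and uses only \<open>\<beta> \<le> 1\<close>.\<close>
    proof (cases "n = 0")
      case False
      then obtain \<xi> where x: "real n < \<xi>" "\<xi> < real (Suc n)" "real (Suc n) powr \<beta> - real n powr \<beta> = \<beta> * \<xi> powr (\<beta> - 1)"
        using mvt[of n] by auto
      have "real (Suc n) powr (\<beta> - 1) \<le> \<xi> powr (\<beta> - 1)"
        using x b by (intro powr_mono2') auto
      then have "\<beta> * real (Suc n) powr (\<beta> - 1) \<le> \<beta> * \<xi> powr (\<beta> - 1)" using b by simp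
      then show ?thesis using Suc.IH x(3) by (simp add: distrib_left del: of_nat_Suc)
    qed (use b in auto)
  qed simp
  have lower: "real (Suc n) powr \<beta> - 1 \<le> \<beta> * ?S n" for n
  proof (induction n)
    case (Suc n)
    obtain \<xi> where x: "real (Suc n) < \<xi>" "real (Suc (Suc n)) powr \<beta> - real (Suc n) powr \<beta> = \<beta> * \<xi> powr (\<beta> - 1)"
      using mvt[of "Suc n"] by auto
    have "\<xi> powr (\<beta> - 1) \<le> real (Suc n) powr (\<beta> - 1)"
      using x b by (intro powr_mono2') auto
    then have "\<beta> * \<xi> powr (\<beta> - 1) \<le> \<beta> * real (Suc n) powr (\<beta> - 1)" using b by simp
    then show ?case using Suc.IH x(2) by (simp add: distrib_left del: of_nat_Suc)
  qed simp
  have eq: "(\<Sum>k=1..n. (real k / real n) powr \<beta> / real k) = ?S n / real n powr \<beta>" for n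
    by (auto simp: powr_divide powr_diff sum_divide_distrib intro!: sum.cong)
  show ?thesis
    unfolding eq
  proof (rule tendsto_sandwich[OF _ _ _ tendsto_const])
    have "((\<lambda>n. (1 - real n powr (- \<beta>)) / \<beta>) \<longlonglongrightarrow> (1 - 0) / \<beta>)"
      using b by (intro tendsto_intros tendsto_neg_powr filterlim_real_sequentially) auto
    then show "(\<lambda>n. (1 - real n powr (- \<beta>)) / \<beta>) \<longlonglongrightarrow> 1 / \<beta>" by simp
    show "\<forall>\<^sub>F n in sequentially. (1 - real n powr (- \<beta>)) / \<beta> \<le> ?S n / real n powr \<beta>"
    proof (rule eventually_sequentiallyI[of 1])
      fix n :: nat assume n: "n \<ge> 1"
      have "real n powr \<beta> \<le> real (Suc n) powr \<beta>" using b by (intro powr_mono2) auto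
      then have "real n powr \<beta> - 1 \<le> \<beta> * ?S n" using lower[of n] by linarith
      moreover have "real n powr \<beta> > 0" using n by simp
      ultimately have "(real n powr \<beta> - 1) / real n powr \<beta> \<le> \<beta> * ?S n / real n powr \<beta>"
        by (intro divide_right_mono) auto
      then have "(real n powr \<beta> - 1) / real n powr \<beta> / \<beta> \<le> \<beta> * ?S n / real n powr \<beta> / \<beta>"
        by (rule divide_right_mono) (rule less_imp_le[OF b(1)])
      also have "\<beta> * ?S n / real n powr \<beta> / \<beta> = ?S n / real n powr \<beta>"
        using b by simp
      finally have *: "(real n powr \<beta> - 1) / real n powr \<beta> / \<beta> \<le> ?S n / real n powr \<beta>" .
      have "(real n powr \<beta> - 1) / real n powr \<beta> = 1 - real n powr (- \<beta>)"
        using n by (simp add: powr_minus field_simps)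
      with * show "(1 - real n powr (- \<beta>)) / \<beta> \<le> ?S n / real n powr \<beta>"
        by (simp only:)
    qed
    show "\<forall>\<^sub>F n in sequentially. ?S n / real n powr \<beta> \<le> 1 / \<beta>"
    proof (rule eventually_sequentiallyI[of 1])
      fix n :: nat assume n: "n \<ge> 1"
      then show "?S n / real n powr \<beta> \<le> 1 / \<beta>"
        using upper[of n] b by (simp add: field_simps)
    qed
  qed
qed

text \<open>The right-hand side has a finite expectation as soon as the characteristic function is
  \<open>1 + O(r\<^bsup>-k\<^esup> q\<^bsup>-k\<^esup>)\<close> at \<open>r\<^bsup>-k\<^esup>\<close> for some \<open>q > 1\<close>.\<close>

lemma abs_le_cos_series:
  fixes r w :: real
  assumes r: "1 < r" "r \<le> 2"
  shows "ennreal \<bar>w\<bar> \<le> 1 + (\<Sum>k. ennreal (8 * r ^ k * (1 - cos (inverse (r ^ k) * w))))"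
proof (cases "\<bar>w\<bar> \<le> 1")
  case True
  then have "ennreal \<bar>w\<bar> \<le> 1" by simp
  then show ?thesis by (simp add: add_increasing2)
next
  case False
  obtain K where "\<bar>w\<bar> < r ^ K" using real_arch_pow[OF r(1)] by blast
  \<comment> \<open>This choice places \<open>\<bar>w\<bar> / r ^ k\<close> in the interval from 1
    to 2, and the single term of index \<open>k\<close> then dominates
    \<open>\<bar>w\<bar>\<close>.\<close>
  define k where "k = (LEAST K. \<bar>w\<bar> < r ^ Suc K)"
  have "\<exists>K. \<bar>w\<bar> < r ^ Suc K"
    using \<open>\<bar>w\<bar> < r ^ K\<close> r power_increasing[of K "Suc K" r] by (intro exI[of _ K]) linarith
  then have k2: "\<bar>w\<bar> < r ^ Suc k" unfolding k_def by (rule LeastI_ex)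
  have k1: "r ^ k \<le> \<bar>w\<bar>"
  proof (cases k)
    case (Suc k')
    then have "\<not> \<bar>w\<bar> < r ^ Suc k'" using not_less_Least[of k' "\<lambda>K. \<bar>w\<bar> < r ^ Suc K"] unfolding k_def by simp
    then show ?thesis using Suc by simp
  qed (use False in simp)
  have rk: "r ^ k > 0" using r by simp
  have rr: "r * r ^ k \<le> 2 * r ^ k" using r rk by (intro mult_right_mono) auto
  define \<theta> where "\<theta> = \<bar>w\<bar> / r ^ k"
  have \<theta>: "1 \<le> \<theta>" "\<theta> \<le> 2"
  proof -
    have "\<bar>w\<bar> \<le> 2 * r ^ k" using k2 rr unfolding power_Suc by linarith
    then show "1 \<le> \<theta>" "\<theta> \<le> 2"
      using k1 rk by (simp_all add: \<theta>_def pos_divide_le_eq)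
  qed
  have "cos (inverse (r ^ k) * w) = cos \<theta>"
  proof -
    have "inverse (r ^ k) * w = \<theta> \<or> inverse (r ^ k) * w = - \<theta>"
      unfolding \<theta>_def by (cases "w \<ge> 0") (simp_all add: divide_inverse mult.commute)
    then show ?thesis by (metis cos_minus)
  qed
  \<comment> \<open>The interval from 1 to 2 lies inside the one from pi / 4 to pi, so the cosine
    stays away from 1.\<close>
  also have "cos \<theta> \<le> cos (pi / 4)"
    using \<theta> pi_less_4 pi_ge_two by (intro cos_monotone_0_pi_le) auto
  also have "\<dots> = sqrt 2 / 2" by (rule cos_45)
  also have "\<dots> \<le> 3 / 4"
    using real_le_lsqrt[of "3 / 2" 2] by (simp add: power2_eq_square)
  finally have c: "1 / 4 \<le> 1 - cos (inverse (r ^ k) * w)" by simp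
  have "\<bar>w\<bar> \<le> 2 * r ^ k" using k2 rr by simp
  \<comment> \<open>The constant 8 combines the factor 2 from \<open>r \<le> 2\<close> with the
    lower bound 1 / 4 for one minus the cosine.\<close>
  also have "\<dots> = 8 * r ^ k * (1 / 4)" by simp
  also have "\<dots> \<le> 8 * r ^ k * (1 - cos (inverse (r ^ k) * w))"
    using c rk by (intro mult_left_mono) auto
  finally have "ennreal \<bar>w\<bar> \<le> ennreal (8 * r ^ k * (1 - cos (inverse (r ^ k) * w)))"
    by (rule ennreal_leI)
  also have "\<dots> \<le> (\<Sum>k. ennreal (8 * r ^ k * (1 - cos (inverse (r ^ k) * w))))"
    using sum_le_suminf[of "\<lambda>k. ennreal (8 * r ^ k * (1 - cos (inverse (r ^ k) * w)))" "{k}"] by simp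
  finally show ?thesis by (simp add: add_increasing)
qed

text \<open>Put \<open>z k = char \<mu> (inverse (r ^ k))\<close>. Then \<open>z (Suc k)\<close>
  squares to \<open>z k\<close>, so \<open>1 - z k\<close> is \<open>1 - z (Suc k)\<close> times
  \<open>1 + z (Suc k)\<close>, a factor close to 2. Hence the distance of \<open>z k\<close> to 1
  shrinks almost by half at each step and beats the growth of \<open>r ^ k\<close>, because
  \<open>r < 2\<close>.\<close>

lemma integrable_of_strictly_stable_char:
  assumes mu: "real_distribution \<mu>" and r: "1 < r" "r < 2"
    and sq: "\<And>t. char \<mu> t ^ 2 = char \<mu> (r * t)"
  shows "integrable \<mu> (\<lambda>x. x)"
proof -
  interpret real_distribution \<mu> by fact
  define z where "z k = char \<mu> (inverse (r ^ k))" for k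
  have z_step: "z (Suc k) ^ 2 = z k" for k
    unfolding z_def sq using r by (simp add: mult.assoc[symmetric])
  have "(\<lambda>k. inverse (r ^ k)) \<longlonglongrightarrow> 0"
    using r by (intro LIMSEQ_inverse_realpow_zero)
  then have "(\<lambda>k. char \<mu> (inverse (r ^ k))) \<longlonglongrightarrow> char \<mu> 0"
    by (rule isCont_tendsto_compose[OF isCont_char])
  then have z_lim: "z \<longlonglongrightarrow> 1" by (simp add: z_def[abs_def] char_zero)
  \<comment> \<open>Any number strictly between \<open>r\<close> and 2 works: below 2 so that the
    factor eventually exceeds it, above \<open>r\<close> for the ratio test.\<close>
  define q where "q = (r + 2) / 2"
  have q: "r < q" "q < 2" using r by (auto simp: q_def)
  have "summable (\<lambda>k. r ^ k * norm (1 - z k))"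
  proof -
    have "eventually (\<lambda>k. dist (z k) 1 < 2 - q) sequentially"
      using q by (intro tendstoD[OF z_lim]) auto
    then obtain K where K: "\<And>k. k \<ge> K \<Longrightarrow> dist (z k) 1 < 2 - q"
      unfolding eventually_sequentially by blast
    show ?thesis
    proof (rule summable_ratio_test[where c = "r / q" and N = K])
      show "r / q < 1" using q r by simp
      fix k assume k: "k \<ge> K"
      have "norm (2::complex) - norm (1 - z (Suc k)) \<le> norm (2 - (1 - z (Suc k)))"
        by (rule norm_triangle_ineq2)
      then have "q \<le> norm (1 + z (Suc k))"
        using K[of "Suc k"] k by (simp add: dist_norm norm_minus_commute algebra_simps)
      moreover have "1 - z k = (1 - z (Suc k)) * (1 + z (Suc k))"
        unfolding z_step[of k, symmetric] by (simp add: algebra_simps power2_eq_square)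
      then have "norm (1 - z k) = norm (1 - z (Suc k)) * norm (1 + z (Suc k))"
        by (simp add: norm_mult)
      ultimately have "norm (1 - z (Suc k)) * q \<le> norm (1 - z k)"
        by (simp add: mult_left_mono)
      then have "norm (1 - z (Suc k)) \<le> norm (1 - z k) / q"
        using q r by (simp add: field_simps)
      then have "r ^ Suc k * norm (1 - z (Suc k)) \<le> r ^ Suc k * (norm (1 - z k) / q)"
        using r by (intro mult_left_mono) auto
      then show "norm (r ^ Suc k * norm (1 - z (Suc k))) \<le> r / q * norm (r ^ k * norm (1 - z k))"
        using r by (simp add: abs_mult)
    qed
  qed
  then have summ: "summable (\<lambda>k. 8 * (r ^ k * norm (1 - z k)))" by (rule summable_mult)
  have term_le: "(\<integral>\<^sup>+w. ennreal (8 * r ^ k * (1 - cos (inverse (r ^ k) * w))) \<partial>\<mu>) \<le> ennreal (8 * (r ^ k * norm (1 - z k)))" for k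
  proof -
    let ?s = "inverse (r ^ k)"
    have i: "integrable \<mu> (\<lambda>w. cos (?s * w))" by (rule integrable_const_bound[of _ 1]) auto
    have "integrable \<mu> (\<lambda>w. iexp (?s * w))"
      using integrable_iexp[of "\<lambda>w. complex_of_real (?s * w)"] by simp
    then have "Re (z k) = (\<integral>w. Re (iexp (?s * w)) \<partial>\<mu>)"
      unfolding z_def char_def by (rule integral_Re[symmetric])
    also have "\<dots> = (\<integral>w. cos (?s * w) \<partial>\<mu>)"
      by (intro Bochner_Integration.integral_cong refl) (simp only: cis_conv_exp[symmetric] cis.sel)
    finally have Re: "(\<integral>w. 8 * r ^ k * (1 - cos (?s * w)) \<partial>\<mu>) = 8 * r ^ k * (1 - Re (z k))"
      using i by (simp add: prob_space[simplified])
    have "(\<integral>\<^sup>+w. ennreal (8 * r ^ k * (1 - cos (?s * w))) \<partial>\<mu>) = ennreal (8 * r ^ k * (1 - Re (z k)))"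
      unfolding Re[symmetric] using i r
      by (intro nn_integral_eq_integral Bochner_Integration.integrable_diff integrable_mult_right AE_I2 mult_nonneg_nonneg) auto
    also have "\<dots> \<le> ennreal (8 * (r ^ k * norm (1 - z k)))"
    proof (rule ennreal_leI)
      have "1 - Re (z k) \<le> norm (1 - z k)" using complex_Re_le_cmod[of "1 - z k"] by simp
      then have "r ^ k * (1 - Re (z k)) \<le> r ^ k * norm (1 - z k)" using r by (intro mult_left_mono) auto
      then show "8 * r ^ k * (1 - Re (z k)) \<le> 8 * (r ^ k * norm (1 - z k))" by simp
    qed
    finally show ?thesis .
  qed
  have "(\<integral>\<^sup>+w. ennreal \<bar>w\<bar> \<partial>\<mu>) \<le> (\<integral>\<^sup>+w. 1 + (\<Sum>k. ennreal (8 * r ^ k * (1 - cos (inverse (r ^ k) * w)))) \<partial>\<mu>)"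
    using r by (intro nn_integral_mono abs_le_cos_series) auto
  also have "\<dots> = 1 + (\<Sum>k. \<integral>\<^sup>+w. ennreal (8 * r ^ k * (1 - cos (inverse (r ^ k) * w))) \<partial>\<mu>)"
    using emeasure_space_1 by (subst nn_integral_add) (auto simp: nn_integral_suminf)
  also have "\<dots> \<le> 1 + (\<Sum>k. ennreal (8 * (r ^ k * norm (1 - z k))))"
    by (intro add_left_mono suminf_le term_le) auto
  also have "\<dots> = 1 + ennreal (\<Sum>k. 8 * (r ^ k * norm (1 - z k)))"
    using summ r by (subst suminf_ennreal2) auto
  also have "\<dots> < \<infinity>" by (simp add: ennreal_add_less_top ennreal_less_top)
  finally show ?thesis
    by (intro integrableI_bounded) auto
qed

section \<open>The maximum of a strictly stable process\<close>

text \<open>Dyadic grids are nested, so the grid maxima increase with \<open>j\<close> and monotone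
  convergence becomes available.\<close>

abbreviation grid_increment :: "(real \<Rightarrow> 'a::real_vector) \<Rightarrow> nat \<Rightarrow> nat \<Rightarrow> 'a" where
  "grid_increment z j i \<equiv> z (real (Suc i) / 2 ^ j) - z (real i / 2 ^ j)"

lemma sum_grid_increment: "(\<Sum>i<k. grid_increment z j i) = z (real k / 2 ^ j) - z 0"
  using sum_lessThan_telescope[of "\<lambda>i. z (real i / 2 ^ j)" k] by simp

lemma grid_max_le_iff:
  "walk_max (2 ^ j) (grid_increment z j) \<le> c \<longleftrightarrow> (\<forall>k\<le>2 ^ j. z (real k / 2 ^ j) - z 0 \<le> c)"
  unfolding walk_max_le_iff sum_grid_increment ..

lemma incseq_grid_max: "incseq (\<lambda>j. walk_max (2 ^ j) (grid_increment z j))"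
proof (rule incseq_SucI)
  fix j
  show "walk_max (2 ^ j) (grid_increment z j) \<le> walk_max (2 ^ Suc j) (grid_increment z (Suc j))"
    unfolding grid_max_le_iff[of j]
  proof (intro allI impI)
    fix k :: nat assume "k \<le> 2 ^ j"
    then have "2 * k \<le> 2 ^ Suc j" by simp
    from sum_le_walk_max[OF this, of "grid_increment z (Suc j)"]
    show "z (real k / 2 ^ j) - z 0 \<le> walk_max (2 ^ Suc j) (grid_increment z (Suc j))"
      unfolding sum_grid_increment by simp
  qed
qed

text \<open>The grid maxima never exceed the supremum. Conversely, right-continuity spreads a nearly
  maximal value to an interval on the right, which contains a dyadic time.\<close>

lemma grid_max_tendsto:
  assumes z: "cadlag z"
  shows "(\<lambda>j. walk_max (2 ^ j) (grid_increment z j)) \<longlonglongrightarrow> (SUP t\<in>{0..1}. z t - z 0)"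
proof -
  let ?G = "\<lambda>j. walk_max (2 ^ j) (grid_increment z j)" and ?H = "SUP t\<in>{0..1}. z t - z 0"
  obtain B where B: "\<forall>t\<in>{0..1}. norm (z t) \<le> B"
    using cadlag_bounded[OF z, of 1] unfolding bounded_iff by auto
  have bdd: "bdd_above ((\<lambda>t. z t - z 0) ` {0..1})"
  proof (rule bdd_aboveI2[of _ _ "B - z 0"])
    fix t assume "t \<in> {0..1::real}"
    then show "z t - z 0 \<le> B - z 0" using B by fastforce
  qed
  have G_le: "?G j \<le> ?H" for j
    unfolding grid_max_le_iff
  proof (intro allI impI)
    fix k :: nat assume "k \<le> 2 ^ j"
    from of_nat_mono[OF this, where 'a = real] have "real k / 2 ^ j \<in> {0..1}" by simp
    from cSUP_upper[OF this bdd] show "z (real k / 2 ^ j) - z 0 \<le> ?H" .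
  qed
  show ?thesis
  proof (rule order_tendstoI)
    fix y assume "?H < y"
    then show "\<forall>\<^sub>F j in sequentially. ?G j < y"
      using G_le by (intro always_eventually allI) (rule le_less_trans)
  next
    fix y assume "y < ?H"
    then obtain t where t: "t \<in> {0..1}" "y < z t - z 0"
      using less_cSUP_iff[OF _ bdd, of y] by auto
    have "\<exists>j k. k \<le> 2 ^ j \<and> y < z (real k / 2 ^ j) - z 0"
    \<comment> \<open>Time 1 has no room to its right within the unit interval, but it belongs to
      every grid.\<close>
    proof (cases "t = 1")
      case True
      then show ?thesis using t by (intro exI[of _ 0] exI[of _ 1]) auto
    next
      case False
      then have t1: "0 \<le> t" "t < 1" using t by auto
      have "(z \<longlongrightarrow> z t) (at_right t)" using z t1 by (simp add: cadlag_def)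
      then have "((\<lambda>s. z s - z 0) \<longlongrightarrow> z t - z 0) (at_right t)" by (intro tendsto_intros)
      then have "\<forall>\<^sub>F s in at_right t. y < z s - z 0" using t(2) by (rule order_tendstoD)
      then obtain c where c: "c > t" "\<And>s. s > t \<Longrightarrow> s < c \<Longrightarrow> y < z s - z 0"
        unfolding eventually_at_right_field by blast
      define \<delta> where "\<delta> = min c 1 - t"
      have "\<delta> > 0" using c(1) t1 by (simp add: \<delta>_def)
      then obtain j where j: "(1 / 2) ^ j < \<delta>" using real_arch_pow_inv[of \<delta> "1/2"] by auto
      \<comment> \<open>The first grid index strictly to the right of \<open>t\<close>; adding 1
        after the floor secures strictness even when \<open>t\<close> is itself dyadic.\<close>
      define k where "k = nat \<lfloor>t * 2 ^ j\<rfloor> + 1"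
      have k: "t * 2 ^ j < real k" "real k \<le> t * 2 ^ j + 1"
        using t1 unfolding k_def by (auto simp: of_nat_nat) linarith+
      have "t < real k / 2 ^ j" using k(1) by (simp add: field_simps)
      moreover have "real k / 2 ^ j < t + \<delta>"
      proof -
        have "real k / 2 ^ j \<le> (t * 2 ^ j + 1) / 2 ^ j" using k(2) by (intro divide_right_mono) auto
        also have "\<dots> = t + (1 / 2) ^ j" by (simp add: add_divide_distrib power_divide)
        finally show ?thesis using j by linarith
      qed
      then have "real k / 2 ^ j < c" "real k / 2 ^ j < 1" unfolding \<delta>_def by linarith+
      moreover from this have "real k < 2 ^ j" by simp
      then have "k \<le> 2 ^ j" by (metis less_imp_le of_nat_less_iff of_nat_numeral of_nat_power)
      ultimately show ?thesis using c(2) by blast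
    qed
    then obtain j k where jk: "k \<le> 2 ^ j" "y < z (real k / 2 ^ j) - z 0" by blast
    show "\<forall>\<^sub>F j in sequentially. y < ?G j"
    proof (rule eventually_sequentiallyI[of j])
      fix i assume "j \<le> i"
      have "y < z (real k / 2 ^ j) - z 0" by (rule jk)
      also have "\<dots> \<le> ?G j" using sum_le_walk_max[OF jk(1), of "grid_increment z j"] unfolding sum_grid_increment .
      also have "\<dots> \<le> ?G i" using incseq_grid_max \<open>j \<le> i\<close> by (rule incseqD)
      finally show "y < ?G i" .
    qed
  qed
qed

text \<open>Strict stability is stated for integer multiples only, which is the form delivered by
  the random walk and suffices for rational times.\<close>

locale strictly_stable_levy =
  fixes N :: "'p measure" and Z :: "real \<Rightarrow> 'p \<Rightarrow> real" and \<alpha> :: real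
  assumes levy: "levy_process N Z" and alpha: "1 < \<alpha>"
    and stable_char: "\<And>m t. m \<ge> 1 \<Longrightarrow>
      char (distr N borel (Z 1)) t ^ m = char (distr N borel (Z 1)) (real m powr (1 / \<alpha>) * t)"
begin

sublocale prob_space N
  using levy by (simp add: levy_process_def)

lemma measurable_Z [measurable]: "t \<ge> 0 \<Longrightarrow> Z t \<in> borel_measurable N"
  using levy by (simp add: levy_process_def)

lemma distr_increment:
  assumes "s \<ge> 0" "t \<ge> 0"
  shows "distr N borel (\<lambda>\<omega>. Z (s + t) \<omega> - Z s \<omega>) = distr N borel (Z t)"
  using levy assms by (simp add: levy_process_def)

lemma indep_increments:
  assumes "h \<ge> 0"
  shows "indep_vars (\<lambda>_. borel) (\<lambda>i \<omega>. Z (real (Suc i) * h) \<omega> - Z (real i * h) \<omega>) {..<k}"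
proof -
  have "\<forall>(n::nat) t. 0 \<le> t 0 \<and> (\<forall>i<n. t i \<le> t (Suc i)) \<longrightarrow>
        indep_vars (\<lambda>_. borel) (\<lambda>i \<omega>. Z (t (Suc i)) \<omega> - Z (t i) \<omega>) {..<n}"
    using levy unfolding levy_process_def by blast
  from this[rule_format, of "\<lambda>i. real i * h" k] show ?thesis
    using assms by (simp add: mult_right_mono)
qed

lemma distr_grid_increment:
  assumes "h \<ge> 0"
  shows "distr N borel (\<lambda>\<omega>. Z (real (Suc i) * h) \<omega> - Z (real i * h) \<omega>) = distr N borel (Z h)"
  using distr_increment[of "real i * h" h] assms by (simp add: algebra_simps)

lemma char_multiple:
  assumes h: "h \<ge> 0"
  shows "char (distr N borel (Z (real k * h))) t = char (distr N borel (Z h)) t ^ k"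
proof -
  \<comment> \<open>Stationarity from time 0 replaces the value by an increment, so it is harmless
    that \<open>Z 0\<close> vanishes only almost everywhere.\<close>
  have "distr N borel (Z (real k * h)) = distr N borel (\<lambda>\<omega>. Z (0 + real k * h) \<omega> - Z 0 \<omega>)"
    using h by (intro distr_increment[symmetric]) auto
  also have "(\<lambda>\<omega>. Z (0 + real k * h) \<omega> - Z 0 \<omega>) = (\<lambda>\<omega>. \<Sum>i<k. Z (real (Suc i) * h) \<omega> - Z (real i * h) \<omega>)"
    using sum_lessThan_telescope[of "\<lambda>i. Z (real i * h) _" k] by (simp add: fun_eq_iff)
  finally have "char (distr N borel (Z (real k * h))) t = (\<Prod>i<k. char (distr N borel (Z h)) t)"
    unfolding char_distr_sum[OF indep_increments[OF h]] distr_grid_increment[OF h]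
    by (simp add: char_distr_sum[OF indep_increments[OF h]] distr_grid_increment[OF h] del: of_nat_Suc)
  then show ?thesis by simp
qed

abbreviation \<phi> where "\<phi> \<equiv> char (distr N borel (Z 1))"

lemma real_distribution_Z: "t \<ge> 0 \<Longrightarrow> real_distribution (distr N borel (Z t))"
  by (intro real_distribution_distr) measurable

lemma char_at_zero: "t \<ge> 0 \<Longrightarrow> char (distr N borel (Z t)) 0 = 1"
  using real_distribution.char_zero[OF real_distribution_Z] .

lemma continuous_char_Z: "t \<ge> 0 \<Longrightarrow> isCont (char (distr N borel (Z t))) s"
  using real_distribution.isCont_char[OF real_distribution_Z] .

text \<open>A zero at \<open>t\<close> would propagate to the points \<open>t\<close> divided by
  powers of \<open>2 powr (1 / \<alpha>)\<close>, which tend to 0, where the characteristic function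
  is 1.\<close>

lemma char_nonzero: "\<phi> t \<noteq> 0"
proof
  assume "\<phi> t = 0"
  define r where "r = 2 powr (1 / \<alpha>)"
  have r: "r > 1" using alpha by (simp add: r_def)
  have "\<phi> (inverse (r ^ k) * t) = 0" for k
  proof (induction k)
    case (Suc k)
    have "\<phi> (inverse (r ^ Suc k) * t) ^ 2 = \<phi> (r * (inverse (r ^ Suc k) * t))"
      using stable_char[of 2] by (simp add: r_def)
    also have "r * (inverse (r ^ Suc k) * t) = inverse (r ^ k) * t" using r by simp
    finally show ?case using Suc by simp
  qed (simp add: \<open>\<phi> t = 0\<close>)
  moreover have "(\<lambda>k. \<phi> (inverse (r ^ k) * t)) \<longlonglongrightarrow> \<phi> (0 * t)"
    by (intro isCont_tendsto_compose[OF continuous_char_Z] tendsto_mult tendsto_const LIMSEQ_inverse_realpow_zero r) auto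
  ultimately have "(\<lambda>_::nat. 0) \<longlonglongrightarrow> \<phi> 0" by simp
  then have "\<phi> 0 = 0" by (simp add: LIMSEQ_const_iff)
  then show False using char_at_zero[of 1] by simp
qed

text \<open>Both sides are continuous in t, have n-th power \<open>\<phi> t\<close> and agree at 0;
  as the right side has no zeros, they coincide.\<close>

lemma char_fraction:
  assumes n: "n \<ge> 1"
  shows "char (distr N borel (Z (1 / real n))) t = \<phi> (real n powr (- 1 / \<alpha>) * t)"
proof (rule continuous_nth_root_unique[where n = n and ?t0.0 = 0
      and f = "char (distr N borel (Z (1 / real n)))" and g = "\<lambda>t. \<phi> (real n powr (- 1 / \<alpha>) * t)"])
  let ?f = "char (distr N borel (Z (1 / real n)))" and ?c = "real n powr (- 1 / \<alpha>)"
  show "continuous_on UNIV ?f"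
    using continuous_char_Z by (intro continuous_at_imp_continuous_on) auto
  show "continuous_on UNIV (\<lambda>t. \<phi> (?c * t))"
    by (intro continuous_at_imp_continuous_on ballI isCont_o2[OF _ continuous_char_Z] continuous_intros) auto
  show "\<phi> (?c * t) \<noteq> 0" for t by (rule char_nonzero)
  show "?f t ^ n = \<phi> (?c * t) ^ n" for t
  proof -
    have "?f t ^ n = \<phi> t" using char_multiple[of "1 / real n" n t] n by simp
    moreover have "\<phi> (?c * t) ^ n = \<phi> (real n powr (1 / \<alpha>) * (?c * t))" by (rule stable_char[OF n])
    moreover have "real n powr (1 / \<alpha>) * (?c * t) = t" using n by (simp add: powr_add[symmetric] mult.assoc[symmetric])
    ultimately show ?thesis by (simp only:)
  qed
  show "n > 0" using n by simp
  show "?f 0 = \<phi> (?c * 0)" using char_at_zero by simp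
qed

lemma distr_Z_scaling:
  assumes n: "n \<ge> 1" and k: "k \<ge> 1"
  shows "distr N borel (Z (real k / real n)) = distr N borel (\<lambda>\<omega>. (real k / real n) powr (1 / \<alpha>) * Z 1 \<omega>)"
proof (rule Levy_uniqueness)
  show "real_distribution (distr N borel (Z (real k / real n)))" by (intro real_distribution_Z) simp
  show "real_distribution (distr N borel (\<lambda>\<omega>. (real k / real n) powr (1 / \<alpha>) * Z 1 \<omega>))"
    by (intro real_distribution_distr) measurable
  show "char (distr N borel (Z (real k / real n))) = char (distr N borel (\<lambda>\<omega>. (real k / real n) powr (1 / \<alpha>) * Z 1 \<omega>))"
  proof
    fix t
    have "char (distr N borel (Z (real k / real n))) t = char (distr N borel (Z (1 / real n))) t ^ k"
      using char_multiple[of "1 / real n" k t] by simp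
    also have "\<dots> = \<phi> (real k powr (1 / \<alpha>) * (real n powr (- 1 / \<alpha>) * t))"
      unfolding char_fraction[OF n] by (rule stable_char[OF k])
    also have "real k powr (1 / \<alpha>) * (real n powr (- 1 / \<alpha>) * t) = (real k / real n) powr (1 / \<alpha>) * t"
      using powr_divide[of "real k" "real n" "1 / \<alpha>"] powr_minus_divide[of "real n" "1 / \<alpha>"] by simp
    finally show "char (distr N borel (Z (real k / real n))) t = char (distr N borel (\<lambda>\<omega>. (real k / real n) powr (1 / \<alpha>) * Z 1 \<omega>)) t"
      by (subst char_distr_scale) auto
  qed
qed

lemma integrable_Z1: "integrable N (Z 1)"
proof -
  have "integrable (distr N borel (Z 1)) (\<lambda>x. x)"
  proof (rule integrable_of_strictly_stable_char[where r = "2 powr (1 / \<alpha>)"])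
    have "2 powr (1 / \<alpha>) < 2 powr (1::real)" using alpha by (intro powr_less_mono) auto
    then show "2 powr (1 / \<alpha>) < 2" by simp
    show "1 < 2 powr (1 / \<alpha>)" using alpha by simp
    show "\<phi> t ^ 2 = \<phi> (2 powr (1 / \<alpha>) * t)" for t using stable_char[of 2 t] by simp
  qed (simp add: real_distribution_Z)
  then show ?thesis by (subst (asm) integrable_distr_eq) auto
qed

lemma integrable_Z_rational:
  assumes "n \<ge> 1" "k \<ge> 1"
  shows "integrable N (Z (real k / real n))"
proof -
  have "integrable (distr N borel (\<lambda>\<omega>. (real k / real n) powr (1 / \<alpha>) * Z 1 \<omega>)) (\<lambda>x. x)"
    using integrable_Z1 by (subst integrable_distr_eq) auto
  then have "integrable (distr N borel (Z (real k / real n))) (\<lambda>x. x)"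
    unfolding distr_Z_scaling[OF assms] .
  then show ?thesis by (subst (asm) integrable_distr_eq) auto
qed

lemma expectation_pos_part:
  assumes "n \<ge> 1" "k \<ge> 1"
  shows "(\<integral>\<omega>. max 0 (Z (real k / real n) \<omega> - Z 0 \<omega>) \<partial>N) =
    (real k / real n) powr (1 / \<alpha>) * (\<integral>\<omega>. max 0 (Z 1 \<omega>) \<partial>N)"
proof -
  have "(\<integral>\<omega>. max 0 (Z (real k / real n) \<omega> - Z 0 \<omega>) \<partial>N)
      = (\<integral>x. max 0 x \<partial>(distr N borel (\<lambda>\<omega>. Z (0 + real k / real n) \<omega> - Z 0 \<omega>)))"
    by (subst integral_distr) auto
  also have "\<dots> = (\<integral>x. max 0 x \<partial>(distr N borel (\<lambda>\<omega>. (real k / real n) powr (1 / \<alpha>) * Z 1 \<omega>)))"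
    by (subst distr_increment) (auto simp: distr_Z_scaling[OF assms])
  also have "\<dots> = (\<integral>\<omega>. (real k / real n) powr (1 / \<alpha>) * max 0 (Z 1 \<omega>) \<partial>N)"
  proof (subst integral_distr)
    have "(real k / real n) powr (1 / \<alpha>) > 0" using assms by simp
    then have "max 0 ((real k / real n) powr (1 / \<alpha>) * x) = (real k / real n) powr (1 / \<alpha>) * max 0 x" for x
      by (simp only: max_def mult_le_0_iff zero_le_mult_iff) auto
    then show "(\<integral>\<omega>. max 0 ((real k / real n) powr (1 / \<alpha>) * Z 1 \<omega>) \<partial>N)
        = (\<integral>\<omega>. (real k / real n) powr (1 / \<alpha>) * max 0 (Z 1 \<omega>) \<partial>N)"
      by (simp only:)
  qed measurable
  finally show ?thesis by simp
qed

lemma expectation_grid_max: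
  "(\<integral>\<omega>. walk_max (2 ^ j) (grid_increment (\<lambda>t. Z t \<omega>) j) \<partial>N) =
    (\<Sum>k=1..2 ^ j. (real k / 2 ^ j) powr (1 / \<alpha>) / real k) * (\<integral>\<omega>. max 0 (Z 1 \<omega>) \<partial>N)"
proof -
  let ?X = "\<lambda>i \<omega>. Z (real (Suc i) / 2 ^ j) \<omega> - Z (real i / 2 ^ j) \<omega>"
  have n: "(2::nat) ^ j \<ge> 1" by simp
  have ind: "indep_vars (\<lambda>_. borel) ?X {..<2 ^ j}"
    using indep_increments[of "1 / 2 ^ j" "2 ^ j"] by simp
  have id: "distr N borel (?X i) = distr N borel (Z (1 / 2 ^ j))" for i
    using distr_grid_increment[of "1 / 2 ^ j" i] by simp
  have int: "integrable N (?X i)" for i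
  proof -
    have "integrable (distr N borel (Z (1 / 2 ^ j))) (\<lambda>x. x)"
      using integrable_Z_rational[OF n, of 1] by (subst integrable_distr_eq) auto
    then show ?thesis unfolding id[of i, symmetric] by (subst (asm) integrable_distr_eq) auto
  qed
  have "(\<integral>\<omega>. walk_max (2 ^ j) (\<lambda>i. ?X i \<omega>) \<partial>N) = (\<Sum>k=1..2 ^ j. (\<integral>\<omega>. max 0 (\<Sum>i<k. ?X i \<omega>) \<partial>N) / real k)"
    by (rule expectation_walk_max[OF ind id int]) simp
  also have "\<dots> = (\<Sum>k=1..2 ^ j. ((real k / 2 ^ j) powr (1 / \<alpha>) * (\<integral>\<omega>. max 0 (Z 1 \<omega>) \<partial>N)) / real k)"
  proof (intro sum.cong refl arg_cong2[of _ _ _ _ "(/)"])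
    fix k :: nat assume "k \<in> {1..2 ^ j}"
    then have "k \<ge> 1" by simp
    have "(\<Sum>i<k. ?X i \<omega>) = Z (real k / 2 ^ j) \<omega> - Z 0 \<omega>" for \<omega>
      by (rule sum_grid_increment)
    then show "(\<integral>\<omega>. max 0 (\<Sum>i<k. ?X i \<omega>) \<partial>N) = (real k / 2 ^ j) powr (1 / \<alpha>) * (\<integral>\<omega>. max 0 (Z 1 \<omega>) \<partial>N)"
      using expectation_pos_part[OF n \<open>k \<ge> 1\<close>] by simp
  qed
  also have "\<dots> = (\<Sum>k=1..2 ^ j. (real k / 2 ^ j) powr (1 / \<alpha>) / real k) * (\<integral>\<omega>. max 0 (Z 1 \<omega>) \<partial>N)"
    unfolding sum_distrib_right by (intro sum.cong refl) (simp only: times_divide_eq_left)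
  finally show ?thesis .
qed

theorem expectation_path_max:
  "has_bochner_integral N (\<lambda>\<omega>. SUP t\<in>{0..1}. Z t \<omega> - Z 0 \<omega>) (\<alpha> * (\<integral>\<omega>. max 0 (Z 1 \<omega>) \<partial>N))"
proof -
  let ?G = "\<lambda>j \<omega>. walk_max (2 ^ j) (grid_increment (\<lambda>t. Z t \<omega>) j)"
  let ?H = "\<lambda>\<omega>. SUP t\<in>{0..1}. Z t \<omega> - Z 0 \<omega>"
  have cadlag: "cadlag (\<lambda>t. Z t \<omega>)" if "\<omega> \<in> space N" for \<omega>
    using levy that by (simp add: levy_process_def)
  have G_meas [measurable]: "?G j \<in> borel_measurable N" for j by measurable
  have G_lim: "(\<lambda>j. ?G j \<omega>) \<longlonglongrightarrow> ?H \<omega>" if "\<omega> \<in> space N" for \<omega>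
    using grid_max_tendsto[OF cadlag[OF that]] .
  have H_meas: "?H \<in> borel_measurable N"
    by (rule borel_measurable_LIMSEQ_real[OF G_lim G_meas])
  have G_int: "integrable N (?G j)" for j
  proof (rule Bochner_Integration.integrable_bound[of _ "\<lambda>\<omega>. \<Sum>i<2 ^ j. \<bar>grid_increment (\<lambda>t. Z t \<omega>) j i\<bar>"])
    have "integrable N (Z (real k / 2 ^ j))" if "k \<ge> 1" for k
      using integrable_Z_rational[of "2 ^ j" k] that by simp
    \<comment> \<open>The scaling relation covers only positive times.\<close>
    moreover have "integrable N (Z 0)"
    proof (rule integrable_cong_AE_imp[OF integrable_zero])
      have "AE \<omega> in N. Z 0 \<omega> = 0" using levy by (simp add: levy_process_def)
      then show "AE \<omega> in N. 0 = Z 0 \<omega>" by (rule eventually_mono) simp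
    qed measurable
    ultimately have "integrable N (Z (real k / 2 ^ j))" for k by (cases "k = 0") auto
    then show "integrable N (\<lambda>\<omega>. \<Sum>i<2 ^ j. \<bar>grid_increment (\<lambda>t. Z t \<omega>) j i\<bar>)"
      by (intro Bochner_Integration.integrable_sum integrable_abs Bochner_Integration.integrable_diff)
    show "AE \<omega> in N. norm (?G j \<omega>) \<le> norm (\<Sum>i<2 ^ j. \<bar>grid_increment (\<lambda>t. Z t \<omega>) j i\<bar>)"
      using walk_max_le_sum_abs walk_max_nonneg by (intro AE_I2) (simp add: sum_nonneg)
  qed measurable
  \<comment> \<open>The factor \<open>\<alpha>\<close> of the theorem arises here, as the limit for
    exponent \<open>1 / \<alpha>\<close>.\<close>
  have "(\<lambda>n. \<Sum>k=1..n. (real k / real n) powr (1 / \<alpha>) / real k) \<longlonglongrightarrow> 1 / (1 / \<alpha>)"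
    using alpha by (intro sum_powr_tendsto) auto
  moreover have "filterlim (\<lambda>j::nat. 2 ^ j :: nat) at_top sequentially"
    by (rule filterlim_subseq) (auto simp: strict_mono_def)
  ultimately have "(\<lambda>j. \<Sum>k=1..2 ^ j. (real k / real (2 ^ j)) powr (1 / \<alpha>) / real k) \<longlonglongrightarrow> 1 / (1 / \<alpha>)"
    by (rule filterlim_compose)
  then have "(\<lambda>j. (\<Sum>k=1..2 ^ j. (real k / 2 ^ j) powr (1 / \<alpha>) / real k) * (\<integral>\<omega>. max 0 (Z 1 \<omega>) \<partial>N))
      \<longlonglongrightarrow> \<alpha> * (\<integral>\<omega>. max 0 (Z 1 \<omega>) \<partial>N)"
    by (intro tendsto_mult_right) simp
  then have "(\<lambda>j. \<integral>\<omega>. ?G j \<omega> \<partial>N) \<longlonglongrightarrow> \<alpha> * (\<integral>\<omega>. max 0 (Z 1 \<omega>) \<partial>N)"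
    unfolding expectation_grid_max .
  then show ?thesis
    by (intro has_bochner_integral_monotone_convergence[where f = ?G] G_int H_meas AE_I2 G_lim incseq_grid_max)
qed

end

section \<open>The expected first intrinsic volume\<close>

lemma levy_process_inner:
  fixes X :: "real \<Rightarrow> 'p \<Rightarrow> 'a::euclidean_space"
  assumes X: "levy_process N X"
  shows "levy_process N (\<lambda>t \<omega>. X t \<omega> \<bullet> u)"
proof -
  interpret prob_space N using X by (simp add: levy_process_def)
  have X_meas [measurable]: "X t \<in> borel_measurable N" if "t \<ge> 0" for t
    using X that by (simp add: levy_process_def)
  show ?thesis
    unfolding levy_process_def
  proof (intro conjI allI impI ballI)
    show "AE \<omega> in N. X 0 \<omega> \<bullet> u = 0"
    proof -
      have "AE \<omega> in N. X 0 \<omega> = 0" using X by (simp add: levy_process_def)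
      then show ?thesis by (rule eventually_mono) simp
    qed
  next
    fix n :: nat and t :: "nat \<Rightarrow> real" assume t: "0 \<le> t 0 \<and> (\<forall>i<n. t i \<le> t (Suc i))"
    have "\<forall>(n::nat) t. 0 \<le> t 0 \<and> (\<forall>i<n. t i \<le> t (Suc i)) \<longrightarrow>
        indep_vars (\<lambda>_. borel) (\<lambda>i \<omega>. X (t (Suc i)) \<omega> - X (t i) \<omega>) {..<n}"
      using X unfolding levy_process_def by blast
    from this[rule_format, OF t]
    have "indep_vars (\<lambda>_. borel) (\<lambda>i \<omega>. (X (t (Suc i)) \<omega> - X (t i) \<omega>) \<bullet> u) {..<n}"
      by (rule indep_vars_compose2) auto
    then show "indep_vars (\<lambda>_. borel) (\<lambda>i \<omega>. X (t (Suc i)) \<omega> \<bullet> u - X (t i) \<omega> \<bullet> u) {..<n}"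
      by (simp add: inner_diff_left)
  next
    fix s t :: real assume st: "0 \<le> s" "0 \<le> t"
    have "distr N borel (\<lambda>\<omega>. X (s + t) \<omega> - X s \<omega>) = distr N borel (X t)"
      using X st by (simp add: levy_process_def)
    then have "distr (distr N borel (\<lambda>\<omega>. X (s + t) \<omega> - X s \<omega>)) borel (\<lambda>x. x \<bullet> u) = distr (distr N borel (X t)) borel (\<lambda>x. x \<bullet> u)"
      by simp
    then show "distr N borel (\<lambda>\<omega>. X (s + t) \<omega> \<bullet> u - X s \<omega> \<bullet> u) = distr N borel (\<lambda>\<omega>. X t \<omega> \<bullet> u)"
      using st by (simp add: distr_distr comp_def inner_diff_left)
  next
    fix \<omega> assume "\<omega> \<in> space N"
    then have "cadlag (\<lambda>t. X t \<omega>)" using X by (simp add: levy_process_def)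
    then show "cadlag (\<lambda>t. X t \<omega> \<bullet> u)"
      unfolding cadlag_def by (fast intro: tendsto_inner[OF _ tendsto_const])
  qed (auto intro: prob_space_axioms)
qed

text \<open>A closed half-space containing \<open>T\<close> also contains its closure and then the
  convex hull of that closure.\<close>

lemma support_fun_hull_closure:
  fixes T :: "'a::euclidean_space set"
  assumes T: "bounded T" "T \<noteq> {}"
  shows "support_fun (convex hull (closure T)) x = support_fun T x"
proof (rule antisym)
  let ?K = "convex hull (closure T)"
  have sub: "T \<subseteq> ?K" using closure_subset hull_subset by (rule order_trans)
  have K: "bounded ?K" using T(1) by (intro bounded_convex_hull bounded_closure)
  have "T \<subseteq> {a. a \<bullet> x \<le> support_fun T x}" using support_fun_upper[OF T(1)] by blast
  then have "closure T \<subseteq> {a. a \<bullet> x \<le> support_fun T x}"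
    by (rule closure_minimal) (simp add: inner_commute[of _ x] closed_halfspace_le)
  then have "?K \<subseteq> {a. a \<bullet> x \<le> support_fun T x}"
    by (rule hull_minimal) (simp add: inner_commute[of _ x] convex_halfspace_le)
  then show "support_fun ?K x \<le> support_fun T x"
    unfolding support_fun_def[of ?K] using sub T(2) by (intro cSUP_least) auto
  show "support_fun T x \<le> support_fun ?K x"
    unfolding support_fun_def[of T] using sub T(2) support_fun_upper[OF K] by (intro cSUP_least) auto
qed

lemma cSUP_diff_const:
  fixes f :: "'b \<Rightarrow> real"
  assumes "bdd_above (f ` T)" "T \<noteq> {}"
  shows "(SUP t\<in>T. f t - c) = (SUP t\<in>T. f t) - c"
proof (rule antisym)
  show "(SUP t\<in>T. f t - c) \<le> (SUP t\<in>T. f t) - c"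
    using assms by (intro cSUP_least diff_right_mono cSUP_upper)
  obtain B where "\<And>t. t \<in> T \<Longrightarrow> f t \<le> B" using assms(1) by (auto simp: bdd_above_def)
  then have "bdd_above ((\<lambda>t. f t - c) ` T)" by (intro bdd_aboveI2[of _ _ "B - c"]) auto
  then have "f t \<le> (SUP t\<in>T. f t - c) + c" if "t \<in> T" for t
    using cSUP_upper[OF that, of "\<lambda>t. f t - c"] by simp
  then have "(SUP t\<in>T. f t) \<le> (SUP t\<in>T. f t - c) + c"
    using assms(2) by (intro cSUP_least)
  then show "(SUP t\<in>T. f t) - c \<le> (SUP t\<in>T. f t - c)" by simp
qed

theorem corollary3p4:
  fixes \<alpha> :: real
    and M :: "'m measure" and Y :: "nat \<Rightarrow> 'm \<Rightarrow> real ^ 'd"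
    and N :: "'p measure" and X :: "real \<Rightarrow> 'p \<Rightarrow> real ^ 'd"
    and b :: "nat \<Rightarrow> real" and l :: "real \<Rightarrow> real"
  assumes alpha: "1 < \<alpha>" "\<alpha> \<le> 2"
    and prob: "prob_space M"
    and indep: "prob_space.indep_vars M (\<lambda>_. borel) Y {1..}"
    and ident: "\<And>i. i \<ge> 1 \<Longrightarrow> distr M borel (Y i) = distr M borel (Y 1)"
    and centered: "integrable M (Y 1)" "(\<integral>\<omega>. Y 1 \<omega> \<partial>M) = 0"
    and b_pos: "\<And>n. n \<ge> 1 \<Longrightarrow> b n > 0"
    and l_slow: "slowly_varying l"
    and b_eq: "\<And>n. n \<ge> 1 \<Longrightarrow> b n = real n powr (1 / \<alpha>) * l (real n)"
    and stable: "stable_levy_process \<alpha> N X"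
    and conv: "weakly_converges (\<lambda>n. distr M borel (\<lambda>\<omega>. (\<Sum>i=1..n. Y i \<omega>) /\<^sub>R b n))
                 (distr N borel (X 1))"
  shows "integrable N (\<lambda>\<omega>. intrinsic_volume 1 (convex hull (path_range X \<omega>))) \<and>
         integrable N (\<lambda>\<omega>. norm (X 1 \<omega>)) \<and>
         (\<integral>\<omega>. intrinsic_volume 1 (convex hull (path_range X \<omega>)) \<partial>N) =
           \<alpha> * (\<integral>\<omega>. norm (X 1 \<omega>) \<partial>N)"
proof -
  have levy: "levy_process N X" using stable by (simp add: stable_levy_process_def)
  interpret prob_space N using levy by (simp add: levy_process_def)
  have X_meas [measurable]: "X t \<in> borel_measurable N" if "t \<ge> 0" for t
    using levy that by (simp add: levy_process_def)
  have X_cadlag: "cadlag (\<lambda>t. X t \<omega>)" if "\<omega> \<in> space N" for \<omega>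
    using levy that by (simp add: levy_process_def)
  have S: "strictly_stable_levy N (\<lambda>t \<omega>. X t \<omega> \<bullet> x) \<alpha>" for x
  proof
    show "levy_process N (\<lambda>t \<omega>. X t \<omega> \<bullet> x)" using levy by (rule levy_process_inner)
    have "distr (distr N borel (X 1)) borel (\<lambda>y. y \<bullet> x) = distr N borel (\<lambda>\<omega>. X 1 \<omega> \<bullet> x)"
      by (subst distr_distr) (auto simp: comp_def)
    then show "char (distr N borel (\<lambda>\<omega>. X 1 \<omega> \<bullet> x)) t ^ m = char (distr N borel (\<lambda>\<omega>. X 1 \<omega> \<bullet> x)) (real m powr (1 / \<alpha>) * t)"
      if "m \<ge> 1" for m t
      using strictly_stable_of_weak_limit[OF prob indep ident b_pos l_slow b_eq conv, of m x t] that
      by (simp add: prob_space_distr)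
  qed (rule alpha)
  define c where "c x = (\<integral>\<omega>. max 0 (X 1 \<omega> \<bullet> x) \<partial>N)" for x
  \<comment> \<open>Subtracting the value at time 0 makes \<open>H\<close> the limit of grid maxima,
    hence nonnegative, on every path and not merely almost everywhere.\<close>
  define H where "H \<omega> x = (SUP t\<in>{0..1}. X t \<omega> \<bullet> x - X 0 \<omega> \<bullet> x)" for \<omega> x
  define w where "w x = 2 * pi * exp (- (pi * (norm x)\<^sup>2))" for x :: "real^'d"
  have w: "w x \<ge> 0" "w \<in> borel_measurable borel" for x by (auto simp: w_def[abs_def])
  have int_inner: "integrable N (\<lambda>\<omega>. X 1 \<omega> \<bullet> x)" for x
    using strictly_stable_levy.integrable_Z1[OF S[of x]] .
  have int_norm: "integrable N (\<lambda>\<omega>. norm (X 1 \<omega>))"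
  proof (rule Bochner_Integration.integrable_bound)
    show "integrable N (\<lambda>\<omega>. \<Sum>b\<in>Basis. \<bar>X 1 \<omega> \<bullet> b\<bar>)"
      using int_inner by (intro Bochner_Integration.integrable_sum integrable_abs)
    show "AE \<omega> in N. norm (norm (X 1 \<omega>)) \<le> norm (\<Sum>b\<in>Basis. \<bar>X 1 \<omega> \<bullet> b\<bar>)"
      using norm_le_l1 by (intro AE_I2) (simp add: sum_nonneg)
  qed simp
  have H_int: "has_bochner_integral N (\<lambda>\<omega>. H \<omega> x) (\<alpha> * c x)" for x
    using strictly_stable_levy.expectation_path_max[OF S[of x]] unfolding H_def c_def .
  have inner_cadlag: "cadlag (\<lambda>t. X t \<omega> \<bullet> x)" if "\<omega> \<in> space N" for \<omega> x
    using levy_process_inner[OF levy, of x] that by (simp add: levy_process_def)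
  let ?G = "\<lambda>j p. walk_max (2 ^ j) (grid_increment (\<lambda>t. X t (fst p) \<bullet> snd p) j)"
  have G_lim: "(\<lambda>j. ?G j (\<omega>, x)) \<longlonglongrightarrow> H \<omega> x" if "\<omega> \<in> space N" for \<omega> x
    using grid_max_tendsto[OF inner_cadlag[OF that, of x]] by (simp add: H_def)
  have H_nonneg: "H \<omega> x \<ge> 0" if "\<omega> \<in> space N" for \<omega> x
    using G_lim[OF that] by (rule LIMSEQ_le_const) (auto simp: walk_max_nonneg)
  have inner_meas: "(\<lambda>p. X t (fst p) \<bullet> snd p) \<in> borel_measurable (N \<Otimes>\<^sub>M lborel)" if "t \<ge> 0" for t
  proof (rule borel_measurable_inner)
    show "(\<lambda>p. X t (fst p)) \<in> borel_measurable (N \<Otimes>\<^sub>M lborel)"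
      using measurable_compose[OF measurable_fst X_meas[OF that]] .
    show "snd \<in> borel_measurable (N \<Otimes>\<^sub>M lborel)"
      using measurable_snd[of N lborel] by (simp add: measurable_lborel1)
  qed
  \<comment> \<open>The supremum ranges over uncountably many times; joint measurability in the path
    and the direction comes from the countable grid approximation.\<close>
  have H_meas: "(\<lambda>p. H (fst p) (snd p)) \<in> borel_measurable (N \<Otimes>\<^sub>M lborel)"
  proof (rule borel_measurable_LIMSEQ_real)
    show "?G j \<in> borel_measurable (N \<Otimes>\<^sub>M lborel)" for j
      by (intro measurable_walk_max borel_measurable_diff inner_meas) auto
    show "(\<lambda>j. ?G j p) \<longlonglongrightarrow> H (fst p) (snd p)" if "p \<in> space (N \<Otimes>\<^sub>M lborel)" for p
      using that G_lim[of "fst p" "snd p"] by (auto simp: space_pair_measure)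
  qed
  let ?K = "\<lambda>\<omega>. convex hull (path_range X \<omega>)"
  have V: "has_bochner_integral lborel (\<lambda>x. w x * (H \<omega> x + X 0 \<omega> \<bullet> x)) (intrinsic_volume 1 (?K \<omega>))"
    if \<omega>: "\<omega> \<in> space N" for \<omega>
  proof -
    let ?T = "(\<lambda>t. X t \<omega>) ` {0..1}"
    have T: "bounded ?T" "?T \<noteq> {}"
      using cadlag_bounded[OF X_cadlag[OF \<omega>], of 1] by auto
    have K: "compact (?K \<omega>)" "?K \<omega> \<noteq> {}"
      using T unfolding path_range_def by (auto intro!: compact_convex_hull simp: compact_closure)
    have supp: "support_fun (?K \<omega>) x = H \<omega> x + X 0 \<omega> \<bullet> x" for x
    proof -
      have "support_fun (?K \<omega>) x = (SUP t\<in>{0..1}. X t \<omega> \<bullet> x)"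
        unfolding path_range_def support_fun_hull_closure[OF T] by (simp add: support_fun_def image_image)
      moreover have "bdd_above ((\<lambda>t. X t \<omega> \<bullet> x) ` {0..1})"
        using bounded_inner_image[OF T(1), of x] by (simp add: image_image)
      then have "H \<omega> x = (SUP t\<in>{0..1}. X t \<omega> \<bullet> x) - X 0 \<omega> \<bullet> x"
        unfolding H_def by (intro cSUP_diff_const) auto
      ultimately show ?thesis by simp
    qed
    have "w x * (H \<omega> x + X 0 \<omega> \<bullet> x) = 2 * pi * support_fun (?K \<omega>) x * exp (- (pi * (norm x)\<^sup>2))" for x
      unfolding supp w_def by (simp only: mult_ac)
    then show ?thesis
      using intrinsic_volume_1_gaussian[OF K(1) convex_convex_hull K(2)] by (simp only:)
  qed
  \<comment> \<open>Measurability in \<open>\<omega>\<close> is inherited from the parameter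
    integral, so no measurability of the random convex hull itself is discussed.\<close>
  have V_meas: "(\<lambda>\<omega>. intrinsic_volume 1 (?K \<omega>)) \<in> borel_measurable N"
  proof -
    have "(\<lambda>p. w (snd p) * (H (fst p) (snd p) + X 0 (fst p) \<bullet> snd p)) \<in> borel_measurable (N \<Otimes>\<^sub>M lborel)"
      using H_meas inner_meas[of 0] w(2)
      by (intro borel_measurable_times borel_measurable_add measurable_compose[OF measurable_snd, of w]) auto
    then have "(\<lambda>\<omega>. \<integral>x. w x * (H \<omega> x + X 0 \<omega> \<bullet> x) \<partial>lborel) \<in> borel_measurable N"
      by (intro lborel.borel_measurable_lebesgue_integral) (simp add: case_prod_beta')
    then show ?thesis
      by (rule measurable_cong[THEN iffD1, rotated]) (rule has_bochner_integral_integral_eq[OF V])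
  qed
  have X0: "AE \<omega> in N. X 0 \<omega> = 0" using levy by (simp add: levy_process_def)
  \<comment> \<open>Almost everywhere the term with \<open>X 0\<close> drops out and the integrand
    is nonnegative, which prepares the interchange of integrals for nonnegative functions.\<close>
  have V_nn: "AE \<omega> in N. ennreal (intrinsic_volume 1 (?K \<omega>)) = (\<integral>\<^sup>+x. ennreal (w x) * ennreal (H \<omega> x) \<partial>lborel)
      \<and> 0 \<le> intrinsic_volume 1 (?K \<omega>)"
    using X0 AE_space
  proof eventually_elim
    case (elim \<omega>)
    have *: "has_bochner_integral lborel (\<lambda>x. w x * H \<omega> x) (intrinsic_volume 1 (?K \<omega>))"
      using V[OF elim(2)] elim(1) by simp
    have nn: "0 \<le> w x * H \<omega> x" for x using w H_nonneg[OF elim(2)] by simp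
    have "(\<integral>\<^sup>+x. ennreal (w x * H \<omega> x) \<partial>lborel) = ennreal (intrinsic_volume 1 (?K \<omega>))"
      using * nn by (subst nn_integral_eq_integral) (auto simp: has_bochner_integral_iff)
    moreover have "0 \<le> (\<integral>x. w x * H \<omega> x \<partial>lborel)"
      using nn by (rule Bochner_Integration.integral_nonneg)
    ultimately show ?case
      using w by (simp add: ennreal_mult' has_bochner_integral_integral_eq[OF *])
  qed
  interpret NL: pair_sigma_finite N "lborel :: (real^'d) measure" ..
  have H_nn: "(\<integral>\<^sup>+\<omega>. ennreal (H \<omega> x) \<partial>N) = (\<integral>\<^sup>+\<omega>. ennreal (\<alpha> * max 0 (X 1 \<omega> \<bullet> x)) \<partial>N)" for x
  proof -
    have "(\<integral>\<^sup>+\<omega>. ennreal (H \<omega> x) \<partial>N) = ennreal (\<alpha> * c x)"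
      using H_int[of x] H_nonneg by (subst nn_integral_eq_integral) (auto simp: has_bochner_integral_iff)
    also have "\<alpha> * c x = (\<integral>\<omega>. \<alpha> * max 0 (X 1 \<omega> \<bullet> x) \<partial>N)"
      by (simp add: c_def)
    also have "ennreal \<dots> = (\<integral>\<^sup>+\<omega>. ennreal (\<alpha> * max 0 (X 1 \<omega> \<bullet> x)) \<partial>N)"
      using int_inner alpha by (intro nn_integral_eq_integral[symmetric] integrable_mult_right integrable_max AE_I2) auto
    finally show ?thesis .
  qed
  have "(\<integral>\<^sup>+\<omega>. ennreal (intrinsic_volume 1 (?K \<omega>)) \<partial>N) = (\<integral>\<^sup>+\<omega>. \<integral>\<^sup>+x. ennreal (w x) * ennreal (H \<omega> x) \<partial>lborel \<partial>N)"
    using V_nn by (intro nn_integral_cong_AE) auto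
  also have "\<dots> = (\<integral>\<^sup>+x. \<integral>\<^sup>+\<omega>. ennreal (w x) * ennreal (H \<omega> x) \<partial>N \<partial>lborel)"
  proof (rule NL.Fubini'[symmetric])
    show "(\<lambda>(\<omega>, x). ennreal (w x) * ennreal (H \<omega> x)) \<in> borel_measurable (N \<Otimes>\<^sub>M lborel)"
      using H_meas measurable_compose[OF measurable_snd, of w lborel borel N] w(2) by (simp add: case_prod_beta')
  qed
  also have "\<dots> = (\<integral>\<^sup>+x. \<integral>\<^sup>+\<omega>. ennreal (w x) * ennreal (\<alpha> * max 0 (X 1 \<omega> \<bullet> x)) \<partial>N \<partial>lborel)"
  proof (rule nn_integral_cong)
    fix x
    have "(\<lambda>\<omega>. H \<omega> x) \<in> borel_measurable N"
      using H_int[of x] by (simp add: has_bochner_integral_iff borel_measurable_integrable)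
    then show "(\<integral>\<^sup>+\<omega>. ennreal (w x) * ennreal (H \<omega> x) \<partial>N) = (\<integral>\<^sup>+\<omega>. ennreal (w x) * ennreal (\<alpha> * max 0 (X 1 \<omega> \<bullet> x)) \<partial>N)"
      by (simp add: nn_integral_cmult H_nn)
  qed
  also have "\<dots> = (\<integral>\<^sup>+\<omega>. \<integral>\<^sup>+x. ennreal (w x) * ennreal (\<alpha> * max 0 (X 1 \<omega> \<bullet> x)) \<partial>lborel \<partial>N)"
  proof (rule NL.Fubini'[where f = "\<lambda>\<omega> x. ennreal (w x) * ennreal (\<alpha> * max 0 (X 1 \<omega> \<bullet> x))"])
    show "(\<lambda>(\<omega>, x). ennreal (w x) * ennreal (\<alpha> * max 0 (X 1 \<omega> \<bullet> x))) \<in> borel_measurable (N \<Otimes>\<^sub>M lborel)"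
      using inner_meas[of 1] measurable_compose[OF measurable_snd, of w lborel borel N] w(2) by (simp add: case_prod_beta')
  qed
  also have "\<dots> = (\<integral>\<^sup>+\<omega>. ennreal (\<alpha> * norm (X 1 \<omega>)) \<partial>N)"
  proof (intro nn_integral_cong)
    fix \<omega>
    have "(\<integral>\<^sup>+x. ennreal (w x) * ennreal (\<alpha> * max 0 (X 1 \<omega> \<bullet> x)) \<partial>lborel)
        = (\<integral>\<^sup>+x. ennreal \<alpha> * ennreal (2 * pi * max 0 (x \<bullet> X 1 \<omega>) * exp (- (pi * (norm x)\<^sup>2))) \<partial>lborel)"
    proof (rule nn_integral_cong)
      fix x
      have "ennreal (w x) * ennreal (\<alpha> * max 0 (X 1 \<omega> \<bullet> x)) = ennreal (w x * (\<alpha> * max 0 (X 1 \<omega> \<bullet> x)))"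
        using w(1) alpha by (intro ennreal_mult[symmetric]) auto
      also have "w x * (\<alpha> * max 0 (X 1 \<omega> \<bullet> x)) = \<alpha> * (2 * pi * max 0 (x \<bullet> X 1 \<omega>) * exp (- (pi * (norm x)\<^sup>2)))"
        unfolding w_def inner_commute[of x] by (simp only: mult_ac)
      also have "ennreal \<dots> = ennreal \<alpha> * ennreal (2 * pi * max 0 (x \<bullet> X 1 \<omega>) * exp (- (pi * (norm x)\<^sup>2)))"
        using alpha by (intro ennreal_mult) auto
      finally show "ennreal (w x) * ennreal (\<alpha> * max 0 (X 1 \<omega> \<bullet> x))
        = ennreal \<alpha> * ennreal (2 * pi * max 0 (x \<bullet> X 1 \<omega>) * exp (- (pi * (norm x)\<^sup>2)))" .
    qed
    \<comment> \<open>The same Gaussian average that produced V_1 on the left now yields the norm of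
      \<open>X 1\<close>.\<close>
    also have "\<dots> = ennreal \<alpha> * ennreal (norm (X 1 \<omega>))"
      by (subst nn_integral_cmult) (auto simp: gaussian_half_moment)
    finally show "(\<integral>\<^sup>+x. ennreal (w x) * ennreal (\<alpha> * max 0 (X 1 \<omega> \<bullet> x)) \<partial>lborel) = ennreal (\<alpha> * norm (X 1 \<omega>))"
      using alpha by (simp add: ennreal_mult')
  qed
  also have "\<dots> = ennreal (\<alpha> * (\<integral>\<omega>. norm (X 1 \<omega>) \<partial>N))"
    using int_norm alpha by (subst nn_integral_eq_integral) auto
  finally have "has_bochner_integral N (\<lambda>\<omega>. intrinsic_volume 1 (?K \<omega>)) (\<alpha> * (\<integral>\<omega>. norm (X 1 \<omega>) \<partial>N))"
    using V_meas V_nn alpha by (intro has_bochner_integral_nn_integral) (auto intro: eventually_mono)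
  then show ?thesis
    using int_norm by (simp add: has_bochner_integral_iff)
qed

end
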